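(* Let $1<p<\infty$ and let $\mu$ be a locally doubling measure on $\mathbb{R}$ supporting a local $p$-Poincaré inequality. Then the following are equivalent: (a) There exists a bounded nonconstant $p$-harmonic function on $(\mathbb{R},\mu)$. (b) There exists a nonconstant $p$-harmonic function with finite energy on $(\mathbb{R},\mu)$. (c) There exists a bounded nonconstant quasiharmonic function on $(\mathbb{R},\mu)$. (d) There exists a nonconstant quasiharmonic function with finite energy on $(\mathbb{R},\mu)$. (e) There is a weight $w$ such that $d\mu=w\,dx$ and $$\int_{-\infty}^\infty w^{1/(1-p)}\,dx<\infty.$$
   Context: $1<p<\infty$; $X=(\mathbb{R},\mu)$ is the real line with the Euclidean metric and a positive complete Borel measure $\mu$ with $0<\mu(B)<\infty$ for all balls (bounded open intervals) $B$. For a ball $B=B(x,r)$, $\lambda B=B(x,\lambda r)$, $r_B=r$. Upper gradients. Curves are nonconstant, compact and rectifiable, parameterized by arc length $ds$. A property holds for $p$-almost every curve if for the family $\Gamma$ of curves for which it fails there is a Borel function $0\le\rho\in L^p(X)$ with $\int_\gamma\rho\,ds=\infty$ for all $\gamma\in\Gamma$. A measurable $g:X\to[0,\infty]$ is a $p$-weak upper gradient of $u:X\to[-\infty,\infty]$ if for $p$-almost every curve $\gamma:[0,l_\gamma]\to X$, $|u(\gamma(0))-u(\gamma(l_\gamma))|\le\int_\gamma g\,ds$ (left-hand side $\infty$ if a term is $\pm\infty$). If $u$ has a $p$-weak upper gradient in $L^p_{\rm loc}$, then $g_u$ denotes the minimal one (a.e. smallest). For measurable $u$, $\|u\|_{N^{1,p}(X)}^p=\int_X|u|^p\,d\mu+\inf_g\int_Xg^p\,d\mu$,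 infimum over $p$-weak upper gradients $g$ of $u$, and $N^{1,p}(X)=\{u:\|u\|_{N^{1,p}(X)}<\infty\}$; $N^{1,p}(E)$ is defined by regarding a measurable set $E$ as a metric measure space in its own right. Local assumptions. $\mu$ is locally doubling if for every $x_0$ there are $r_0>0$, $C>0$ (depending on $x_0$) with $\mu(2B)\le C\mu(B)$ for all balls $B\subset B(x_0,r_0)$. $\mu$ supports a local $p$-Poincaré inequality if for every $x_0$ there are $r_0>0$, $C>0$, $\lambda\ge1$ (depending on $x_0$) such that for all balls $B\subset B(x_0,r_0)$, all integrable $u$ on $\lambda B$ and all $p$-weak upper gradients $g$ of $u$, $\frac1{\mu(B)}\int_B|u-u_B|\,d\mu\le Cr_B\bigl(\frac1{\mu(\lambda B)}\int_{\lambda B}g^p\,d\mu\bigr)^{1/p}$, where $u_B=\frac1{\mu(B)}\int_Bu\,d\mu$. Quasiharmonic functions. A function $u$ on $X$ with $u\in N^{1,p}(G)$ for every bounded open $G\subset X$ is a quasiminimizer on $X$ if there is $Q\ge1$ with $\int_{\{\varphi\ne0\}}g_u^p\,d\mu\le Q\int_{\{\varphi\ne0\}}g_{u+\varphi}^p\,d\mu$ for all $\varphi$ in the closure in $N^{1,p}(X)$ of the functions in $N^{1,p}(X)$ vanishing outside some bounded open set (this closure is $N^{1,p}(X)$). A continuous (real-valued) quasiminimizer is called quasiharmonic, and $p$-harmonic if $Q=1$ is possible. Finite energy means $\int_Xg_u^p\,d\mu<\infty$. A weight is a nonnegative locally integrable function. *)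

theory Defs
  imports "HOL-Analysis.Analysis"
begin

text \<open>
  Real powers on \<open>[0,\<infinity>]\<close> with the usual conventions \<open>0\<^sup>a = \<infinity>\<close> and \<open>\<infinity>\<^sup>a = 0\<close> for \<open>a < 0\<close>.
  The operator \<open>powr\<close> alone would give \<open>0\<^sup>a = 0\<close>.
\<close>

definition epow :: "ennreal \<Rightarrow> real \<Rightarrow> ennreal" where
  "epow x a =
     (if a = 0 then 1
      else if x = 0 then (if a < 0 then \<infinity> else 0)
      else if x = \<infinity> then (if a < 0 then 0 else \<infinity>)
      else ennreal (enn2real x powr a))"


section \<open>Measures on the real line\<close>

text \<open>
  A complete Borel measure is the completion of a measure on the Borel sigma-algebra; in
  particular it is determined by its values on Borel sets.
\<close>

definition complete_borel_measure :: "real measure \<Rightarrow> bool" where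
  "complete_borel_measure M \<longleftrightarrow> (\<exists>N. sets N = sets borel \<and> M = completion N)"

definition positive_finite_on_balls :: "real measure \<Rightarrow> bool" where
  "positive_finite_on_balls M \<longleftrightarrow>
     (\<forall>x r. 0 < r \<longrightarrow> 0 < emeasure M (ball x r) \<and> emeasure M (ball x r) < \<infinity>)"

definition locally_doubling :: "real measure \<Rightarrow> bool" where
  "locally_doubling M \<longleftrightarrow>
     (\<forall>x0. \<exists>r0>0. \<exists>C>0. \<forall>x r. 0 < r \<and> ball x r \<subseteq> ball x0 r0 \<longrightarrow>
        emeasure M (ball x (2 * r)) \<le> ennreal C * emeasure M (ball x r))"

definition weight :: "(real \<Rightarrow> real) \<Rightarrow> bool" where
  "weight w \<longleftrightarrow> (\<forall>x. 0 \<le> w x) \<and> (\<forall>a b. set_integrable lebesgue {a..b} w)"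

text \<open>
  The relation \<open>d\<mu> = w dx\<close>. Comparing the two measures on Borel sets suffices, as complete Borel
  measures are completions of their Borel restrictions.
\<close>

definition has_weight :: "real measure \<Rightarrow> (real \<Rightarrow> real) \<Rightarrow> bool" where
  "has_weight M w \<longleftrightarrow> (\<forall>A\<in>sets borel. emeasure M A = (\<integral>\<^sup>+x\<in>A. ennreal (w x) \<partial>lebesgue))"


section \<open>Curves and weak upper gradients\<close>

definition curve_length :: "(real \<Rightarrow> real) \<Rightarrow> real \<Rightarrow> real \<Rightarrow> ennreal" where
  "curve_length \<gamma> a b =
     (SUP ts \<in> {ts. sorted ts \<and> set ts \<subseteq> {a..b}}.
        \<Sum>i<length ts - 1. ennreal (dist (\<gamma> (ts ! i)) (\<gamma> (ts ! Suc i))))"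

text \<open>
  Curves in \<open>E\<close> parameterized by arc length on \<open>[0,l]\<close>. Such a curve is 1-Lipschitz, hence
  continuous, and \<open>0 < l\<close> says that it is nonconstant.
\<close>

definition arc_curve :: "real set \<Rightarrow> (real \<Rightarrow> real) \<Rightarrow> real \<Rightarrow> bool" where
  "arc_curve E \<gamma> l \<longleftrightarrow>
     0 < l \<and> \<gamma> ` {0..l} \<subseteq> E \<and>
     (\<forall>s t. 0 \<le> s \<and> s \<le> t \<and> t \<le> l \<longrightarrow> curve_length \<gamma> s t = ennreal (t - s))"

definition curve_integral :: "(real \<Rightarrow> ennreal) \<Rightarrow> (real \<Rightarrow> real) \<Rightarrow> real \<Rightarrow> ennreal" where
  "curve_integral g \<gamma> l = (\<integral>\<^sup>+t\<in>{0..l}. g (\<gamma> t) \<partial>lebesgue)"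

text \<open>
  Below, a set \<open>E\<close> is regarded as a metric measure space in its own right: only curves in \<open>E\<close>
  and the restriction of the measure to \<open>E\<close> enter.
\<close>

definition pae_curve ::
  "real \<Rightarrow> real measure \<Rightarrow> real set \<Rightarrow> ((real \<Rightarrow> real) \<Rightarrow> real \<Rightarrow> bool) \<Rightarrow> bool" where
  "pae_curve p M E P \<longleftrightarrow>
     (\<exists>\<rho> \<in> borel_measurable (restrict_space borel E).
        (\<integral>\<^sup>+x\<in>E. epow (\<rho> x) p \<partial>M) < \<infinity> \<and>
        (\<forall>\<gamma> l. arc_curve E \<gamma> l \<and> \<not> P \<gamma> l \<longrightarrow> curve_integral \<rho> \<gamma> l = \<infinity>))"

text \<open>
  If \<open>M\<close> is a complete Borel measure and \<open>g\<close> is \<open>M\<close>-measurable, then \<open>g\<close> agrees outside a Borel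
  null set with a Borel function, so \<open>g \<circ> \<gamma>\<close> is Lebesgue measurable for p-almost every curve
  \<open>\<gamma>\<close>. Curves for which it is not are thus irrelevant.
\<close>

definition weak_upper_gradient ::
  "real \<Rightarrow> real measure \<Rightarrow> real set \<Rightarrow> (real \<Rightarrow> ereal) \<Rightarrow> (real \<Rightarrow> ennreal) \<Rightarrow> bool" where
  "weak_upper_gradient p M E u g \<longleftrightarrow>
     g \<in> borel_measurable (restrict_space M E) \<and>
     pae_curve p M E (\<lambda>\<gamma> l.
       (if \<bar>u (\<gamma> 0)\<bar> = \<infinity> \<or> \<bar>u (\<gamma> l)\<bar> = \<infinity> then \<infinity> else e2ennreal \<bar>u (\<gamma> 0) - u (\<gamma> l)\<bar>)
         \<le> curve_integral g \<gamma> l)"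

definition Lp_loc :: "real \<Rightarrow> real measure \<Rightarrow> (real \<Rightarrow> ennreal) \<Rightarrow> bool" where
  "Lp_loc p M g \<longleftrightarrow>
     g \<in> borel_measurable M \<and> (\<forall>x. \<exists>r>0. (\<integral>\<^sup>+y\<in>ball x r. epow (g y) p \<partial>M) < \<infinity>)"

definition is_min_weak_upper_gradient ::
  "real \<Rightarrow> real measure \<Rightarrow> (real \<Rightarrow> ereal) \<Rightarrow> (real \<Rightarrow> ennreal) \<Rightarrow> bool" where
  "is_min_weak_upper_gradient p M u g \<longleftrightarrow>
     weak_upper_gradient p M UNIV u g \<and> Lp_loc p M g \<and>
     (\<forall>h. weak_upper_gradient p M UNIV u h \<and> Lp_loc p M h \<longrightarrow> (AE x in M. g x \<le> h x))"

text \<open>The function \<open>g\<^sub>u\<close>, which is unique up to null sets.\<close>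

definition min_wug :: "real \<Rightarrow> real measure \<Rightarrow> (real \<Rightarrow> ereal) \<Rightarrow> real \<Rightarrow> ennreal" where
  "min_wug p M u = (SOME g. is_min_weak_upper_gradient p M u g)"

definition local_poincare :: "real \<Rightarrow> real measure \<Rightarrow> bool" where
  "local_poincare p M \<longleftrightarrow>
     (\<forall>x0. \<exists>r0>0. \<exists>C>0. \<exists>L\<ge>1. \<forall>x r. 0 < r \<and> ball x r \<subseteq> ball x0 r0 \<longrightarrow>
        (\<forall>u g. u \<in> borel_measurable (restrict_space M (ball x (L * r))) \<and>
               (\<integral>\<^sup>+y\<in>ball x (L * r). e2ennreal \<bar>u y\<bar> \<partial>M) < \<infinity> \<and>
               weak_upper_gradient p M (ball x (L * r)) u g \<longrightarrow>
           (let uB = (LINT y:ball x r|M. real_of_ereal (u y)) / measure M (ball x r) in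
            (\<integral>\<^sup>+y\<in>ball x r. e2ennreal \<bar>u y - ereal uB\<bar> \<partial>M) / emeasure M (ball x r)
              \<le> ennreal (C * r) *
                epow ((\<integral>\<^sup>+y\<in>ball x (L * r). epow (g y) p \<partial>M) / emeasure M (ball x (L * r)))
                     (1 / p))))"


section \<open>Newtonian functions and quasiharmonic functions\<close>

definition N1p_norm :: "real \<Rightarrow> real measure \<Rightarrow> real set \<Rightarrow> (real \<Rightarrow> ereal) \<Rightarrow> ennreal" where
  "N1p_norm p M E u =
     epow ((\<integral>\<^sup>+x\<in>E. epow (e2ennreal \<bar>u x\<bar>) p \<partial>M) +
           (INF g \<in> {g. weak_upper_gradient p M E u g}. \<integral>\<^sup>+x\<in>E. epow (g x) p \<partial>M))
          (1 / p)"

definition N1p :: "real \<Rightarrow> real measure \<Rightarrow> real set \<Rightarrow> (real \<Rightarrow> ereal) set" where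
  "N1p p M E = {u \<in> borel_measurable (restrict_space M E). N1p_norm p M E u < \<infinity>}"

definition N1p_bounded_support :: "real \<Rightarrow> real measure \<Rightarrow> (real \<Rightarrow> ereal) set" where
  "N1p_bounded_support p M =
     {\<psi> \<in> N1p p M UNIV. \<exists>G. open G \<and> bounded G \<and> (\<forall>x. x \<notin> G \<longrightarrow> \<psi> x = 0)}"

text \<open>
  Closure in the seminorm. In \<open>ereal\<close> one has \<open>\<infinity> - \<infinity> = \<infinity>\<close>, so differences and sums are total;
  Newtonian functions are infinite only on sets of zero capacity, where values are irrelevant.
\<close>

definition test_functions :: "real \<Rightarrow> real measure \<Rightarrow> (real \<Rightarrow> ereal) set" where
  "test_functions p M =
     {\<phi> \<in> N1p p M UNIV. \<forall>\<epsilon>>0. \<exists>\<psi> \<in> N1p_bounded_support p M.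
        N1p_norm p M UNIV (\<lambda>x. \<phi> x - \<psi> x) < ennreal \<epsilon>}"

definition quasiminimizer :: "real \<Rightarrow> real measure \<Rightarrow> real \<Rightarrow> (real \<Rightarrow> ereal) \<Rightarrow> bool" where
  "quasiminimizer p M Q u \<longleftrightarrow>
     (\<forall>G. open G \<and> bounded G \<longrightarrow> u \<in> N1p p M G) \<and>
     (\<forall>\<phi> \<in> test_functions p M.
        (\<integral>\<^sup>+x\<in>{x. \<phi> x \<noteq> 0}. epow (min_wug p M u x) p \<partial>M)
          \<le> ennreal Q *
            (\<integral>\<^sup>+x\<in>{x. \<phi> x \<noteq> 0}. epow (min_wug p M (\<lambda>y. u y + \<phi> y) x) p \<partial>M))"

definition quasiharmonic :: "real \<Rightarrow> real measure \<Rightarrow> (real \<Rightarrow> real) \<Rightarrow> bool" where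
  "quasiharmonic p M u \<longleftrightarrow>
     continuous_on UNIV u \<and> (\<exists>Q\<ge>1. quasiminimizer p M Q (\<lambda>x. ereal (u x)))"

definition p_harmonic :: "real \<Rightarrow> real measure \<Rightarrow> (real \<Rightarrow> real) \<Rightarrow> bool" where
  "p_harmonic p M u \<longleftrightarrow> continuous_on UNIV u \<and> quasiminimizer p M 1 (\<lambda>x. ereal (u x))"

definition finite_energy :: "real \<Rightarrow> real measure \<Rightarrow> (real \<Rightarrow> real) \<Rightarrow> bool" where
  "finite_energy p M u \<longleftrightarrow> (\<integral>\<^sup>+x. epow (min_wug p M (\<lambda>y. ereal (u y)) x) p \<partial>M) < \<infinity>"

end

theory Submission
  imports Defs
begin

text \<open>
  Doubling and the Poincare inequality force a measure on the line to have a density \<open>w\<close> for which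
  the \<^emph>\<open>dual weight\<close> \<open>s = w powr (1 / (1 - p))\<close> is locally integrable. The single estimate behind this is
  \<open>bump_estimate\<close>: testing the Poincare inequality with the primitive of a bump \<open>\<rho>\<close> bounds the \<open>p\<close>-th
  power of the Lebesgue integral of \<open>\<rho>\<close> by the integral of \<open>\<rho> powr p\<close> with respect to the measure.
  Indicators of sets as bumps yield that the measure and Lebesgue measure have the same null sets, and the
  truncated dual weight as a bump yields its local integrability.

  Once \<open>s\<close> is locally integrable, Young's inequality \<open>r \<le> t * s + t powr (1 - p) * (r powr p * w)\<close> shows
  that functions in \<open>L\<^sup>p\<close> are integrable along segments. So segments are never exceptional, Newtonian functions
  are exactly the locally absolutely continuous functions with the appropriate integrability, and the
  minimal weak upper gradient is the absolute value of the derivative (\<open>min_wug_primitive\<close>). The problem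
  becomes one about the functional that sends \<open>u\<close> to the integral of \<open>\<bar>u'\<bar> powr p * w\<close>. Its Euler-Lagrange
  equation says that the flux \<open>\<bar>u'\<bar> powr (p - 2) * u' * w\<close> is constant, that is, \<open>u'\<close> is a constant multiple
  of \<open>s\<close>. The oscillation and the energy of a primitive of \<open>s\<close> are both equal to the integral of \<open>s\<close>.

  If \<open>s\<close> is integrable, its primitive is bounded, has finite energy and minimizes energy
  (\<open>p_harmonic_dual_primitive\<close>). If it is not, let \<open>u\<close> be a quasiminimizer and compare it on an interval
  with the \<open>p\<close>-harmonic function that has the same boundary values. The energy of \<open>u\<close> on \<open>{a..b}\<close> is then at
  most \<open>Q * \<bar>u b - u a\<bar> powr p * S powr (1 - p)\<close>, where \<open>S\<close> is the integral of \<open>s\<close> over \<open>{a..b}\<close>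
  (\<open>quasiminimizer_energy_le\<close>). As the interval exhausts the line, \<open>S\<close> tends to infinity, and this bound
  tends to 0: for bounded \<open>u\<close> because the increments stay bounded, and for \<open>u\<close> of finite energy because
  by Young's inequality the increments grow more slowly than \<open>S powr (1 - 1 / p)\<close>. So \<open>u\<close> is constant
  (\<open>quasiharmonic_constant\<close>).
\<close>

section \<open>Powers\<close>

lemma epow_ennreal: "0 < r \<or> (0 < a \<and> 0 \<le> r) \<Longrightarrow> epow (ennreal r) a = ennreal (r powr a)"
  by (auto simp: epow_def)

lemma epow_mono:
  assumes "0 < a" "x \<le> y" shows "epow x a \<le> epow y a"
proof (cases "y = \<infinity>")
  case False
  then have "x \<noteq> \<infinity>" using assms(2) by (auto simp: top_unique)
  then show ?thesis using False assms
    by (auto simp: epow_def less_top enn2real_mono intro!: ennreal_leI powr_mono2)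
qed (use assms in \<open>simp add: epow_def\<close>)

lemma epow_less_top_iff: "0 < a \<Longrightarrow> epow x a < \<infinity> \<longleftrightarrow> x < \<infinity>"
  by (auto simp: epow_def less_top[symmetric])

lemma measurable_epow [measurable]: "(\<lambda>x. epow x a) \<in> borel_measurable borel"
  unfolding epow_def by measurable

lemma epow_inverse: "0 < a \<Longrightarrow> epow (epow x (1 / a)) a = x"
  by (cases "x = \<infinity>") (auto simp: epow_def powr_powr less_top enn2real_eq_0_iff split: if_splits)

text \<open>
  The convex function \<open>\<lambda>t. \<bar>t\<bar> powr p\<close> lies above its tangent at \<open>x\<close>. For \<open>x + z \<ge> 0\<close> this is Young's
  inequality for \<open>x + z\<close> and \<open>x powr (p - 1)\<close>; otherwise the tangent is negative.
\<close>

lemma powr_tangent_le: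
  fixes x z p :: real
  assumes p: "1 < p" and x: "0 < x"
  shows "x powr p + p * x powr (p - 1) * z \<le> \<bar>x + z\<bar> powr p"
proof (cases "0 \<le> x + z")
  case True
  define q where "q = p / (p - 1)"
  have q: "1 < q" "1 / p + 1 / q = 1" using p by (auto simp: q_def field_simps)
  have "(x + z) * x powr (p - 1) \<le> (x + z) powr p / p + (x powr (p - 1)) powr q / q"
    using p q True x by (intro Youngs_inequality) auto
  also have "(x powr (p - 1)) powr q = x powr p"
    using p by (simp add: powr_powr q_def)
  finally have "p * ((x + z) * x powr (p - 1)) \<le> p * ((x + z) powr p / p + x powr p / q)"
    using p by (intro mult_left_mono) auto
  also have "\<dots> = (x + z) powr p + (p - 1) * x powr p"
    using p by (simp add: q_def field_simps)
  finally have "p * ((x + z) * x powr (p - 1)) \<le> (x + z) powr p + (p - 1) * x powr p" .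
  moreover have "x * x powr (p - 1) = x powr p" using x by (simp add: powr_diff)
  ultimately show ?thesis using True by (simp add: algebra_simps)
next
  case False
  have x': "x * x powr (p - 1) = x powr p" using x by (simp add: powr_diff)
  have "p * x powr (p - 1) * z \<le> p * x powr (p - 1) * (- x)"
    using False p by (intro mult_left_mono) auto
  also have "\<dots> = - p * x powr p" using x' by (simp add: mult_ac)
  also have "\<dots> \<le> - (x powr p)"
    using p mult_right_mono[of 1 p "x powr p"] by simp
  finally show ?thesis using powr_ge_zero[of "\<bar>x + z\<bar>" p] by linarith
qed

text \<open>
  For \<open>s = y powr (1 / (1 - p))\<close> the two natural integrands agree: the \<open>p\<close>-energy density
  \<open>s powr p * y\<close> of \<open>s\<close> with weight \<open>y\<close> is \<open>s\<close> itself.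
\<close>

lemma powr_dual_exponent:
  fixes y p :: real
  assumes "1 < p" "0 < y"
  shows "(y powr (1 / (1 - p))) powr p * y = y powr (1 / (1 - p))"
proof -
  have "1 / (1 - p) * p + 1 = 1 / (1 - p)" using assms(1) by (simp add: field_simps)
  moreover have "(y powr (1 / (1 - p))) powr p * y = y powr (1 / (1 - p) * p + 1)"
    using assms(2) by (simp add: powr_powr powr_add)
  ultimately show ?thesis by simp
qed

section \<open>Comparing Borel measures on intervals\<close>

lemma open_bounded_connected_real:
  fixes C :: "real set"
  assumes "open C" "bounded C" "connected C" "C \<noteq> {}"
  shows "\<exists>a b. a < b \<and> C = {a<..<b}"
proof -
  have bd: "bdd_below C" "bdd_above C"
    using assms(2) bounded_imp_bdd_below bounded_imp_bdd_above by auto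
  have in1: "Inf C < x \<and> x < Sup C" if x: "x \<in> C" for x
  proof -
    obtain e where e: "e > 0" "ball x e \<subseteq> C" using assms(1) x open_contains_ball by blast
    then have "x - e/2 \<in> C" "x + e/2 \<in> C" by (auto simp: subset_iff dist_real_def)
    then have "Inf C \<le> x - e/2" "x + e/2 \<le> Sup C" using bd by (auto intro: cInf_lower cSup_upper)
    with e show ?thesis by auto
  qed
  have in2: "x \<in> C" if x: "Inf C < x" "x < Sup C" for x
  proof -
    obtain y where y: "y \<in> C" "y < x" using cInf_lessD[OF assms(4) x(1)] by blast
    obtain z where z: "z \<in> C" "x < z" using less_cSupD[OF assms(4) x(2)] by blast
    show ?thesis using connectedD_interval[OF assms(3) y(1) z(1)] y(2) z(2) by simp
  qed
  have "C = {Inf C<..<Sup C}" using in1 in2 by auto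
  moreover have "Inf C < Sup C" using assms(4) in1 by fastforce
  ultimately show ?thesis by blast
qed

text \<open>
  Outer regularity reduces the comparison to open sets, and the components of an open set reduce
  it to intervals. This is the tool by which inequalities on intervals become inequalities between
  densities almost everywhere.
\<close>

lemma emeasure_le_of_intervals:
  fixes A B :: "real measure"
  assumes sets: "sets A = sets borel" "sets B = sets borel"
    and fin: "\<And>a b. emeasure B {a<..<b} < \<infinity>"
    and le: "\<And>a b. a < b \<Longrightarrow> emeasure A {a<..<b} \<le> emeasure B {a<..<b}"
    and S: "S \<in> sets borel"
  shows "emeasure A S \<le> emeasure B S"
proof -
  note [measurable_cong] = sets
  have sp: "space B = UNIV" using sets(2) by (metis sets_eq_imp_space_eq space_borel)
  \<comment> \<open>An open set is a countable disjoint union of its components, which are open intervals.\<close>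
  have bounded_open: "emeasure A U \<le> emeasure B U" if U: "open U" "bounded U" for U
  proof -
    let ?F = "components U"
    have op: "open C" if "C \<in> ?F" for C using that U open_components by blast
    have dis: "disjoint ?F"
      using pairwise_disjoint_components[of U] by (simp add: disjoint_def pairwise_def disjnt_def)
    have cnt: "countable ?F"
      using dis op countable_disjoint_open_subsets by blast
    have meas: "C \<in> sets borel" if "C \<in> ?F" for C using op[OF that] by simp
    have comp: "emeasure A C \<le> emeasure B C" if C: "C \<in> ?F" for C
    proof -
      have "C \<subseteq> U" "connected C" "C \<noteq> {}" using C in_components_subset in_components_connected
        in_components_nonempty by blast+
      then obtain a b where "a < b" "C = {a<..<b}"
        using open_bounded_connected_real[of C] op[OF C] U(2) bounded_subset by blast
      then show ?thesis using le by simp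
    qed
    have disf: "disjoint_family_on (\<lambda>C. C) ?F"
      using dis by (auto simp: disjoint_family_on_def disjoint_def)
    have "emeasure A U = (\<integral>\<^sup>+C. emeasure A C \<partial>count_space ?F)"
      using emeasure_UN_countable[where I="?F" and X="\<lambda>C. C" and M=A] meas cnt disf by (simp add: sets)
    also have "\<dots> \<le> (\<integral>\<^sup>+C. emeasure B C \<partial>count_space ?F)"
      by (intro nn_integral_mono) (use comp in simp)
    also have "\<dots> = emeasure B U"
      using emeasure_UN_countable[where I="?F" and X="\<lambda>C. C" and M=B] meas cnt disf by (simp add: sets)
    finally show ?thesis .
  qed
  \<comment> \<open>Outer regularity needs a finite measure, hence the truncation to bounded intervals.\<close>
  have part: "emeasure A (S \<inter> {-real n<..<real n}) \<le> emeasure B (S \<inter> {-real n<..<real n})" for n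
  proof -
    let ?I = "{-real n<..<real n}"
    let ?B = "density B (indicator ?I)"
    have eB: "emeasure ?B T = emeasure B (T \<inter> ?I)" if "T \<in> sets borel" for T
      using that by (subst emeasure_density)
        (auto simp: sets indicator_inter_arith[symmetric] Int_commute)
    have "emeasure ?B S = (INF U \<in> {U. S \<subseteq> U \<and> open U}. emeasure ?B U)"
    proof (rule outer_regular)
      show "sets ?B = sets borel" by (simp add: sets)
      show "emeasure ?B (space ?B) \<noteq> \<infinity>" using fin eB[of UNIV] sp by (simp add: less_top)
    qed (rule S)
    moreover have "emeasure A (S \<inter> ?I) \<le> emeasure ?B U" if U: "S \<subseteq> U" "open U" for U
    proof -
      have "emeasure A (S \<inter> ?I) \<le> emeasure A (U \<inter> ?I)"
        using U by (intro emeasure_mono) (auto simp: sets)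
      also have "\<dots> \<le> emeasure B (U \<inter> ?I)"
        by (intro bounded_open) (use U in \<open>auto intro: bounded_subset[of ?I]\<close>)
      finally show ?thesis using U eB[of U] by simp
    qed
    ultimately have "emeasure A (S \<inter> ?I) \<le> emeasure ?B S" by (auto intro: INF_greatest)
    then show ?thesis using eB[OF S] by simp
  qed
  have lim: "(\<lambda>n. emeasure M (S \<inter> {-real n<..<real n})) \<longlonglongrightarrow> emeasure M S"
    if "sets M = sets borel" for M :: "real measure"
  proof -
    have "(\<Union>n. S \<inter> {-real n<..<real n}) = S"
    proof (intro equalityI subsetI)
      fix x assume "x \<in> S"
      moreover obtain n :: nat where "\<bar>x\<bar> < real n" using reals_Archimedean2 by blast
      ultimately show "x \<in> (\<Union>n. S \<inter> {-real n<..<real n})" by (auto intro!: exI[of _ n])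
    qed auto
    moreover have "range (\<lambda>n. S \<inter> {-real n<..<real n}) \<subseteq> sets M"
      using sets.Int[OF S] by (simp add: that image_subset_iff)
    moreover have "incseq (\<lambda>n. S \<inter> {-real n<..<real n})" by (auto simp: incseq_def)
    ultimately show ?thesis using Lim_emeasure_incseq[of "\<lambda>n. S \<inter> {-real n<..<real n}" M] by simp
  qed
  show ?thesis using lim[OF sets(1)] lim[OF sets(2)] part by (intro LIMSEQ_le) auto
qed

lemma nn_integral_Icc_eq_Ioo:
  fixes g :: "real \<Rightarrow> ennreal"
  shows "(\<integral>\<^sup>+x\<in>{a..b}. g x \<partial>lborel) = (\<integral>\<^sup>+x\<in>{a<..<b}. g x \<partial>lborel)"
proof (rule nn_integral_cong_AE)
  have "AE x in lborel. x \<noteq> a" "AE x in lborel. x \<noteq> b" by (auto intro: AE_lborel_singleton)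
  then show "AE x in lborel. g x * indicator {a..b} x = g x * indicator {a<..<b} x"
    by eventually_elim (auto simp: indicator_def)
qed

lemma AE_lborel_of_bounded:
  fixes P :: "real \<Rightarrow> bool"
  assumes "\<And>n::nat. AE x in lborel. x \<in> {-real n..real n} \<longrightarrow> P x"
  shows "AE x in lborel. P x"
proof -
  have "AE x in lborel. \<forall>n::nat. x \<in> {-real n..real n} \<longrightarrow> P x"
    using assms by (subst AE_all_countable) blast
  then show ?thesis
  proof eventually_elim
    case (elim x)
    obtain n :: nat where "\<bar>x\<bar> < real n" using reals_Archimedean2 by blast
    then show ?case using elim[rule_format, of n] by (simp add: abs_less_iff)
  qed
qed

lemma AE_le_of_intervals:
  fixes F G :: "real \<Rightarrow> ennreal"
  assumes [measurable]: "F \<in> borel_measurable borel" "G \<in> borel_measurable borel"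
    and fin: "\<And>a b. (\<integral>\<^sup>+x\<in>{a..b}. G x \<partial>lborel) < \<infinity>"
    and le: "\<And>a b. a < b \<Longrightarrow> (\<integral>\<^sup>+x\<in>{a..b}. F x \<partial>lborel) \<le> (\<integral>\<^sup>+x\<in>{a..b}. G x \<partial>lborel)"
  shows "AE x in lborel. F x \<le> G x"
proof -
  have meas_le: "(\<integral>\<^sup>+x\<in>S. F x \<partial>lborel) \<le> (\<integral>\<^sup>+x\<in>S. G x \<partial>lborel)" if S: "S \<in> sets borel" for S
  proof -
    have "emeasure (density lborel F) S \<le> emeasure (density lborel G) S"
    proof (rule emeasure_le_of_intervals)
      show "emeasure (density lborel G) {a<..<b} < \<infinity>" for a b
        using fin[of a b] by (simp add: emeasure_density nn_integral_Icc_eq_Ioo)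
      show "emeasure (density lborel F) {a<..<b} \<le> emeasure (density lborel G) {a<..<b}"
        if "a < b" for a b
        using le[OF that] by (simp add: emeasure_density nn_integral_Icc_eq_Ioo)
    qed (use S in auto)
    then show ?thesis using S by (simp add: emeasure_density)
  qed
  show ?thesis
  proof (rule AE_lborel_of_bounded)
    fix n :: nat
    \<comment> \<open>On the bounded exceptional set the integral of \<open>F - G > 0\<close> would have to vanish.\<close>
    define S where "S = {x \<in> {-real n..real n}. G x < F x}"
    have S[measurable]: "S \<in> sets borel" unfolding S_def by measurable
    have finS: "(\<integral>\<^sup>+x\<in>S. G x \<partial>lborel) < \<infinity>"
      by (rule le_less_trans[OF nn_integral_mono fin[of "-real n" "real n"]])
        (auto simp: S_def indicator_def)
    have "(\<integral>\<^sup>+x. F x * indicator S x - G x * indicator S x \<partial>lborel)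
        = (\<integral>\<^sup>+x\<in>S. F x \<partial>lborel) - (\<integral>\<^sup>+x\<in>S. G x \<partial>lborel)"
      using finS by (intro nn_integral_diff) (auto simp: S_def indicator_def)
    also have "\<dots> = 0" using meas_le[OF S] by (intro diff_eq_0_ennreal) (use finS in simp_all)
    finally have "AE x in lborel. F x * indicator S x - G x * indicator S x = 0"
      by (subst (asm) nn_integral_0_iff_AE) auto
    then show "AE x in lborel. x \<in> {-real n..real n} \<longrightarrow> F x \<le> G x"
    proof eventually_elim
      case (elim x)
      show ?case
      proof (cases "x \<in> S")
        case True
        then have "F x \<le> G x" using elim by (simp add: diff_eq_0_iff_ennreal)
        then show ?thesis by simp
      qed (auto simp: S_def not_less)
    qed
  qed
qed

text \<open>
  Finiteness on neighbouring intervals adds up, so compactness of \<open>{a..b}\<close> in the form of the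
  Bolzano induction principle applies.
\<close>

lemma locally_finite_imp_finite_Icc:
  fixes g :: "real \<Rightarrow> ennreal"
  assumes [measurable]: "g \<in> borel_measurable borel"
    and loc: "\<And>x. \<exists>r>0. (\<integral>\<^sup>+y\<in>ball x r. g y \<partial>lborel) < \<infinity>"
  shows "(\<integral>\<^sup>+y\<in>{a..b}. g y \<partial>lborel) < \<infinity>"
proof (cases "a \<le> b")
  case True
  then show ?thesis
  proof (induction rule: Bolzano)
    case (trans a b c)
    have "(\<integral>\<^sup>+y\<in>{a..c}. g y \<partial>lborel) \<le> (\<integral>\<^sup>+y. g y * indicator {a..b} y + g y * indicator {b..c} y \<partial>lborel)"
      by (intro nn_integral_mono) (auto simp: indicator_def)
    also have "\<dots> = (\<integral>\<^sup>+y\<in>{a..b}. g y \<partial>lborel) + (\<integral>\<^sup>+y\<in>{b..c}. g y \<partial>lborel)"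
      by (intro nn_integral_add) auto
    also have "\<dots> < \<infinity>" using trans by simp
    finally show ?case .
  next
    case (local x)
    obtain r where r: "r > 0" "(\<integral>\<^sup>+y\<in>ball x r. g y \<partial>lborel) < \<infinity>" using loc by blast
    have "(\<integral>\<^sup>+y\<in>{a..b}. g y \<partial>lborel) < \<infinity>" if "a \<le> x" "x \<le> b" "b - a < r" for a b
      using that by (intro le_less_trans[OF nn_integral_mono r(2)])
        (auto simp: indicator_def dist_real_def)
    then show ?case using r(1) by blast
  qed
qed simp

text \<open>
  By Lindelof's theorem, countably many of the given balls cover the line.
\<close>

lemma emeasure_eq_0_of_local:
  assumes Z: "Z \<in> sets N" and sets: "sets N = sets (borel :: real measure)"
    and loc: "\<And>x. \<exists>s>0. emeasure N (Z \<inter> ball x s) = 0"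
  shows "emeasure N Z = 0"
proof -
  let ?F = "{B. open B \<and> emeasure N (Z \<inter> B) = 0}"
  have "\<exists>F. F \<subseteq> ?F \<and> countable F \<and> \<Union>F = \<Union>?F"
    by (rule Lindelof[of ?F]) blast+
  then obtain F where F: "F \<subseteq> ?F" "countable F" "\<Union>F = \<Union>?F" by blast
  have "x \<in> \<Union>?F" for x
  proof -
    obtain s where "s > 0" "emeasure N (Z \<inter> ball x s) = 0" using loc by blast
    then show ?thesis by (intro UnionI[of "ball x s"]) auto
  qed
  then have "Z = (\<Union>B\<in>F. Z \<inter> B)" using F(3) by auto
  also have "\<dots> \<in> null_sets N"
  proof (rule null_sets_UN'[OF F(2)])
    fix B assume "B \<in> F"
    then have "open B" "emeasure N (Z \<inter> B) = 0" using F(1) by auto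
    moreover have "Z \<inter> B \<in> sets N" using Z \<open>open B\<close> by (intro sets.Int) (auto simp: sets)
    ultimately show "Z \<inter> B \<in> null_sets N" by (simp add: null_sets_def)
  qed
  finally show ?thesis by (simp add: null_sets_def)
qed

lemma ennreal_enn2real_le: "ennreal (enn2real x) \<le> x"
  by (cases x) auto

section \<open>Locally absolutely continuous functions\<close>

definition locally_integrable :: "(real \<Rightarrow> real) \<Rightarrow> bool" where
  "locally_integrable f \<longleftrightarrow>
     f \<in> borel_measurable borel \<and> (\<forall>a b. set_integrable lborel {a..b} f)"

text \<open>
  Locally absolutely continuous functions together with a choice of derivative. The derivative is
  recorded as an integrand and is determined by \<open>u\<close> up to null sets.
\<close>

definition primitive :: "(real \<Rightarrow> real) \<Rightarrow> (real \<Rightarrow> real) \<Rightarrow> bool" where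
  "primitive u f \<longleftrightarrow>
     locally_integrable f \<and> (\<forall>a b. a \<le> b \<longrightarrow> u b - u a = (LINT x:{a..b}|lborel. f x))"

lemma locally_integrable_iff:
  "locally_integrable f \<longleftrightarrow>
     f \<in> borel_measurable borel \<and> (\<forall>a b. (\<integral>\<^sup>+x\<in>{a..b}. ennreal \<bar>f x\<bar> \<partial>lborel) < \<infinity>)"
proof -
  have "set_integrable lborel {a..b} f \<longleftrightarrow> (\<integral>\<^sup>+x\<in>{a..b}. ennreal \<bar>f x\<bar> \<partial>lborel) < \<infinity>"
    if [measurable]: "f \<in> borel_measurable borel" for a b
  proof -
    have "(\<integral>\<^sup>+x. ennreal (norm (indicator {a..b} x *\<^sub>R f x)) \<partial>lborel) =
        (\<integral>\<^sup>+x\<in>{a..b}. ennreal \<bar>f x\<bar> \<partial>lborel)"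
      by (intro nn_integral_cong) (auto simp: indicator_def)
    then show ?thesis unfolding set_integrable_def integrable_iff_bounded by simp
  qed
  then show ?thesis unfolding locally_integrable_def by blast
qed

lemma locally_integrable_measurable[measurable_dest]:
  "locally_integrable f \<Longrightarrow> f \<in> borel_measurable borel"
  by (simp add: locally_integrable_def)

lemma primitive_locally_integrable: "primitive u f \<Longrightarrow> locally_integrable f"
  by (simp add: primitive_def)

lemma locally_integrable_add:
  "locally_integrable f \<Longrightarrow> locally_integrable g \<Longrightarrow> locally_integrable (\<lambda>x. f x + g x)"
  unfolding locally_integrable_def by (auto intro: set_integral_add)

lemma locally_integrable_cmult:
  "locally_integrable f \<Longrightarrow> locally_integrable (\<lambda>x. c * f x)"
  unfolding locally_integrable_def by auto

lemma locally_integrable_abs: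
  "locally_integrable f \<Longrightarrow> locally_integrable (\<lambda>x. \<bar>f x\<bar>)"
  unfolding locally_integrable_iff by auto

lemma locally_integrable_restrict:
  assumes "locally_integrable f" "S \<in> sets borel"
  shows "locally_integrable (\<lambda>x. f x * indicator S x)"
proof -
  note [measurable] = assms
  have "(\<integral>\<^sup>+x\<in>{a..b}. ennreal \<bar>f x * indicator S x\<bar> \<partial>lborel) \<le> (\<integral>\<^sup>+x\<in>{a..b}. ennreal \<bar>f x\<bar> \<partial>lborel)" for a b
    by (intro nn_integral_mono) (auto simp: indicator_def)
  then have "(\<integral>\<^sup>+x\<in>{a..b}. ennreal \<bar>f x * indicator S x\<bar> \<partial>lborel) < \<infinity>" for a b
    by (rule le_less_trans) (use assms(1) in \<open>simp add: locally_integrable_iff\<close>)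
  then show ?thesis using assms unfolding locally_integrable_iff by auto
qed

lemma lborel_set_integral_nonneg:
  fixes f :: "real \<Rightarrow> real"
  assumes "\<And>x. 0 \<le> f x" shows "0 \<le> (LINT x:S|lborel. f x)"
  unfolding set_lebesgue_integral_def by (intro Bochner_Integration.integral_nonneg) (simp add: assms)

lemma set_integral_eq_nn_integral_nonneg:
  assumes "locally_integrable f" "\<And>x. 0 \<le> f x"
  shows "ennreal (LINT x:{a..b}|lborel. f x) = (\<integral>\<^sup>+x\<in>{a..b}. ennreal (f x) \<partial>lborel)"
proof -
  have "integrable lborel (\<lambda>x. indicator {a..b} x *\<^sub>R f x)"
    using assms(1) by (simp add: locally_integrable_def set_integrable_def)
  then have "ennreal (LINT x:{a..b}|lborel. f x) = (\<integral>\<^sup>+x. ennreal (indicator {a..b} x *\<^sub>R f x) \<partial>lborel)"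
    unfolding set_lebesgue_integral_def using assms(2) by (intro nn_integral_eq_integral[symmetric]) auto
  also have "\<dots> = (\<integral>\<^sup>+x\<in>{a..b}. ennreal (f x) \<partial>lborel)"
    by (intro nn_integral_cong) (auto simp: indicator_def)
  finally show ?thesis .
qed

lemma primitive_add:
  assumes "primitive u f" "primitive v g"
  shows "primitive (\<lambda>x. u x + v x) (\<lambda>x. f x + g x)"
  unfolding primitive_def
proof (intro conjI allI impI)
  show "locally_integrable (\<lambda>x. f x + g x)"
    using assms by (auto simp: primitive_def intro: locally_integrable_add)
  fix a b :: real assume ab: "a \<le> b"
  have "(LINT x:{a..b}|lborel. f x + g x) = (LINT x:{a..b}|lborel. f x) + (LINT x:{a..b}|lborel. g x)"
    using assms by (intro set_integral_add) (auto simp: primitive_def locally_integrable_def)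
  then show "u b + v b - (u a + v a) = (LINT x:{a..b}|lborel. f x + g x)"
    using assms ab unfolding primitive_def by (smt (verit))
qed

lemma primitive_cmult:
  assumes "primitive u f" shows "primitive (\<lambda>x. c * u x) (\<lambda>x. c * f x)"
  using assms unfolding primitive_def
  by (auto intro: locally_integrable_cmult simp: right_diff_distrib[symmetric])

lemma primitive_exists:
  assumes "locally_integrable f"
  shows "primitive (\<lambda>x. LBINT t=0..x. f t) f"
  unfolding primitive_def
proof (intro conjI allI impI)
  fix a b :: real assume ab: "a \<le> b"
  have int: "interval_lebesgue_integrable lborel (ereal c) (ereal d) f" for c d
    using assms unfolding locally_integrable_def interval_lebesgue_integrable_def
    by (auto intro: set_integrable_subset[of _ "{c..d}"] set_integrable_subset[of _ "{d..c}"])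
  have "(LBINT t=0..a. f t) + (LBINT t=a..b. f t) = (LBINT t=0..b. f t)"
    by (intro interval_integral_sum) (use int[of "min 0 (min a b)" "max 0 (max a b)"] in
        \<open>auto simp: min_def max_def zero_ereal_def split: if_splits\<close>)
  then show "(LBINT t=0..b. f t) - (LBINT t=0..a. f t) = (LINT x:{a..b}|lborel. f x)"
    using interval_integral_Icc[OF ab, of f] by simp
qed (rule assms)

lemma primitive_of_bump:
  assumes f: "locally_integrable f" and ab: "a \<le> b" and supp: "\<And>x. x \<notin> {a<..<b} \<Longrightarrow> f x = 0"
  shows "\<exists>v. primitive v f \<and> (\<forall>x\<le>a. v x = 0) \<and> (\<forall>x\<ge>b. v x = (LINT x:{a..b}|lborel. f x))"
proof -
  define U where "U x = (LBINT t=0..x. f t)" for x :: real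
  have U: "primitive U f" unfolding U_def by (rule primitive_exists[OF f])
  have diff: "U y - U x = 0" if "x \<le> y" "y \<le> a \<or> b \<le> x" for x y
  proof -
    have "(\<lambda>t. indicator {x..y} t *\<^sub>R f t) = (\<lambda>t. 0)"
      using that supp by (auto simp: indicator_def)
    then have "(LINT t:{x..y}|lborel. f t) = 0"
      unfolding set_lebesgue_integral_def by (simp only: Bochner_Integration.integral_zero)
    then show ?thesis using U that(1) by (simp add: primitive_def)
  qed
  have "U x - U a = 0" if "x \<le> a" for x using diff[OF that] by simp
  moreover have "U x - U a = (LINT x:{a..b}|lborel. f x)" if "b \<le> x" for x
  proof -
    have "U b - U a = (LINT x:{a..b}|lborel. f x)" using U ab by (simp add: primitive_def)
    then show ?thesis using diff[OF that] by simp
  qed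
  moreover have "primitive (\<lambda>x. U x - U a) f" using U by (simp add: primitive_def)
  ultimately show ?thesis by blast
qed

lemma primitive_continuous:
  assumes "primitive u f"
  shows "continuous_on S u"
proof -
  have "isCont u x" for x
  proof -
    have int: "f integrable_on {x - 1..x + 1}"
      using assms set_borel_integral_eq_integral(1)[of "{x-1..x+1}" f]
      by (auto simp: primitive_def locally_integrable_def)
    have "continuous_on {x-1..x+1} (\<lambda>y. u (x - 1) + integral {x-1..y} f)"
      by (intro continuous_intros indefinite_integral_continuous_1 int)
    moreover have "u (x - 1) + integral {x-1..y} f = u y" if "y \<in> {x-1..x+1}" for y
    proof -
      have "integral {x-1..y} f = (LINT t:{x-1..y}|lborel. f t)"
        using assms set_borel_integral_eq_integral(2)[of "{x-1..y}" f]
        by (auto simp: primitive_def locally_integrable_def)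
      moreover have "u y - u (x - 1) = (LINT t:{x-1..y}|lborel. f t)"
        using assms that by (simp add: primitive_def)
      ultimately show ?thesis by simp
    qed
    ultimately have "continuous_on {x-1..x+1} u" by (rule continuous_on_eq) auto
    then have "continuous_on {x-1<..<x+1} u" by (rule continuous_on_subset) auto
    then show ?thesis using continuous_on_interior[of "{x-1<..<x+1}" u x] by simp
  qed
  then show ?thesis by (simp add: continuous_at_imp_continuous_on)
qed

lemma primitive_measurable:
  assumes "primitive u f"
  shows "f \<in> borel_measurable borel" "u \<in> borel_measurable borel"
  using primitive_locally_integrable[OF assms] primitive_continuous[OF assms]
  by (auto intro: locally_integrable_measurable borel_measurable_continuous_onI)

lemma primitive_diff_le:
  assumes "primitive u f"
  shows "ennreal \<bar>u b - u a\<bar> \<le> (\<integral>\<^sup>+x\<in>{min a b..max a b}. ennreal \<bar>f x\<bar> \<partial>lborel)"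
proof -
  have *: "ennreal \<bar>u b - u a\<bar> \<le> (\<integral>\<^sup>+x\<in>{a..b}. ennreal \<bar>f x\<bar> \<partial>lborel)" if "a \<le> b" for a b
  proof -
    have "\<bar>u b - u a\<bar> = \<bar>LINT x:{a..b}|lborel. f x\<bar>" using assms that by (auto simp: primitive_def)
    also have "\<dots> \<le> (LINT x:{a..b}|lborel. \<bar>f x\<bar>)"
      unfolding set_lebesgue_integral_def
      using integral_norm_bound[of lborel "\<lambda>x. indicator {a..b} x *\<^sub>R f x"] by (simp add: abs_mult)
    finally show ?thesis
      using set_integral_eq_nn_integral_nonneg[of "\<lambda>x. \<bar>f x\<bar>" a b]
      by (metis abs_ge_zero assms ennreal_leI locally_integrable_abs primitive_def)
  qed
  show ?thesis using *[of a b] *[of b a] by (cases "a \<le> b") (auto simp: min_def max_def abs_minus_commute)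
qed

text \<open>
  An upper gradient \<open>g\<close> of \<open>u\<close> dominates the derivative. This is the minimality of \<open>\<bar>f\<bar>\<close> among the
  upper gradients of \<open>u\<close>.
\<close>

lemma primitive_AE_le:
  assumes u: "primitive u f" and [measurable]: "g \<in> borel_measurable borel"
    and fin: "\<And>a b. (\<integral>\<^sup>+x\<in>{a..b}. g x \<partial>lborel) < \<infinity>"
    and le: "\<And>a b. a < b \<Longrightarrow> ennreal \<bar>u b - u a\<bar> \<le> (\<integral>\<^sup>+x\<in>{a..b}. g x \<partial>lborel)"
  shows "AE x in lborel. ennreal \<bar>f x\<bar> \<le> g x"
proof -
  have *: "AE x in lborel. ennreal (f x) \<le> g x"
    if u: "primitive u f"
      and le: "\<And>a b. a < b \<Longrightarrow> ennreal \<bar>u b - u a\<bar> \<le> (\<integral>\<^sup>+x\<in>{a..b}. g x \<partial>lborel)" for u f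
  proof -
    have f: "locally_integrable f" using u by (rule primitive_locally_integrable)
    note [measurable] = locally_integrable_measurable[OF f]
    have fin': "(\<integral>\<^sup>+x\<in>{a..b}. ennreal (- f x) \<partial>lborel) < \<infinity>"
        "(\<integral>\<^sup>+x\<in>{a..b}. ennreal (f x) \<partial>lborel) < \<infinity>" for a b
    proof -
      have "(\<integral>\<^sup>+x\<in>{a..b}. ennreal \<bar>f x\<bar> \<partial>lborel) < \<infinity>"
        using f by (simp add: locally_integrable_iff)
      then show "(\<integral>\<^sup>+x\<in>{a..b}. ennreal (- f x) \<partial>lborel) < \<infinity>"
        "(\<integral>\<^sup>+x\<in>{a..b}. ennreal (f x) \<partial>lborel) < \<infinity>"
        by (auto elim!: le_less_trans[rotated] intro!: nn_integral_mono mult_right_mono ennreal_leI)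
    qed
    \<comment> \<open>Splitting \<open>f\<close> into its positive part \<open>ennreal (f x)\<close> and its negative part \<open>ennreal (- f x)\<close>
        turns the signed inequality on intervals into one between nonnegative densities. Where
        \<open>f > 0\<close> the negative part vanishes, and elsewhere there is nothing to show.\<close>
    have "AE x in lborel. ennreal (f x) \<le> g x + ennreal (- f x)"
    proof (rule AE_le_of_intervals)
      show "(\<integral>\<^sup>+x\<in>{a..b}. (g x + ennreal (- f x)) \<partial>lborel) < \<infinity>" for a b
        using fin[of a b] fin'[of a b] by (simp add: distrib_right nn_integral_add)
      fix a b :: real assume ab: "a < b"
      let ?P = "\<integral>\<^sup>+x\<in>{a..b}. ennreal (f x) \<partial>lborel"
      let ?N = "\<integral>\<^sup>+x\<in>{a..b}. ennreal (- f x) \<partial>lborel"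
      have "integrable lborel (\<lambda>x. indicator {a..b} x *\<^sub>R f x)"
        using f by (simp add: locally_integrable_def set_integrable_def)
      then have "(LINT x:{a..b}|lborel. f x) =
          enn2real (\<integral>\<^sup>+x. ennreal (indicator {a..b} x *\<^sub>R f x) \<partial>lborel)
        - enn2real (\<integral>\<^sup>+x. ennreal (- (indicator {a..b} x *\<^sub>R f x)) \<partial>lborel)"
        unfolding set_lebesgue_integral_def by (rule real_lebesgue_integral_def)
      also have "(\<integral>\<^sup>+x. ennreal (indicator {a..b} x *\<^sub>R f x) \<partial>lborel) = ?P"
        by (intro nn_integral_cong) (auto simp: indicator_def)
      also have "(\<integral>\<^sup>+x. ennreal (- (indicator {a..b} x *\<^sub>R f x)) \<partial>lborel) = ?N"
        by (intro nn_integral_cong) (auto simp: indicator_def)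
      finally have eq: "enn2real ?P = (u b - u a) + enn2real ?N"
        using u ab by (simp add: primitive_def)
      have "?P = ennreal (enn2real ?P)" using fin'(2)[of a b] by simp
      also have "\<dots> \<le> ennreal \<bar>u b - u a\<bar> + ennreal (enn2real ?N)"
        unfolding eq by (subst ennreal_plus[symmetric]) (simp_all add: ennreal_leI del: ennreal_plus)
      also have "ennreal (enn2real ?N) = ?N" using fin'(1)[of a b] by simp
      also have "ennreal \<bar>u b - u a\<bar> + ?N \<le> (\<integral>\<^sup>+x\<in>{a..b}. g x \<partial>lborel) + ?N"
        using le[OF ab] by (rule add_right_mono)
      also have "\<dots> = (\<integral>\<^sup>+x\<in>{a..b}. (g x + ennreal (- f x)) \<partial>lborel)"
        by (simp add: distrib_right nn_integral_add)
      finally show "?P \<le> (\<integral>\<^sup>+x\<in>{a..b}. (g x + ennreal (- f x)) \<partial>lborel)" .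
    qed measurable
    then show ?thesis
    proof eventually_elim
      case (elim x)
      then show ?case by (cases "0 \<le> f x") (auto simp: ennreal_neg)
    qed
  qed
  have "primitive (\<lambda>x. - u x) (\<lambda>x. - f x)" using primitive_cmult[OF u, of "-1"] by simp
  then have "AE x in lborel. ennreal (- f x) \<le> g x"
    by (rule *) (use le in \<open>simp add: abs_minus_commute\<close>)
  moreover have "AE x in lborel. ennreal (f x) \<le> g x" by (rule *[OF u le])
  ultimately show ?thesis by eventually_elim (simp add: abs_real_def)
qed

lemma locally_integrable_enn2real:
  assumes [measurable]: "g \<in> borel_measurable borel"
    and fin: "\<And>a b. (\<integral>\<^sup>+x\<in>{a..b}. g x \<partial>lborel) < \<infinity>"
  shows "locally_integrable (\<lambda>x. enn2real (g x))" (is ?loc)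
    and "AE x in lborel. g x = ennreal (enn2real (g x))" (is ?AE)
proof -
  have "AE x in lborel. g x \<noteq> \<infinity>"
  proof (rule AE_lborel_of_bounded)
    fix n :: nat
    have "AE x in lborel. g x * indicator {-real n..real n} x \<noteq> \<infinity>"
      using fin[of "-real n" "real n"] by (intro nn_integral_PInf_AE) auto
    then show "AE x in lborel. x \<in> {-real n..real n} \<longrightarrow> g x \<noteq> \<infinity>"
      by eventually_elim (auto simp: indicator_def)
  qed
  then show gg: ?AE by eventually_elim (simp add: less_top)
  have "(\<integral>\<^sup>+x\<in>{a..b}. g x \<partial>lborel) = (\<integral>\<^sup>+x\<in>{a..b}. ennreal (enn2real (g x)) \<partial>lborel)" for a b
    using gg by (intro nn_integral_cong_AE) (auto elim: eventually_mono)
  then show ?loc unfolding locally_integrable_iff using fin by (simp add: abs_of_nonneg)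
qed

text \<open>
  A function with a locally integrable upper gradient is locally absolutely continuous: adding a
  primitive of \<open>g\<close> makes \<open>u\<close> increasing, the Stieltjes measure of the sum is dominated by \<open>2 * g\<close> times
  Lebesgue measure, and the Radon-Nikodym theorem provides its density.
\<close>

lemma primitive_of_integral_bound:
  assumes [measurable]: "g \<in> borel_measurable borel"
    and fin: "\<And>a b. (\<integral>\<^sup>+x\<in>{a..b}. g x \<partial>lborel) < \<infinity>"
    and le: "\<And>a b. a < b \<Longrightarrow> ennreal \<bar>u b - u a\<bar> \<le> (\<integral>\<^sup>+x\<in>{a..b}. g x \<partial>lborel)"
  shows "\<exists>f. primitive u f"
proof -
  define g' where "g' x = enn2real (g x)" for x
  have locg: "locally_integrable g'" and gg: "AE x in lborel. g x = ennreal (g' x)"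
    unfolding g'_def using fin by (auto intro!: locally_integrable_enn2real)
  have gi: "(\<integral>\<^sup>+x\<in>{a..b}. g x \<partial>lborel) = (\<integral>\<^sup>+x\<in>{a..b}. ennreal (g' x) \<partial>lborel)" for a b
    using gg by (intro nn_integral_cong_AE) (auto elim: eventually_mono)
  have g'0: "0 \<le> g' x" for x by (simp add: g'_def)
  define G where "G x = (LBINT t=0..x. g' t)" for x :: real
  have G: "primitive G g'" unfolding G_def by (rule primitive_exists[OF locg])
  have Gdiff: "(\<integral>\<^sup>+x\<in>{a..b}. g x \<partial>lborel) = ennreal (G b - G a)" "G a \<le> G b" if "a \<le> b" for a b
  proof -
    have eq: "G b - G a = (LINT x:{a..b}|lborel. g' x)" using G that by (simp add: primitive_def)
    show "(\<integral>\<^sup>+x\<in>{a..b}. g x \<partial>lborel) = ennreal (G b - G a)"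
      unfolding eq gi using set_integral_eq_nn_integral_nonneg[OF locg g'0] by simp
    have "0 \<le> (LINT x:{a..b}|lborel. g' x)"
      by (rule lborel_set_integral_nonneg) (simp add: g'0)
    then show "G a \<le> G b" using eq by simp
  qed
  have uG: "\<bar>u b - u a\<bar> \<le> G b - G a" if "a \<le> b" for a b
  proof (cases "a = b")
    case False
    then have "ennreal \<bar>u b - u a\<bar> \<le> ennreal (G b - G a)"
      using le[of a b] that unfolding Gdiff(1)[OF that] by simp
    then show ?thesis using Gdiff(2)[OF that] ennreal_le_iff[of "G b - G a"] by auto
  qed simp
  define F where "F x = u x + G x" for x
  have F_mono: "F a \<le> F b" if "a \<le> b" for a b using uG[OF that] by (simp add: F_def)
  have "isCont F x" for x
  proof -
    have cG: "isCont G x" using primitive_continuous[OF G, of UNIV] by (simp add: continuous_on_eq_continuous_at)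
    then have lim: "((\<lambda>y. \<bar>G y - G x\<bar>) \<longlongrightarrow> 0) (at x)"
      by (intro tendsto_rabs_zero) (simp add: isCont_def LIM_zero_iff)
    have "\<bar>u y - u x\<bar> \<le> \<bar>G y - G x\<bar>" for y
      using uG[of x y] uG[of y x] by (cases "x \<le> y") auto
    then have "((\<lambda>y. u y - u x) \<longlongrightarrow> 0) (at x)"
      by (intro Lim_null_comparison[OF _ lim] always_eventually allI) (simp only: real_norm_def)
    then have "isCont u x" by (simp add: isCont_def LIM_zero_iff)
    then show ?thesis unfolding F_def using cG by (intro continuous_intros)
  qed
  then have F_cont: "continuous_on UNIV F" by (simp add: continuous_at_imp_continuous_on)
  define \<nu> where "\<nu> = interval_measure F"
  have \<nu>_sets: "sets \<nu> = sets borel" by (simp add: \<nu>_def)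
  have \<nu>_Icc: "emeasure \<nu> {a..b} = ennreal (F b - F a)" if "a \<le> b" for a b
    unfolding \<nu>_def using that F_mono F_cont by (rule emeasure_interval_measure_Icc)
  \<comment> \<open>The factor 2 comes from \<open>F b - F a \<le> 2 * (G b - G a)\<close>.\<close>
  have \<nu>_le: "emeasure \<nu> S \<le> emeasure (density lborel (\<lambda>x. 2 * g x)) S" if S: "S \<in> sets borel" for S
  proof (rule emeasure_le_of_intervals[OF \<nu>_sets _ _ _ S])
    show "emeasure (density lborel (\<lambda>x. 2 * g x)) {a<..<b} < \<infinity>" for a b
      using fin[of a b]
      by (simp add: emeasure_density nn_integral_Icc_eq_Ioo mult.assoc nn_integral_cmult
          ennreal_mult_less_top)
    fix a b :: real assume ab: "a < b"
    have "emeasure \<nu> {a<..<b} \<le> emeasure \<nu> {a..b}"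
      by (intro emeasure_mono) (auto simp: \<nu>_sets)
    also have "\<dots> = ennreal (F b - F a)" using ab by (simp add: \<nu>_Icc)
    also have "\<dots> \<le> ennreal (2 * (G b - G a))"
      using uG[of a b] ab by (intro ennreal_leI) (auto simp: F_def)
    also have "\<dots> = 2 * (\<integral>\<^sup>+x\<in>{a..b}. g x \<partial>lborel)"
      using Gdiff(1)[of a b] Gdiff(2)[of a b] ab by (subst ennreal_mult) simp_all
    also have "\<dots> = emeasure (density lborel (\<lambda>x. 2 * g x)) {a<..<b}"
      by (simp add: emeasure_density nn_integral_Icc_eq_Ioo mult.assoc nn_integral_cmult)
    finally show "emeasure \<nu> {a<..<b} \<le> emeasure (density lborel (\<lambda>x. 2 * g x)) {a<..<b}" .
  qed simp
  have "absolutely_continuous lborel \<nu>"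
    unfolding absolutely_continuous_def
  proof (rule subsetI)
    fix N :: "real set" assume N: "N \<in> null_sets lborel"
    then have "N \<in> null_sets (density lborel (\<lambda>x. 2 * g x))"
      using absolutely_continuousI_density[of "\<lambda>x. 2 * g x" lborel]
      by (auto simp: absolutely_continuous_def)
    then show "N \<in> null_sets \<nu>"
      using \<nu>_le[of N] N by (auto simp: null_sets_def \<nu>_sets)
  qed
  then obtain k where k[measurable]: "k \<in> borel_measurable lborel" and dk: "density lborel k = \<nu>"
    using sigma_finite_measure.Radon_Nikodym[OF sigma_finite_lborel, of \<nu>] \<nu>_sets by auto
  define k' where "k' x = enn2real (k x)" for x
  have k_int: "(\<integral>\<^sup>+x\<in>{a..b}. k x \<partial>lborel) = ennreal (F b - F a)" if "a \<le> b" for a b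
    using \<nu>_Icc[OF that] k unfolding dk[symmetric] by (simp add: emeasure_density)
  have k_fin: "(\<integral>\<^sup>+x\<in>{a..b}. k x \<partial>lborel) < \<infinity>" for a b
    by (cases "a \<le> b") (auto simp: k_int)
  have kb: "k \<in> borel_measurable borel" using k by simp
  have lock: "locally_integrable k'" and kk: "AE x in lborel. k x = ennreal (k' x)"
    unfolding k'_def using k_fin kb by (auto intro!: locally_integrable_enn2real)
  have "primitive F k'"
    unfolding primitive_def
  proof (intro conjI allI impI lock)
    fix a b :: real assume ab: "a \<le> b"
    have "ennreal (LINT x:{a..b}|lborel. k' x) = (\<integral>\<^sup>+x\<in>{a..b}. ennreal (k' x) \<partial>lborel)"
      by (rule set_integral_eq_nn_integral_nonneg[OF lock]) (simp add: k'_def)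
    also have "\<dots> = (\<integral>\<^sup>+x\<in>{a..b}. k x \<partial>lborel)"
      using kk by (intro nn_integral_cong_AE) (auto elim: eventually_mono)
    also have "\<dots> = ennreal (F b - F a)" by (rule k_int[OF ab])
    finally have "ennreal (LINT x:{a..b}|lborel. k' x) = ennreal (F b - F a)" .
    moreover have "0 \<le> (LINT x:{a..b}|lborel. k' x)"
      by (rule lborel_set_integral_nonneg) (simp add: k'_def)
    ultimately show "F b - F a = (LINT x:{a..b}|lborel. k' x)" using F_mono[OF ab] by simp
  qed
  then have "primitive (\<lambda>x. F x + - 1 * G x) (\<lambda>x. k' x + - 1 * g' x)"
    by (intro primitive_add primitive_cmult G)
  then show ?thesis by (auto simp: F_def)
qed

text \<open>
  The function \<open>h\<close> that equals \<open>\<bar>f\<bar>\<close> where \<open>u \<noteq> 0\<close> and 0 elsewhere is again an upper gradient of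
  \<open>u\<close>, because what happens between the first and the last zero in an interval does not contribute to
  the difference of the values at its ends. Minimality then gives \<open>\<bar>f\<bar> \<le> h\<close>.
\<close>

lemma primitive_zero_set:
  assumes u: "primitive u f"
  shows "AE x in lborel. u x = 0 \<longrightarrow> f x = 0"
proof -
  have loc: "locally_integrable f" using u by (rule primitive_locally_integrable)
  note [measurable] = primitive_measurable[OF u]
  have cu: "continuous_on UNIV u" using u by (rule primitive_continuous)
  define h where "h x = ennreal \<bar>f x\<bar> * indicator {x. u x \<noteq> 0} x" for x
  have [measurable]: "h \<in> borel_measurable borel" unfolding h_def by measurable
  have h_le: "h x \<le> ennreal \<bar>f x\<bar>" for x by (auto simp: h_def indicator_def)
  have fin: "(\<integral>\<^sup>+x\<in>{a..b}. h x \<partial>lborel) < \<infinity>" for a b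
  proof -
    have "(\<integral>\<^sup>+x\<in>{a..b}. h x \<partial>lborel) \<le> (\<integral>\<^sup>+x\<in>{a..b}. ennreal \<bar>f x\<bar> \<partial>lborel)"
      using h_le by (intro nn_integral_mono mult_right_mono) auto
    also have "\<dots> < \<infinity>" using loc by (simp add: locally_integrable_iff)
    finally show ?thesis .
  qed
  \<comment> \<open>The first and the last zero in an interval cut off two pieces without zeros inside.\<close>
  have nz: "ennreal \<bar>u b - u a\<bar> \<le> (\<integral>\<^sup>+x\<in>{a<..<b}. h x \<partial>lborel)"
    if ab: "a \<le> b" and nz: "\<And>x. a < x \<Longrightarrow> x < b \<Longrightarrow> u x \<noteq> 0" for a b
  proof -
    have "ennreal \<bar>u b - u a\<bar> \<le> (\<integral>\<^sup>+x\<in>{a<..<b}. ennreal \<bar>f x\<bar> \<partial>lborel)"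
      using primitive_diff_le[OF u, of b a] ab by (simp add: min_def max_def nn_integral_Icc_eq_Ioo split: if_splits)
    also have "\<dots> = (\<integral>\<^sup>+x\<in>{a<..<b}. h x \<partial>lborel)"
      using nz by (intro nn_integral_cong) (auto simp: h_def indicator_def)
    finally show ?thesis .
  qed
  have "ennreal \<bar>u b - u a\<bar> \<le> (\<integral>\<^sup>+x\<in>{a..b}. h x \<partial>lborel)" if ab: "a < b" for a b
  proof (cases "\<exists>x\<in>{a..b}. u x = 0")
    case False
    then show ?thesis using nz[of a b] ab by (auto simp: nn_integral_Icc_eq_Ioo)
  next
    case True
    define Z where "Z = {x\<in>{a..b}. u x = 0}"
    have Z: "closed Z" "bounded Z" "Z \<noteq> {}"
    proof -
      have "closed ({a..b} \<inter> {x. u x = 0})"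
        using cu by (intro closed_Int closed_Collect_eq) auto
      then show "closed Z" by (simp add: Z_def Int_def)
    qed (use True in \<open>auto simp: Z_def intro: bounded_subset[of "{a..b}"]\<close>)
    define c d where "c = Inf Z" and "d = Sup Z"
    have bd: "bdd_below Z" "bdd_above Z" using Z bounded_imp_bdd_below bounded_imp_bdd_above by auto
    have cd: "c \<in> Z" "d \<in> Z"
      unfolding c_def d_def using Z bd by (auto intro: closed_contains_Inf closed_contains_Sup)
    have ord: "a \<le> c" "c \<le> d" "d \<le> b" and zero: "u c = 0" "u d = 0"
      using cd cInf_lower[of d Z] bd by (auto simp: Z_def c_def)
    have "u x \<noteq> 0" if "a < x" "x < c" for x
      using cInf_lower[of x Z] bd that ord by (auto simp: Z_def c_def)
    then have 1: "ennreal \<bar>u c - u a\<bar> \<le> (\<integral>\<^sup>+x\<in>{a<..<c}. h x \<partial>lborel)" by (intro nz ord)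
    have "u x \<noteq> 0" if "d < x" "x < b" for x
      using cSup_upper[of x Z] bd that ord by (auto simp: Z_def d_def)
    then have 2: "ennreal \<bar>u b - u d\<bar> \<le> (\<integral>\<^sup>+x\<in>{d<..<b}. h x \<partial>lborel)" by (intro nz ord)
    have "ennreal \<bar>u b - u a\<bar> \<le> ennreal \<bar>u c - u a\<bar> + ennreal \<bar>u b - u d\<bar>"
      using zero by (subst ennreal_plus[symmetric]) (simp_all add: ennreal_leI del: ennreal_plus)
    also have "\<dots> \<le> (\<integral>\<^sup>+x\<in>{a<..<c}. h x \<partial>lborel) + (\<integral>\<^sup>+x\<in>{d<..<b}. h x \<partial>lborel)"
      by (intro add_mono 1 2)
    also have "\<dots> = (\<integral>\<^sup>+x. h x * indicator {a<..<c} x + h x * indicator {d<..<b} x \<partial>lborel)"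
      by (intro nn_integral_add[symmetric]) auto
    also have "\<dots> \<le> (\<integral>\<^sup>+x\<in>{a..b}. h x \<partial>lborel)"
      using ord by (intro nn_integral_mono) (auto simp: indicator_def)
    finally show ?thesis .
  qed
  then have "AE x in lborel. ennreal \<bar>f x\<bar> \<le> h x"
    using u fin by (intro primitive_AE_le) auto
  then show ?thesis
    by eventually_elim (auto simp: h_def indicator_def split: if_splits)
qed

section \<open>Curves on the line\<close>

lemma arc_curve_Lipschitz:
  assumes "arc_curve E \<gamma> l" "0 \<le> s" "s \<le> t" "t \<le> l"
  shows "\<bar>\<gamma> t - \<gamma> s\<bar> \<le> t - s"
proof -
  have "ennreal \<bar>\<gamma> t - \<gamma> s\<bar> \<le> curve_length \<gamma> s t"
    unfolding curve_length_def using assms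
    by (intro SUP_upper2[of "[s, t]"]) (auto simp: dist_real_def abs_minus_commute)
  also have "\<dots> = ennreal (t - s)" using assms by (simp add: arc_curve_def)
  finally show ?thesis using assms(3) ennreal_le_iff[of "t - s" "\<bar>\<gamma> t - \<gamma> s\<bar>"] by simp
qed

text \<open>
  For the identity parametrization the sums that define the length telescope.
\<close>

lemma arc_curve_segment:
  assumes "a < b" "{a..b} \<subseteq> E"
  shows "arc_curve E (\<lambda>t. a + t) (b - a)"
  unfolding arc_curve_def
proof (intro conjI allI impI)
  fix s t :: real assume st: "0 \<le> s \<and> s \<le> t \<and> t \<le> b - a"
  let ?S = "\<lambda>ts. \<Sum>i<length ts - 1. ennreal (dist (a + ts ! i) (a + ts ! Suc i))"
  have "?S ts \<le> ennreal (t - s)" if ts: "sorted ts" "set ts \<subseteq> {s..t}" for ts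
  proof (cases "ts = []")
    case False
    have "?S ts = (\<Sum>i<length ts - 1. ennreal (ts ! Suc i - ts ! i))"
    proof (intro sum.cong refl)
      fix i assume "i \<in> {..<length ts - 1}"
      then have "ts ! i \<le> ts ! Suc i" using ts(1) by (simp add: sorted_iff_nth_mono)
      then show "ennreal (dist (a + ts ! i) (a + ts ! Suc i)) = ennreal (ts ! Suc i - ts ! i)"
        by (simp add: dist_real_def)
    qed
    also have "\<dots> = ennreal (\<Sum>i<length ts - 1. ts ! Suc i - ts ! i)"
      using ts(1) by (intro sum_ennreal) (simp add: sorted_iff_nth_mono)
    also have "\<dots> = ennreal (ts ! (length ts - 1) - ts ! 0)" by (subst sum_lessThan_telescope) simp
    also have "\<dots> \<le> ennreal (t - s)"
    proof -
      have "ts ! 0 \<in> set ts" "ts ! (length ts - 1) \<in> set ts" using False by auto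
      then have "ts ! 0 \<in> {s..t}" "ts ! (length ts - 1) \<in> {s..t}" using ts(2) by blast+
      then show ?thesis by (intro ennreal_leI) auto
    qed
    finally show ?thesis .
  qed simp
  then have "curve_length (\<lambda>t. a + t) s t \<le> ennreal (t - s)"
    unfolding curve_length_def by (intro SUP_least) auto
  moreover have "ennreal (t - s) \<le> curve_length (\<lambda>t. a + t) s t"
    unfolding curve_length_def using st
    by (intro SUP_upper2[of "[s, t]"]) (auto simp: dist_real_def)
  ultimately show "curve_length (\<lambda>t. a + t) s t = ennreal (t - s)" by (rule antisym)
qed (use assms in auto)

lemma crossing_interval:
  fixes \<gamma> :: "real \<Rightarrow> real"
  assumes cont: "continuous_on {0..l} \<gamma>" and l: "0 \<le> l"
    and ab: "\<gamma> 0 \<le> a" "a < b" "b \<le> \<gamma> l"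
  shows "\<exists>s t. 0 \<le> s \<and> s < t \<and> t \<le> l \<and> \<gamma> s = a \<and> \<gamma> t = b \<and> (\<forall>x. s < x \<and> x < t \<longrightarrow> a < \<gamma> x \<and> \<gamma> x < b)"
proof -
  \<comment> \<open>\<open>t\<close> is the first time at \<open>b\<close>, and \<open>s\<close> the last time at \<open>a\<close> before \<open>t\<close>.\<close>
  define B where "B = {x\<in>{0..l}. \<gamma> x = b}"
  have "\<exists>x\<ge>0. x \<le> l \<and> \<gamma> x = b" using ab l cont by (intro IVT') auto
  then have Bne: "B \<noteq> {}" by (auto simp: B_def)
  have clB: "closed B"
    using continuous_closed_preimage_constant[OF cont closed_atLeastAtMost, of b]
    by (simp add: B_def)
  have bdB: "bdd_below B" by (auto simp: B_def intro: bdd_belowI[of _ 0])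
  define t where "t = Inf B"
  have tB: "t \<in> B" unfolding t_def by (rule closed_contains_Inf[OF Bne bdB clB])
  then have t: "0 \<le> t" "t \<le> l" "\<gamma> t = b" by (auto simp: B_def)
  have lt_b: "\<gamma> x < b" if "0 \<le> x" "x < t" for x
  proof (rule ccontr)
    assume "\<not> \<gamma> x < b"
    then have "\<exists>y\<ge>0. y \<le> x \<and> \<gamma> y = b"
      using that ab t by (intro IVT' continuous_on_subset[OF cont]) auto
    then obtain y where y: "0 \<le> y" "y \<le> x" "\<gamma> y = b" by blast
    then have "y \<in> B" "y \<le> x" using that t(2) by (auto simp: B_def)
    then show False using cInf_lower[OF _ bdB, of y] that by (simp add: t_def)
  qed
  define A where "A = {x\<in>{0..t}. \<gamma> x = a}"
  have cont': "continuous_on {0..t} \<gamma>" using cont t by (auto intro: continuous_on_subset)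
  have "\<exists>x\<ge>0. x \<le> t \<and> \<gamma> x = a" using ab t cont' by (intro IVT') auto
  then have Ane: "A \<noteq> {}" by (auto simp: A_def)
  have clA: "closed A"
    using continuous_closed_preimage_constant[OF cont' closed_atLeastAtMost, of a]
    by (simp add: A_def)
  have bdA: "bdd_above A" by (auto simp: A_def intro: bdd_aboveI[of _ t])
  define s where "s = Sup A"
  have sA: "s \<in> A" unfolding s_def by (rule closed_contains_Sup[OF Ane bdA clA])
  then have s: "0 \<le> s" "s \<le> t" "\<gamma> s = a" by (auto simp: A_def)
  have gt_a: "a < \<gamma> x" if "s < x" "x < t" for x
  proof (rule ccontr)
    assume "\<not> a < \<gamma> x"
    then have "\<exists>y\<ge>x. y \<le> t \<and> \<gamma> y = a"
      using that ab t s by (intro IVT' continuous_on_subset[OF cont']) auto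
    then obtain y where y: "x \<le> y" "y \<le> t" "\<gamma> y = a" by blast
    then have "y \<in> A" "x \<le> y" using that s(1) by (auto simp: A_def)
    then show False using cSup_upper[OF _ bdA, of y] that by (simp add: s_def)
  qed
  have "s \<noteq> t" using s t ab by auto
  then show ?thesis using s t lt_b gt_a by (intro exI[of _ s] exI[of _ t]) auto
qed

text \<open>
  A curve passes through every interval between its end points, and since it is 1-Lipschitz it
  spends at least the length of the interval there. Hence the image of Lebesgue measure under the curve
  dominates Lebesgue measure between the end points, however much the curve oscillates.
\<close>

lemma nn_integral_range_le_curve:
  fixes h :: "real \<Rightarrow> ennreal"
  assumes [measurable]: "h \<in> borel_measurable borel"
    and l: "0 \<le> l"
    and lip: "\<And>s t. 0 \<le> s \<Longrightarrow> s \<le> t \<Longrightarrow> t \<le> l \<Longrightarrow> \<bar>\<gamma> t - \<gamma> s\<bar> \<le> t - s"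
  shows "(\<integral>\<^sup>+x\<in>{min (\<gamma> 0) (\<gamma> l)..max (\<gamma> 0) (\<gamma> l)}. h x \<partial>lborel) \<le> (\<integral>\<^sup>+t\<in>{0..l}. h (\<gamma> t) \<partial>lborel)"
proof -
  define \<alpha> \<beta> where "\<alpha> = min (\<gamma> 0) (\<gamma> l)" and "\<beta> = max (\<gamma> 0) (\<gamma> l)"
  have "1-lipschitz_on {0..l} \<gamma>"
  proof (rule lipschitz_onI)
    fix x y assume "x \<in> {0..l}" "y \<in> {0..l}"
    then show "dist (\<gamma> x) (\<gamma> y) \<le> 1 * dist x y"
      using lip[of x y] lip[of y x] by (cases "x \<le> y") (simp_all add: dist_real_def)
  qed simp
  then have cont: "continuous_on {0..l} \<gamma>" by (rule lipschitz_on_continuous_on)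
  define R where "R = restrict_space lborel {0..l}"
  have meas: "\<gamma> \<in> R \<rightarrow>\<^sub>M borel"
    unfolding R_def using borel_measurable_continuous_on_restrict[OF cont]
    by (simp cong: measurable_cong_sets add: sets_restrict_space measurable_def)
  define \<nu>1 where "\<nu>1 = density lborel (\<lambda>x. indicator {\<alpha>..\<beta>} x :: ennreal)"
  define \<nu>2 where "\<nu>2 = distr R borel \<gamma>"
  have \<nu>2: "emeasure \<nu>2 S = emeasure lborel {t\<in>{0..l}. \<gamma> t \<in> S}" if "S \<in> sets borel" for S
  proof -
    have "\<gamma> -` S \<inter> space R = {t\<in>{0..l}. \<gamma> t \<in> S}" by (auto simp: R_def space_restrict_space)
    then have "emeasure \<nu>2 S = emeasure R {t\<in>{0..l}. \<gamma> t \<in> S}"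
      using that meas by (simp add: \<nu>2_def emeasure_distr)
    then show ?thesis unfolding R_def by (subst (asm) emeasure_restrict_space) auto
  qed
  have "emeasure \<nu>1 S \<le> emeasure \<nu>2 S" if S: "S \<in> sets borel" for S
  proof (rule emeasure_le_of_intervals[OF _ _ _ _ S])
    show "emeasure \<nu>2 {a<..<b} < \<infinity>" for a b
    proof -
      have "emeasure \<nu>2 {a<..<b} \<le> emeasure lborel {0..l}"
        using \<nu>2[of "{a<..<b}"] by (auto intro!: emeasure_mono)
      then show ?thesis using l by (auto simp: less_top[symmetric] top_unique)
    qed
    fix a b :: real assume ab: "a < b"
    define a' b' where "a' = max a \<alpha>" and "b' = min b \<beta>"
    have "emeasure \<nu>1 {a<..<b} = emeasure lborel ({\<alpha>..\<beta>} \<inter> {a<..<b})"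
      unfolding \<nu>1_def by (subst emeasure_density) (auto simp: indicator_inter_arith[symmetric])
    also have "\<dots> \<le> emeasure lborel {a'..b'}"
      by (intro emeasure_mono) (auto simp: a'_def b'_def)
    also have "\<dots> \<le> emeasure \<nu>2 {a<..<b}"
    proof (cases "a' < b'")
      case True
      have "\<exists>s t. 0 \<le> s \<and> s < t \<and> t \<le> l \<and> b' - a' \<le> t - s \<and> (\<forall>x. s < x \<and> x < t \<longrightarrow> a' < \<gamma> x \<and> \<gamma> x < b')"
      proof (cases "\<gamma> 0 \<le> \<gamma> l")
        case True
        then have "\<gamma> 0 \<le> a'" "b' \<le> \<gamma> l" by (auto simp: a'_def b'_def \<alpha>_def \<beta>_def)
        then obtain s t where "0 \<le> s" "s < t" "t \<le> l" "\<gamma> s = a'" "\<gamma> t = b'"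
          "\<forall>x. s < x \<and> x < t \<longrightarrow> a' < \<gamma> x \<and> \<gamma> x < b'"
          using crossing_interval[OF cont l _ \<open>a' < b'\<close>] by blast
        then show ?thesis using lip[of s t] by (intro exI[of _ s] exI[of _ t]) auto
      next
        case False
        then have "- \<gamma> 0 \<le> - b'" "- a' \<le> - \<gamma> l" by (auto simp: a'_def b'_def \<alpha>_def \<beta>_def)
        moreover have "continuous_on {0..l} (\<lambda>x. - \<gamma> x)" using cont by (intro continuous_intros)
        ultimately obtain s t where "0 \<le> s" "s < t" "t \<le> l" "- \<gamma> s = - b'" "- \<gamma> t = - a'"
          "\<forall>x. s < x \<and> x < t \<longrightarrow> - b' < - \<gamma> x \<and> - \<gamma> x < - a'"
          using crossing_interval[of l "\<lambda>x. - \<gamma> x" "- b'" "- a'"] l \<open>a' < b'\<close> by auto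
        then show ?thesis using lip[of s t] by (intro exI[of _ s] exI[of _ t]) auto
      qed
      then obtain s t where st: "0 \<le> s" "s < t" "t \<le> l" "b' - a' \<le> t - s"
        "\<And>x. s < x \<Longrightarrow> x < t \<Longrightarrow> a' < \<gamma> x \<and> \<gamma> x < b'" by blast
      have "emeasure lborel {a'..b'} \<le> emeasure lborel {s<..<t}"
        using True st by (simp add: ennreal_leI)
      also have "\<dots> \<le> emeasure lborel {x\<in>{0..l}. \<gamma> x \<in> {a<..<b}}"
      proof (rule emeasure_mono)
        show "{s<..<t} \<subseteq> {x\<in>{0..l}. \<gamma> x \<in> {a<..<b}}"
          using st by (fastforce simp: a'_def b'_def)
        have "{x\<in>{0..l}. \<gamma> x \<in> {a<..<b}} = \<gamma> -` {a<..<b} \<inter> space R"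
          by (auto simp: R_def space_restrict_space)
        also have "\<dots> \<in> sets R" using meas by (rule measurable_sets) simp
        finally show "{x\<in>{0..l}. \<gamma> x \<in> {a<..<b}} \<in> sets lborel"
          by (auto simp: R_def sets_restrict_space)
      qed
      also have "\<dots> = emeasure \<nu>2 {a<..<b}" by (simp add: \<nu>2)
      finally show ?thesis .
    next
      case False
      then have "emeasure lborel {a'..b'} = 0" by (cases "a' = b'") auto
      then show ?thesis by simp
    qed
    finally show "emeasure \<nu>1 {a<..<b} \<le> emeasure \<nu>2 {a<..<b}" .
  qed (auto simp: \<nu>1_def \<nu>2_def)
  then have "\<nu>1 \<le> \<nu>2"
    by (subst le_measure) (auto simp: \<nu>1_def \<nu>2_def le_fun_def emeasure_notin_sets)
  then have "nn_integral \<nu>1 h \<le> nn_integral \<nu>2 h"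
    by (intro nn_integral_mono_measure) (auto simp: \<nu>1_def \<nu>2_def)
  also have "nn_integral \<nu>2 h = (\<integral>\<^sup>+t. h (\<gamma> t) \<partial>R)"
    unfolding \<nu>2_def using meas by (intro nn_integral_distr) auto
  also have "\<dots> = (\<integral>\<^sup>+t\<in>{0..l}. h (\<gamma> t) \<partial>lborel)"
    unfolding R_def by (rule nn_integral_restrict_space) simp
  also have "nn_integral \<nu>1 h = (\<integral>\<^sup>+x\<in>{\<alpha>..\<beta>}. h x \<partial>lborel)"
    unfolding \<nu>1_def by (subst nn_integral_density) (auto simp: mult.commute)
  finally show ?thesis by (simp add: \<alpha>_def \<beta>_def)
qed

lemma weak_upper_gradient_primitive:
  assumes u: "primitive u f" and p: "0 < p" and M: "sets borel \<subseteq> sets M" "space M = UNIV"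
  shows "weak_upper_gradient p M E (\<lambda>x. ereal (u x)) (\<lambda>x. ennreal \<bar>f x\<bar>)"
proof -
  note [measurable] = primitive_measurable[OF u]
  have "(\<lambda>x. ennreal \<bar>f x\<bar>) \<in> borel_measurable borel" by measurable
  then have "(\<lambda>x. ennreal \<bar>f x\<bar>) \<in> borel_measurable M"
    using M by (auto simp: measurable_def)
  then have meas: "(\<lambda>x. ennreal \<bar>f x\<bar>) \<in> borel_measurable (restrict_space M E)"
    by (rule measurable_restrict_space1)
  have ineq: "ennreal \<bar>u (\<gamma> 0) - u (\<gamma> l)\<bar> \<le> curve_integral (\<lambda>x. ennreal \<bar>f x\<bar>) \<gamma> l"
    if \<gamma>: "arc_curve E \<gamma> l" for \<gamma> l
  proof -
    have l: "0 \<le> l" using \<gamma> by (simp add: arc_curve_def)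
    have "ennreal \<bar>u (\<gamma> 0) - u (\<gamma> l)\<bar> \<le>
        (\<integral>\<^sup>+x\<in>{min (\<gamma> 0) (\<gamma> l)..max (\<gamma> 0) (\<gamma> l)}. ennreal \<bar>f x\<bar> \<partial>lborel)"
      using primitive_diff_le[OF u, of "\<gamma> l" "\<gamma> 0"] by (simp add: abs_minus_commute)
    also have "\<dots> \<le> (\<integral>\<^sup>+t\<in>{0..l}. ennreal \<bar>f (\<gamma> t)\<bar> \<partial>lborel)"
      using arc_curve_Lipschitz[OF \<gamma>] by (intro nn_integral_range_le_curve l) auto
    also have "\<dots> = curve_integral (\<lambda>x. ennreal \<bar>f x\<bar>) \<gamma> l"
      by (simp add: curve_integral_def nn_integral_completion)
    finally show ?thesis .
  qed
  \<comment> \<open>No curve is exceptional, so \<open>\<rho> = 0\<close> serves.\<close>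
  show ?thesis
    unfolding weak_upper_gradient_def pae_curve_def
    using meas ineq p by (auto intro!: bexI[of _ "\<lambda>_. 0"] simp: epow_def)
qed

section \<open>Minimal weak upper gradients on a weighted line\<close>

text \<open>
  The setting that doubling and the Poincare inequality will turn out to force. The weight is
  normalized to be Borel measurable and positive everywhere, and \<open>w powr (1 / (1 - p))\<close> is locally
  integrable, which makes points have positive capacity.
\<close>

locale weighted_line =
  fixes p :: real and M :: "real measure" and w :: "real \<Rightarrow> real"
  assumes p: "1 < p"
    and w_pos: "\<And>x. 0 < w x"
    and w_loc: "locally_integrable w"
    and M: "M = completion (density lborel (\<lambda>x. ennreal (w x)))"
    and dual_loc: "locally_integrable (\<lambda>x. w x powr (1 / (1 - p)))"
begin

lemma p_pos: "0 < p" using p by simp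

definition dual :: "real \<Rightarrow> real" where
  "dual x = w x powr (1 / (1 - p))"

lemma w_measurable [measurable]: "w \<in> borel_measurable borel"
  by (rule locally_integrable_measurable[OF w_loc])

lemma dual_locally_integrable: "locally_integrable dual"
  using dual_loc by (simp add: dual_def[abs_def])

lemma dual_measurable [measurable]: "dual \<in> borel_measurable borel"
  by (rule locally_integrable_measurable[OF dual_locally_integrable])

lemma dual_pos: "0 < dual x"
  using w_pos[of x] by (simp add: dual_def)

text \<open>
  This is the Euler-Lagrange equation of the \<open>p\<close>-energy on the line: the flux of a function whose
  derivative is \<open>dual\<close> is constant.
\<close>

lemma dual_powr: "dual x powr (p - 1) * w x = 1"
proof -
  have "dual x powr (p - 1) = w x powr (- 1)"
  proof -
    have "1 / (1 - p) * (p - 1) = - 1" using p by (simp add: field_simps)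
    then show ?thesis by (simp only: dual_def powr_powr)
  qed
  then show ?thesis using w_pos[of x] by (simp add: powr_minus)
qed

lemma dual_powr_p: "dual x powr p * w x = dual x"
  unfolding dual_def by (rule powr_dual_exponent[OF p w_pos])

lemma space_M: "space M = UNIV"
  by (simp add: M)

text \<open>
  \<open>M\<close> and Lebesgue measure have the same null sets, so their completions have the same measurable sets.
\<close>

lemma sets_M: "sets M = sets lebesgue"
proof -
  have "N \<in> null_sets (density lborel (\<lambda>x. ennreal (w x))) \<longleftrightarrow> N \<in> null_sets lborel" for N :: "real set"
  proof -
    have "(AE x\<in>N in lborel. ennreal (w x) = 0) \<longleftrightarrow> (AE x in lborel. x \<notin> N)"
      using w_pos by (intro AE_cong) (metis ennreal_eq_0_iff not_le)
    moreover have "N \<in> null_sets lborel \<longleftrightarrow> N \<in> sets lborel \<and> (AE x in lborel. x \<notin> N)"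
      using AE_iff_null_sets[of N lborel] by (auto simp: null_sets_def)
    ultimately show ?thesis by (subst null_sets_density_iff) auto
  qed
  then show ?thesis by (simp add: M sets_completion)
qed

lemma borel_sets_M: "sets borel \<subseteq> sets M"
  by (auto simp: sets_M)

lemma AE_M: "(AE x in M. P x) \<longleftrightarrow> (AE x in lborel. P x)"
  unfolding M AE_completion_iff by (subst AE_density) (use w_pos in auto)

lemma nn_integral_M:
  "g \<in> borel_measurable borel \<Longrightarrow> (\<integral>\<^sup>+x. g x \<partial>M) = (\<integral>\<^sup>+x. g x * ennreal (w x) \<partial>lborel)"
  unfolding M nn_integral_completion by (subst nn_integral_density) (auto simp: mult.commute)

lemma borel_measurable_M: "g \<in> borel_measurable borel \<Longrightarrow> g \<in> borel_measurable M"
  using borel_sets_M by (auto simp: measurable_def space_M)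

lemma Borel_representative:
  fixes g :: "real \<Rightarrow> ennreal"
  assumes g: "g \<in> borel_measurable (restrict_space M E)" and E: "E \<in> sets borel"
  shows "\<exists>g'\<in>borel_measurable borel. AE x in lborel. x \<in> E \<longrightarrow> g x = g' x"
proof -
  have "(\<lambda>x. g x * indicator E x) \<in> borel_measurable M"
    using g E borel_sets_M by (subst (asm) borel_measurable_restrict_space_iff_ennreal) (auto simp: space_M)
  then obtain g' where g': "g' \<in> borel_measurable (density lborel (\<lambda>x. ennreal (w x)))"
    and "AE x in density lborel (\<lambda>x. ennreal (w x)). g x * indicator E x = g' x"
    using completion_ex_borel_measurable unfolding M by blast
  then have "AE x in lborel. g x * indicator E x = g' x"
    using w_pos by (simp add: AE_density)
  then have "AE x in lborel. x \<in> E \<longrightarrow> g x = g' x" by eventually_elim auto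
  then show ?thesis using g' by auto
qed

text \<open>
  The \<open>p\<close>-energy of a function with derivative \<open>f\<close> over \<open>S\<close>, and at the same time the \<open>p\<close>-th power of
  the norm of \<open>f\<close> in \<open>L\<^sup>p(S, M)\<close>.
\<close>

definition energy :: "(real \<Rightarrow> real) \<Rightarrow> real set \<Rightarrow> ennreal" where
  "energy f S = (\<integral>\<^sup>+x\<in>S. ennreal (\<bar>f x\<bar> powr p * w x) \<partial>lborel)"

lemma energy_mono: "S \<subseteq> T \<Longrightarrow> energy f S \<le> energy f T"
  unfolding energy_def by (intro nn_integral_mono) (auto simp: indicator_def)

lemma nn_integral_M_epow:
  assumes [measurable]: "g' \<in> borel_measurable borel" "S \<in> sets borel"
    and ae: "AE x in lborel. x \<in> S \<longrightarrow> g x = g' x"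
  shows "(\<integral>\<^sup>+x\<in>S. epow (g x) p \<partial>M) = (\<integral>\<^sup>+x\<in>S. epow (g' x) p * ennreal (w x) \<partial>lborel)"
proof -
  have "(\<integral>\<^sup>+x\<in>S. epow (g x) p \<partial>M) = (\<integral>\<^sup>+x\<in>S. epow (g' x) p \<partial>M)"
    using ae unfolding AE_M[symmetric] by (intro nn_integral_cong_AE) (auto elim!: eventually_mono)
  also have "\<dots> = (\<integral>\<^sup>+x\<in>S. epow (g' x) p * ennreal (w x) \<partial>lborel)"
    by (subst nn_integral_M) (auto simp: mult_ac)
  finally show ?thesis .
qed

lemma nn_integral_epow_energy:
  "(\<integral>\<^sup>+x\<in>S. epow (ennreal \<bar>f x\<bar>) p * ennreal (w x) \<partial>lborel) = energy f S"
  unfolding energy_def using p_pos w_pos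
  by (intro nn_integral_cong) (simp add: epow_ennreal ennreal_mult less_imp_le)

lemma nn_integral_M_energy:
  assumes [measurable]: "f \<in> borel_measurable borel" "S \<in> sets borel"
    and ae: "AE x in lborel. x \<in> S \<longrightarrow> g x = ennreal \<bar>f x\<bar>"
  shows "(\<integral>\<^sup>+x\<in>S. epow (g x) p \<partial>M) = energy f S"
proof -
  have "(\<integral>\<^sup>+x\<in>S. epow (g x) p \<partial>M) = (\<integral>\<^sup>+x\<in>S. epow (ennreal \<bar>f x\<bar>) p * ennreal (w x) \<partial>lborel)"
    using ae by (intro nn_integral_M_epow) auto
  then show ?thesis by (simp only: nn_integral_epow_energy)
qed

text \<open>
  The case distinction \<open>r \<le> t * dual x\<close> gives a Young inequality without constants. Its integrated
  form, with \<open>t\<close> adapted to the two sides, acts as the Hoelder inequality.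
\<close>

lemma Young_dual:
  assumes "0 \<le> r" "0 < t"
  shows "r \<le> t * dual x + t powr (1 - p) * (r powr p * w x)"
proof (cases "r \<le> t * dual x")
  case True
  then show ?thesis using w_pos[of x] by (simp add: add_increasing2 less_imp_le)
next
  case False
  have pos: "0 < t * dual x" using assms dual_pos[of x] by simp
  have "1 = t powr (1 - p) * ((t * dual x) powr (p - 1) * w x)"
  proof -
    have "t powr (1 - p) * ((t * dual x) powr (p - 1) * w x)
        = (t powr (1 - p) * t powr (p - 1)) * (dual x powr (p - 1) * w x)"
      using assms dual_pos[of x] by (simp add: powr_mult mult_ac)
    also have "\<dots> = 1" using assms dual_powr[of x] by (simp add: powr_add[symmetric])
    finally show ?thesis by simp
  qed
  also have "\<dots> \<le> t powr (1 - p) * (r powr (p - 1) * w x)"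
    using False p w_pos[of x] pos by (intro mult_left_mono mult_right_mono powr_mono2) auto
  \<comment> \<open>Where \<open>r > t * dual x\<close>, the second summand alone is at least \<open>r\<close>.\<close>
  finally have "r * 1 \<le> r * (t powr (1 - p) * (r powr (p - 1) * w x))"
    using assms by (intro mult_left_mono) auto
  also have "\<dots> = t powr (1 - p) * (r powr p * w x)"
    using False pos by (simp add: powr_diff)
  finally show ?thesis using pos by simp
qed

lemma Young_dual_epow:
  assumes "0 < t"
  shows "r \<le> ennreal t * ennreal (dual x) + ennreal (t powr (1 - p)) * (epow r p * ennreal (w x))"
proof (cases "r = \<infinity>")
  case True
  then show ?thesis using p_pos w_pos[of x] assms by (simp add: epow_def ennreal_top_mult ennreal_mult_top)
next
  case False
  then obtain r' where r': "r = ennreal r'" "0 \<le> r'" by (cases r) auto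
  have "ennreal r' \<le> ennreal (t * dual x + t powr (1 - p) * (r' powr p * w x))"
    using Young_dual[OF r'(2) assms] by (rule ennreal_leI)
  also have "\<dots> = ennreal t * ennreal (dual x) + ennreal (t powr (1 - p)) * (epow r p * ennreal (w x))"
    using r' p_pos assms w_pos[of x] dual_pos[of x]
    by (simp add: epow_ennreal ennreal_mult less_imp_le)
  finally show ?thesis by (simp add: r')
qed

text \<open>
  Since \<open>dual\<close> is locally integrable, functions in \<open>L\<^sup>p(M)\<close> are locally integrable with respect to
  Lebesgue measure.
\<close>

lemma nn_integral_le_dual_epow:
  assumes [measurable]: "g \<in> borel_measurable borel" "S \<in> sets borel" and t: "0 < t"
  shows "(\<integral>\<^sup>+x\<in>S. g x \<partial>lborel) \<le> ennreal t * (\<integral>\<^sup>+x\<in>S. ennreal (dual x) \<partial>lborel)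
    + ennreal (t powr (1 - p)) * (\<integral>\<^sup>+x\<in>S. epow (g x) p * ennreal (w x) \<partial>lborel)"
proof -
  have "(\<integral>\<^sup>+x\<in>S. g x \<partial>lborel) \<le> (\<integral>\<^sup>+x. ennreal t * (ennreal (dual x) * indicator S x)
      + ennreal (t powr (1 - p)) * (epow (g x) p * ennreal (w x) * indicator S x) \<partial>lborel)"
    using Young_dual_epow[OF t] by (intro nn_integral_mono) (auto simp: indicator_def)
  then show ?thesis by (simp add: nn_integral_add nn_integral_cmult)
qed

lemma nn_integral_le_dual_energy:
  assumes [measurable]: "f \<in> borel_measurable borel" "S \<in> sets borel" and t: "0 < t"
  shows "(\<integral>\<^sup>+x\<in>S. ennreal \<bar>f x\<bar> \<partial>lborel) \<le> ennreal t * (\<integral>\<^sup>+x\<in>S. ennreal (dual x) \<partial>lborel)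
    + ennreal (t powr (1 - p)) * energy f S"
  using nn_integral_le_dual_epow[of "\<lambda>x. ennreal \<bar>f x\<bar>" S t] t by (simp add: nn_integral_epow_energy)

lemma dual_finite_Icc: "(\<integral>\<^sup>+x\<in>{a..b}. ennreal (dual x) \<partial>lborel) < \<infinity>"
  using dual_locally_integrable dual_pos by (simp add: locally_integrable_iff abs_of_nonneg less_imp_le)

lemma finite_integral_of_finite_epow:
  assumes "g \<in> borel_measurable borel"
    and "(\<integral>\<^sup>+x\<in>{a..b}. epow (g x) p * ennreal (w x) \<partial>lborel) < \<infinity>"
  shows "(\<integral>\<^sup>+x\<in>{a..b}. g x \<partial>lborel) < \<infinity>"
proof (rule le_less_trans)
  show "(\<integral>\<^sup>+x\<in>{a..b}. g x \<partial>lborel) \<le> ennreal 1 * (\<integral>\<^sup>+x\<in>{a..b}. ennreal (dual x) \<partial>lborel)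
    + ennreal (1 powr (1 - p)) * (\<integral>\<^sup>+x\<in>{a..b}. epow (g x) p * ennreal (w x) \<partial>lborel)"
    using assms(1) by (intro nn_integral_le_dual_epow) auto
  show "ennreal 1 * (\<integral>\<^sup>+x\<in>{a..b}. ennreal (dual x) \<partial>lborel)
    + ennreal (1 powr (1 - p)) * (\<integral>\<^sup>+x\<in>{a..b}. epow (g x) p * ennreal (w x) \<partial>lborel) < \<infinity>"
    using assms(2) dual_finite_Icc[of a b] by simp
qed

text \<open>
  Translations preserve null sets, so the integral over a segment does not see the choice of a
  representative.
\<close>

lemma curve_integral_segment:
  assumes g: "g' \<in> borel_measurable borel" and ae: "AE x in lborel. x \<in> {a..b} \<longrightarrow> g x = g' x"
  shows "curve_integral g (\<lambda>t. a + t) (b - a) = (\<integral>\<^sup>+x\<in>{a..b}. g' x \<partial>lborel)"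
proof -
  obtain N where N: "N \<in> null_sets lborel" "{x. \<not> (x \<in> {a..b} \<longrightarrow> g x = g' x)} \<subseteq> N"
    using ae unfolding eventually_ae_filter by auto
  then have [measurable]: "N \<in> sets borel" by (auto simp: null_sets_def)
  have "AE x in lborel. x \<notin> N" using N(1) by (rule AE_not_in)
  then have "AE t in lborel. a + 1 * t \<notin> N" by (intro AE_borel_affine) auto
  then have *: "AE t in lborel. g (a + t) * indicator {0..b - a} t = g' (a + 1 * t) * indicator {a..b} (a + 1 * t)"
  proof eventually_elim
    case (elim t)
    then have "\<not> a + t \<in> {x. \<not> (x \<in> {a..b} \<longrightarrow> g x = g' x)}"
      using subsetD[OF N(2), of "a + t"] by (simp only: mult_1) metis
    then have "a + t \<in> {a..b} \<longrightarrow> g (a + t) = g' (a + t)" by (simp only: mem_Collect_eq not_not)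
    then show ?case by (auto simp: indicator_def)
  qed
  have "curve_integral g (\<lambda>t. a + t) (b - a) = (\<integral>\<^sup>+t\<in>{0..b - a}. g (a + t) \<partial>lborel)"
    by (simp add: curve_integral_def nn_integral_completion)
  also have "\<dots> = (\<integral>\<^sup>+t. g' (a + 1 * t) * indicator {a..b} (a + 1 * t) \<partial>lborel)"
    using * by (rule nn_integral_cong_AE)
  also have "\<dots> = (\<integral>\<^sup>+x\<in>{a..b}. g' x \<partial>lborel)"
    using nn_integral_real_affine[of "\<lambda>x. g' x * indicator {a..b} x" 1 a] g by simp
  finally show ?thesis .
qed

text \<open>
  The left-hand side of the upper gradient inequality.
\<close>

abbreviation endpoint_gap :: "(real \<Rightarrow> ereal) \<Rightarrow> real \<Rightarrow> real \<Rightarrow> ennreal" where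
  "endpoint_gap u a b \<equiv> (if \<bar>u a\<bar> = \<infinity> \<or> \<bar>u b\<bar> = \<infinity> then \<infinity> else e2ennreal \<bar>u a - u b\<bar>)"

text \<open>
  No segment is exceptional: a function \<open>\<rho>\<close> of finite \<open>p\<close>-norm has finite integral over every segment
  by Young's inequality. The function \<open>g'\<close> is a Borel representative of \<open>g\<close>.
\<close>

lemma weak_upper_gradient_segments:
  assumes wug: "weak_upper_gradient p M E u g" and E: "E \<in> sets borel"
  shows "\<exists>g'\<in>borel_measurable borel. (AE x in lborel. x \<in> E \<longrightarrow> g x = g' x) \<and>
    (\<forall>a b. a < b \<and> {a..b} \<subseteq> E \<longrightarrow> endpoint_gap u a b \<le> (\<integral>\<^sup>+x\<in>{a..b}. g' x \<partial>lborel))"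
proof -
  obtain g' where g'[measurable]: "g' \<in> borel_measurable borel" and ae: "AE x in lborel. x \<in> E \<longrightarrow> g x = g' x"
    using wug E Borel_representative unfolding weak_upper_gradient_def by blast
  obtain \<rho> where \<rho>: "\<rho> \<in> borel_measurable (restrict_space borel E)"
    and \<rho>_fin: "(\<integral>\<^sup>+x\<in>E. epow (\<rho> x) p \<partial>M) < \<infinity>"
    and exc: "\<And>\<gamma> l. arc_curve E \<gamma> l \<Longrightarrow> curve_integral \<rho> \<gamma> l \<noteq> \<infinity> \<Longrightarrow> endpoint_gap u (\<gamma> 0) (\<gamma> l) \<le> curve_integral g \<gamma> l"
    using wug unfolding weak_upper_gradient_def pae_curve_def by blast
  \<comment> \<open>Outside \<open>E\<close> the function \<open>\<rho>\<close> is arbitrary; it is replaced by 0 there.\<close>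
  define r where "r x = \<rho> x * indicator E x" for x
  have r[measurable]: "r \<in> borel_measurable borel"
    using \<rho> E unfolding r_def by (subst (asm) borel_measurable_restrict_space_iff_ennreal) auto
  have r_fin: "(\<integral>\<^sup>+x\<in>E. epow (r x) p * ennreal (w x) \<partial>lborel) < \<infinity>"
    using \<rho>_fin nn_integral_M_epow[OF r E, of \<rho>] by (simp add: r_def)
  have "endpoint_gap u a b \<le> (\<integral>\<^sup>+x\<in>{a..b}. g' x \<partial>lborel)" if ab: "a < b" "{a..b} \<subseteq> E" for a b
  proof -
    have "(\<integral>\<^sup>+x\<in>{a..b}. epow (r x) p * ennreal (w x) \<partial>lborel) < \<infinity>"
      by (rule le_less_trans[OF nn_integral_mono r_fin]) (use ab in \<open>auto simp: indicator_def\<close>)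
    then have "(\<integral>\<^sup>+x\<in>{a..b}. r x \<partial>lborel) < \<infinity>" by (rule finite_integral_of_finite_epow[OF r])
    moreover have "curve_integral \<rho> (\<lambda>t. a + t) (b - a) = (\<integral>\<^sup>+x\<in>{a..b}. r x \<partial>lborel)"
      using ab by (intro curve_integral_segment r AE_I2) (auto simp: r_def subset_eq indicator_def)
    ultimately have "endpoint_gap u (a + 0) (a + (b - a)) \<le> curve_integral g (\<lambda>t. a + t) (b - a)"
      by (intro exc arc_curve_segment ab) auto
    also have "curve_integral g (\<lambda>t. a + t) (b - a) = (\<integral>\<^sup>+x\<in>{a..b}. g' x \<partial>lborel)"
      using ab ae by (intro curve_integral_segment g') (auto elim!: eventually_mono)
    finally have *: "endpoint_gap u (a + 0) (a + (b - a)) \<le> (\<integral>\<^sup>+x\<in>{a..b}. g' x \<partial>lborel)" .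
    have "a + 0 = a" "a + (b - a) = b" by simp_all
    then show ?thesis using * by (simp only:)
  qed
  with g' ae show ?thesis by blast
qed

lemma weak_upper_gradient_primitive_M:
  "primitive u f \<Longrightarrow> weak_upper_gradient p M E (\<lambda>x. ereal (u x)) (\<lambda>x. ennreal \<bar>f x\<bar>)"
  by (rule weak_upper_gradient_primitive[OF _ p_pos borel_sets_M space_M])

text \<open>
  Upper gradients that are locally in \<open>L\<^sup>p(M)\<close> are locally integrable, so minimality on segments
  applies.
\<close>

lemma primitive_le_weak_upper_gradient:
  assumes u: "primitive u f" and h: "weak_upper_gradient p M UNIV (\<lambda>x. ereal (u x)) h" "Lp_loc p M h"
  shows "AE x in lborel. ennreal \<bar>f x\<bar> \<le> h x"
proof -
  have UB: "UNIV \<in> sets (borel :: real measure)" by simp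
  obtain h' where h'[measurable]: "h' \<in> borel_measurable borel" and ae: "AE x in lborel. x \<in> UNIV \<longrightarrow> h x = h' x"
    and seg: "\<forall>a b. a < b \<and> {a..b} \<subseteq> UNIV \<longrightarrow>
      endpoint_gap (\<lambda>x. ereal (u x)) a b \<le> (\<integral>\<^sup>+x\<in>{a..b}. h' x \<partial>lborel)"
    using weak_upper_gradient_segments[OF h(1) UB] by (elim bexE conjE)
  have "\<exists>r>0. (\<integral>\<^sup>+y\<in>ball x r. epow (h' y) p * ennreal (w y) \<partial>lborel) < \<infinity>" for x
  proof -
    obtain r where "r > 0" "(\<integral>\<^sup>+y\<in>ball x r. epow (h y) p \<partial>M) < \<infinity>"
      using h(2) unfolding Lp_loc_def by blast
    moreover have "(\<integral>\<^sup>+y\<in>ball x r. epow (h y) p \<partial>M) = (\<integral>\<^sup>+y\<in>ball x r. epow (h' y) p * ennreal (w y) \<partial>lborel)"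
      using ae by (intro nn_integral_M_epow) auto
    ultimately show ?thesis by auto
  qed
  then have fin: "(\<integral>\<^sup>+y\<in>{a..b}. epow (h' y) p * ennreal (w y) \<partial>lborel) < \<infinity>" for a b
    by (intro locally_finite_imp_finite_Icc) auto
  have "(\<integral>\<^sup>+y\<in>{a..b}. h' y \<partial>lborel) < \<infinity>" for a b
    by (rule finite_integral_of_finite_epow[OF h' fin])
  then have "AE x in lborel. ennreal \<bar>f x\<bar> \<le> h' x"
    using seg by (intro primitive_AE_le[OF u h']) (auto simp: abs_minus_commute)
  then show ?thesis using ae by eventually_elim simp
qed

text \<open>
  Both \<open>\<bar>f\<bar>\<close> and the chosen function \<open>min_wug p M u\<close> are minimal, hence each is at most the other
  almost everywhere.
\<close>

lemma min_wug_primitive: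
  assumes u: "primitive u f" and fin: "\<And>a b. energy f {a..b} < \<infinity>"
  shows "AE x in lborel. min_wug p M (\<lambda>x. ereal (u x)) x = ennreal \<bar>f x\<bar>"
proof -
  let ?u = "\<lambda>x. ereal (u x)" and ?f = "\<lambda>x. ennreal \<bar>f x\<bar>"
  note [measurable] = primitive_measurable[OF u]
  have "Lp_loc p M ?f"
    unfolding Lp_loc_def
  proof (intro conjI allI)
    show "?f \<in> borel_measurable M" by (rule borel_measurable_M) measurable
    fix x
    have "(\<integral>\<^sup>+y\<in>ball x 1. epow (?f y) p \<partial>M) = energy f (ball x 1)"
      by (rule nn_integral_M_energy) auto
    also have "\<dots> \<le> energy f {x - 1..x + 1}"
      by (rule energy_mono) (auto simp: dist_real_def)
    also have "\<dots> < \<infinity>" by (rule fin)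
    finally show "\<exists>r>0. (\<integral>\<^sup>+y\<in>ball x r. epow (?f y) p \<partial>M) < \<infinity>" by (intro exI[of _ 1]) simp
  qed
  then have "is_min_weak_upper_gradient p M ?u ?f"
    unfolding is_min_weak_upper_gradient_def AE_M
    using weak_upper_gradient_primitive_M[OF u] primitive_le_weak_upper_gradient[OF u] by blast
  then have min: "is_min_weak_upper_gradient p M ?u (min_wug p M ?u)"
    unfolding min_wug_def by (rule someI[of "is_min_weak_upper_gradient p M ?u"])
  have "AE x in lborel. min_wug p M ?u x \<le> ?f x"
    using min weak_upper_gradient_primitive_M[OF u] \<open>Lp_loc p M ?f\<close>
    unfolding is_min_weak_upper_gradient_def AE_M by blast
  moreover have "AE x in lborel. ?f x \<le> min_wug p M ?u x"
    using min unfolding is_min_weak_upper_gradient_def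
    by (blast intro: primitive_le_weak_upper_gradient[OF u])
  ultimately show ?thesis by eventually_elim simp
qed

lemma nn_integral_min_wug:
  assumes u: "primitive u f" and fin: "\<And>a b. energy f {a..b} < \<infinity>" and S: "S \<in> sets borel"
  shows "(\<integral>\<^sup>+x\<in>S. epow (min_wug p M (\<lambda>x. ereal (u x)) x) p \<partial>M) = energy f S"
  using primitive_measurable(1)[OF u] S min_wug_primitive[OF u fin]
  by (intro nn_integral_M_energy) auto

section \<open>Newtonian functions on a weighted line\<close>

text \<open>
  A function with a weak upper gradient in \<open>L\<^sup>p(M)\<close> is real-valued and absolutely continuous on
  compact intervals. To state this for functions on the whole line, \<open>u\<close> is extended from \<open>{c..d}\<close> by
  constants.
\<close>

lemma primitive_of_weak_upper_gradient_Icc: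
  assumes wug: "weak_upper_gradient p M E u g" and E: "E \<in> sets borel"
    and cd: "c < d" "{c..d} \<subseteq> E"
    and fin: "(\<integral>\<^sup>+x\<in>E. epow (g x) p \<partial>M) < \<infinity>"
  shows "(\<forall>x\<in>{c..d}. \<bar>u x\<bar> \<noteq> \<infinity>) \<and>
    (\<exists>f. primitive (\<lambda>x. real_of_ereal (u (max c (min d x)))) f \<and> energy f UNIV < \<infinity>)"
proof -
  obtain g' where g'[measurable]: "g' \<in> borel_measurable borel"
    and ae: "AE x in lborel. x \<in> E \<longrightarrow> g x = g' x"
    and seg: "\<forall>a b. a < b \<and> {a..b} \<subseteq> E \<longrightarrow> endpoint_gap u a b \<le> (\<integral>\<^sup>+x\<in>{a..b}. g' x \<partial>lborel)"
    using weak_upper_gradient_segments[OF wug E] by (elim bexE conjE)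
  have fin': "(\<integral>\<^sup>+x\<in>{c..d}. epow (g' x) p * ennreal (w x) \<partial>lborel) < \<infinity>"
  proof -
    have "(\<integral>\<^sup>+x\<in>{c..d}. epow (g' x) p * ennreal (w x) \<partial>lborel)
        \<le> (\<integral>\<^sup>+x\<in>E. epow (g' x) p * ennreal (w x) \<partial>lborel)"
      using cd by (intro nn_integral_mono) (auto simp: indicator_def)
    also have "\<dots> = (\<integral>\<^sup>+x\<in>E. epow (g x) p \<partial>M)"
      by (rule nn_integral_M_epow[OF g' E ae, symmetric])
    finally show ?thesis using fin by simp
  qed
  have g'_fin: "(\<integral>\<^sup>+x\<in>{c..d}. g' x \<partial>lborel) < \<infinity>"
    by (rule finite_integral_of_finite_epow[OF g' fin'])
  have seg': "\<bar>u a\<bar> \<noteq> \<infinity>" "\<bar>u b\<bar> \<noteq> \<infinity>"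
      "ennreal \<bar>real_of_ereal (u b) - real_of_ereal (u a)\<bar> \<le> (\<integral>\<^sup>+x\<in>{a..b}. g' x \<partial>lborel)"
    if ab: "c \<le> a" "a < b" "b \<le> d" for a b
  proof -
    have le: "endpoint_gap u a b \<le> (\<integral>\<^sup>+x\<in>{a..b}. g' x \<partial>lborel)"
    proof -
      have "{a..b} \<subseteq> E" using ab by (intro order_trans[OF _ cd(2)]) auto
      with ab(2) show ?thesis by (intro seg[THEN spec, THEN spec, THEN mp] conjI)
    qed
    have "(\<integral>\<^sup>+x\<in>{a..b}. g' x \<partial>lborel) \<le> (\<integral>\<^sup>+x\<in>{c..d}. g' x \<partial>lborel)"
      using ab by (intro nn_integral_mono) (auto simp: indicator_def)
    then have "(\<integral>\<^sup>+x\<in>{a..b}. g' x \<partial>lborel) < \<infinity>" using g'_fin by simp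
    then have "endpoint_gap u a b < \<infinity>" using le by (rule order.strict_trans1[rotated])
    then show 1: "\<bar>u a\<bar> \<noteq> \<infinity>" "\<bar>u b\<bar> \<noteq> \<infinity>" by (auto split: if_splits)
    then obtain x y where "u a = ereal x" "u b = ereal y" by (metis ereal_real')
    then show "ennreal \<bar>real_of_ereal (u b) - real_of_ereal (u a)\<bar> \<le> (\<integral>\<^sup>+x\<in>{a..b}. g' x \<partial>lborel)"
      using le by (simp add: abs_minus_commute)
  qed
  have real_valued: "\<bar>u x\<bar> \<noteq> \<infinity>" if "x \<in> {c..d}" for x
    using seg'(1)[of x d] seg'(2)[of c d] that cd by (cases "x = d") auto
  \<comment> \<open>Freezing \<open>u\<close> outside \<open>{c..d}\<close> gives a function on the whole line, with \<open>h\<close> in place of \<open>g'\<close>.\<close>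
  define h where "h x = g' x * indicator {c..d} x" for x
  have [measurable]: "h \<in> borel_measurable borel" unfolding h_def by measurable
  define v where "v x = real_of_ereal (u (max c (min d x)))" for x
  have h_fin: "(\<integral>\<^sup>+x\<in>{a..b}. h x \<partial>lborel) < \<infinity>" for a b
  proof -
    have "(\<integral>\<^sup>+x\<in>{a..b}. h x \<partial>lborel) \<le> (\<integral>\<^sup>+x\<in>{c..d}. g' x \<partial>lborel)"
      by (intro nn_integral_mono) (auto simp: h_def indicator_def)
    then show ?thesis using g'_fin by simp
  qed
  have v_le: "ennreal \<bar>v b - v a\<bar> \<le> (\<integral>\<^sup>+x\<in>{a..b}. h x \<partial>lborel)" if ab: "a < b" for a b
  proof (cases "max c (min d a) < max c (min d b)")
    case True
    have "ennreal \<bar>v b - v a\<bar> \<le> (\<integral>\<^sup>+x\<in>{max c (min d a)..max c (min d b)}. g' x \<partial>lborel)"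
      unfolding v_def using cd True by (intro seg') auto
    also have "\<dots> \<le> (\<integral>\<^sup>+x\<in>{a..b}. h x \<partial>lborel)"
      using True cd by (intro nn_integral_mono) (auto simp: h_def indicator_def)
    finally show ?thesis .
  next
    case False
    then have "max c (min d a) = max c (min d b)" using ab by auto
    then show ?thesis by (simp add: v_def)
  qed
  obtain f where f: "primitive v f"
    using primitive_of_integral_bound[of h v] h_fin v_le by auto
  note [measurable] = primitive_measurable[OF f]
  have le: "AE x in lborel. ennreal \<bar>f x\<bar> \<le> h x"
    using h_fin v_le by (intro primitive_AE_le[OF f]) auto
  have "energy f UNIV = (\<integral>\<^sup>+x. epow (ennreal \<bar>f x\<bar>) p * ennreal (w x) \<partial>lborel)"
    by (simp add: nn_integral_epow_energy[symmetric])
  also have "\<dots> \<le> (\<integral>\<^sup>+x\<in>{c..d}. epow (g' x) p * ennreal (w x) \<partial>lborel)"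
  proof (rule nn_integral_mono_AE)
    show "AE x in lborel. epow (ennreal \<bar>f x\<bar>) p * ennreal (w x)
        \<le> epow (g' x) p * ennreal (w x) * indicator {c..d} x"
      using le
    proof eventually_elim
      case (elim x)
      then have "epow (ennreal \<bar>f x\<bar>) p \<le> epow (h x) p" by (rule epow_mono[OF p_pos])
      then show ?case using p_pos
        by (cases "x \<in> {c..d}") (auto simp: h_def epow_def intro: mult_right_mono)
    qed
  qed
  finally have "energy f UNIV < \<infinity>" using fin' by simp
  then show ?thesis
    using f real_valued by (intro conjI ballI exI[of _ f]) (simp_all add: v_def[abs_def])
qed

text \<open>
  Derivatives on an exhausting sequence of intervals agree where both are defined, by
  \<open>primitive_zero_set\<close> applied to the difference, so they can be glued. Starting with radius 1 keeps all
  intervals nondegenerate.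
\<close>

lemma primitive_of_local_primitives:
  assumes loc: "\<And>n::nat. (\<forall>x\<in>{-1 - real n..1 + real n}. \<bar>u x\<bar> \<noteq> \<infinity>) \<and>
    (\<exists>f. primitive (\<lambda>x. real_of_ereal (u (max (-1 - real n) (min (1 + real n) x)))) f \<and> energy f UNIV < \<infinity>)"
  shows "\<exists>v f. u = (\<lambda>x. ereal (v x)) \<and> primitive v f \<and> (\<forall>a b. energy f {a..b} < \<infinity>)"
proof -
  define v where "v x = real_of_ereal (u x)" for x
  define k where "k n = 1 + real n" for n
  have in_k: "\<exists>n. \<bar>x\<bar> < k n" for x unfolding k_def by (meson less_add_same_cancel2 less_trans reals_Archimedean2 zero_less_one)
  have uv: "u x = ereal (v x)" for x
  proof -
    obtain n where "\<bar>x\<bar> < k n" using in_k by blast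
    then have "x \<in> {-1 - real n..1 + real n}" by (auto simp: k_def)
    then have "\<bar>u x\<bar> \<noteq> \<infinity>" by (rule bspec[OF conjunct1[OF loc]])
    then show ?thesis by (simp add: v_def ereal_real')
  qed
  define V where "V n x = v (max (- k n) (min (k n) x))" for n x
  have "\<exists>f. primitive (V n) f \<and> energy f UNIV < \<infinity>" for n
    using loc[of n] unfolding V_def[abs_def] v_def k_def by (simp add: diff_conv_add_uminus[symmetric] add.commute)
  then obtain f where f: "primitive (V n) (f n)" "energy (f n) UNIV < \<infinity>" for n by metis
  have [measurable]: "f n \<in> borel_measurable borel" for n
    by (rule primitive_measurable(1)[OF f(1)])
  have "AE x in lborel. \<bar>x\<bar> < k m \<longrightarrow> f m x = f n x" if mn: "m \<le> n" for m n
  proof -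
    have "primitive (\<lambda>x. V m x + - 1 * V n x) (\<lambda>x. f m x + - 1 * f n x)"
      by (intro primitive_add primitive_cmult f)
    then have "AE x in lborel. V m x + - 1 * V n x = 0 \<longrightarrow> f m x + - 1 * f n x = 0"
      by (rule primitive_zero_set)
    then show ?thesis
      by eventually_elim (use mn in \<open>auto simp: V_def k_def\<close>)
  qed
  then have "AE x in lborel. \<forall>m n. m \<le> n \<longrightarrow> \<bar>x\<bar> < k m \<longrightarrow> f m x = f n x"
    by (simp add: AE_all_countable)
  then have ae: "AE x in lborel. \<forall>m. \<bar>x\<bar> < k m \<longrightarrow> lim (\<lambda>n. f n x) = f m x"
  proof eventually_elim
    case (elim x)
    have "lim (\<lambda>n. f n x) = f m x" if "\<bar>x\<bar> < k m" for m
    proof (rule limI, rule tendsto_eventually)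
      show "\<forall>\<^sub>F n in sequentially. f n x = f m x"
        using eventually_ge_at_top[of m] by eventually_elim (use elim that in metis)
    qed
    then show ?case by blast
  qed
  define F where "F x = lim (\<lambda>n. f n x)" for x
  have [measurable]: "F \<in> borel_measurable borel" unfolding F_def by measurable
  have ex_n: "\<exists>n. - k n < a \<and> b < k n" for a b
  proof -
    obtain n where "\<bar>max \<bar>a\<bar> \<bar>b\<bar>\<bar> < k n" using in_k by blast
    then show ?thesis by (intro exI[of _ n]) auto
  qed
  have Ff: "AE x in lborel. x \<in> {a..b} \<longrightarrow> F x = f n x" if "- k n < a" "b < k n" for a b n
    using ae by eventually_elim (use that in \<open>auto simp: F_def\<close>)
  have "locally_integrable F"
    unfolding locally_integrable_iff
  proof (intro conjI allI)
    fix a b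
    obtain n where n: "- k n < a" "b < k n" using ex_n by blast
    have "(\<integral>\<^sup>+x\<in>{a..b}. ennreal \<bar>F x\<bar> \<partial>lborel) = (\<integral>\<^sup>+x\<in>{a..b}. ennreal \<bar>f n x\<bar> \<partial>lborel)"
      by (intro nn_integral_cong_AE) (use Ff[OF n] in \<open>eventually_elim, auto simp: indicator_def\<close>)
    also have "\<dots> < \<infinity>"
      using primitive_locally_integrable[OF f(1)] by (simp add: locally_integrable_iff)
    finally show "(\<integral>\<^sup>+x\<in>{a..b}. ennreal \<bar>F x\<bar> \<partial>lborel) < \<infinity>" .
  qed measurable
  moreover have "v b - v a = (LINT x:{a..b}|lborel. F x)" if ab: "a \<le> b" for a b
  proof -
    obtain n where n: "- k n < a" "b < k n" using ex_n by blast
    have "v b - v a = V n b - V n a" using n ab by (simp add: V_def)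
    also have "\<dots> = (LINT x:{a..b}|lborel. f n x)" using f(1) ab by (simp add: primitive_def)
    also have "\<dots> = (LINT x:{a..b}|lborel. F x)"
      unfolding set_lebesgue_integral_def
    proof (rule integral_cong_AE)
      show "AE x in lborel. indicator {a..b} x *\<^sub>R f n x = indicator {a..b} x *\<^sub>R F x"
        using Ff[OF n] by eventually_elim (auto simp: indicator_def)
    qed measurable
    finally show ?thesis .
  qed
  ultimately have "primitive v F" by (simp add: primitive_def)
  moreover have "energy F {a..b} < \<infinity>" for a b
  proof -
    obtain n where n: "- k n < a" "b < k n" using ex_n by blast
    have "energy F {a..b} = energy (f n) {a..b}"
      unfolding energy_def
      by (intro nn_integral_cong_AE) (use Ff[OF n] in \<open>eventually_elim, auto simp: indicator_def\<close>)
    also have "\<dots> \<le> energy (f n) UNIV" by (rule energy_mono) simp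
    finally show ?thesis using f(2)[of n] by simp
  qed
  ultimately show ?thesis using uv by blast
qed

lemma N1p_weak_upper_gradient:
  assumes "u \<in> N1p p M E"
  shows "\<exists>g. weak_upper_gradient p M E u g \<and> (\<integral>\<^sup>+x\<in>E. epow (g x) p \<partial>M) < \<infinity>"
proof -
  have "N1p_norm p M E u < \<infinity>" using assms by (simp add: N1p_def)
  then have "(INF g \<in> {g. weak_upper_gradient p M E u g}. \<integral>\<^sup>+x\<in>E. epow (g x) p \<partial>M) < \<infinity>"
    using p_pos unfolding N1p_norm_def by (subst (asm) epow_less_top_iff) auto
  then show ?thesis by (auto simp: INF_less_iff)
qed

text \<open>
  The Newtonian norm of a locally absolutely continuous function is its Sobolev norm, since the
  infimum over all upper gradients is attained by \<open>\<bar>f\<bar>\<close>.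
\<close>

lemma N1p_norm_primitive:
  assumes v: "primitive v f"
  shows "N1p_norm p M UNIV (\<lambda>x. ereal (v x)) = epow (energy v UNIV + energy f UNIV) (1 / p)"
proof -
  note [measurable] = primitive_measurable[OF v]
  have "(\<integral>\<^sup>+x\<in>UNIV. epow (e2ennreal \<bar>ereal (v x)\<bar>) p \<partial>M) = energy v UNIV"
    by (rule nn_integral_M_energy) auto
  moreover have "(INF g \<in> {g. weak_upper_gradient p M UNIV (\<lambda>x. ereal (v x)) g}.
      \<integral>\<^sup>+x\<in>UNIV. epow (g x) p \<partial>M) = energy f UNIV" (is "?I = _")
  proof (rule antisym)
    have f: "(\<integral>\<^sup>+x\<in>UNIV. epow (ennreal \<bar>f x\<bar>) p \<partial>M) = energy f UNIV"
      by (rule nn_integral_M_energy) auto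
    show "?I \<le> energy f UNIV"
      unfolding f[symmetric] by (rule INF_lower) (simp add: weak_upper_gradient_primitive_M[OF v])
    show "energy f UNIV \<le> ?I"
    proof (rule INF_greatest)
      fix g assume "g \<in> {g. weak_upper_gradient p M UNIV (\<lambda>x. ereal (v x)) g}"
      then have g: "weak_upper_gradient p M UNIV (\<lambda>x. ereal (v x)) g" by simp
      show "energy f UNIV \<le> (\<integral>\<^sup>+x\<in>UNIV. epow (g x) p \<partial>M)"
      proof (cases "(\<integral>\<^sup>+x\<in>UNIV. epow (g x) p \<partial>M) < \<infinity>")
        case True
        have "(\<integral>\<^sup>+y\<in>ball x 1. epow (g y) p \<partial>M) \<le> (\<integral>\<^sup>+y\<in>UNIV. epow (g y) p \<partial>M)" for x
          by (intro nn_integral_mono) (auto simp: indicator_def)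
        then have "(\<integral>\<^sup>+y\<in>ball x 1. epow (g y) p \<partial>M) < \<infinity>" for x
          using True by (rule le_less_trans)
        then have "Lp_loc p M g"
          using g by (auto simp: Lp_loc_def weak_upper_gradient_def intro!: exI[of _ 1])
        then have le: "AE x in M. ennreal \<bar>f x\<bar> \<le> g x"
          unfolding AE_M using primitive_le_weak_upper_gradient[OF v g] by blast
        show ?thesis
          unfolding f[symmetric]
          by (intro nn_integral_mono_AE) (use le in \<open>auto elim!: eventually_mono intro: epow_mono[OF p_pos]\<close>)
      qed (simp add: not_less top_unique)
    qed
  qed
  ultimately show ?thesis by (simp add: N1p_norm_def)
qed

lemma energy_continuous_finite:
  assumes "continuous_on UNIV v"
  shows "energy v {a..b} < \<infinity>"
proof -
  have "bounded (v ` {a..b})"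
    using assms by (intro compact_imp_bounded compact_continuous_image) (auto intro: continuous_on_subset)
  then obtain K where K: "\<forall>x\<in>{a..b}. \<bar>v x\<bar> \<le> K" by (auto simp: bounded_iff)
  have "energy v {a..b} \<le> (\<integral>\<^sup>+x. ennreal (K powr p) * (ennreal \<bar>w x\<bar> * indicator {a..b} x) \<partial>lborel)"
    unfolding energy_def
  proof (intro nn_integral_mono)
    fix x
    show "ennreal (\<bar>v x\<bar> powr p * w x) * indicator {a..b} x \<le>
        ennreal (K powr p) * (ennreal \<bar>w x\<bar> * indicator {a..b} x)"
    proof (cases "x \<in> {a..b}")
      case True
      then have "\<bar>v x\<bar> powr p \<le> K powr p" using K p_pos by (intro powr_mono2) auto
      then show ?thesis using True w_pos[of x]
        by (auto simp: ennreal_mult[symmetric] intro!: ennreal_leI mult_right_mono)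
    qed simp
  qed
  also have "\<dots> < \<infinity>"
    using w_loc by (simp add: nn_integral_cmult ennreal_mult_less_top locally_integrable_iff)
  finally show ?thesis .
qed

lemma primitive_measurable_M:
  assumes "primitive v f"
  shows "(\<lambda>x. ereal (v x)) \<in> borel_measurable (restrict_space M E)"
proof -
  have "(\<lambda>x. ereal (v x)) \<in> borel_measurable borel"
    by (intro borel_measurable_ereal primitive_measurable(2)[OF assms])
  then show ?thesis
    using borel_sets_M by (intro measurable_restrict_space1) (auto simp: measurable_def space_M)
qed

lemma primitive_in_N1p_bounded:
  assumes v: "primitive v f" and fin: "\<And>a b. energy f {a..b} < \<infinity>"
    and G: "open G" "bounded G"
  shows "(\<lambda>x. ereal (v x)) \<in> N1p p M G"
proof -
  note [measurable] = primitive_measurable[OF v]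
  have [measurable]: "G \<in> sets borel" using G by simp
  obtain K where K: "G \<subseteq> {-K..K}" using G(2) by (auto simp: bounded_iff abs_le_iff subset_iff) (metis minus_le_iff)
  have "(\<integral>\<^sup>+x\<in>G. epow (e2ennreal \<bar>ereal (v x)\<bar>) p \<partial>M) = energy v G"
    by (rule nn_integral_M_energy) auto
  also have "\<dots> \<le> energy v {-K..K}" using K by (rule energy_mono)
  also have "\<dots> < \<infinity>" by (intro energy_continuous_finite primitive_continuous[OF v])
  finally have 1: "(\<integral>\<^sup>+x\<in>G. epow (e2ennreal \<bar>ereal (v x)\<bar>) p \<partial>M) < \<infinity>" .
  have "(INF g \<in> {g. weak_upper_gradient p M G (\<lambda>x. ereal (v x)) g}. \<integral>\<^sup>+x\<in>G. epow (g x) p \<partial>M)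
      \<le> (\<integral>\<^sup>+x\<in>G. epow (ennreal \<bar>f x\<bar>) p \<partial>M)"
    by (rule INF_lower) (simp add: weak_upper_gradient_primitive_M[OF v])
  also have "\<dots> = energy f G" by (rule nn_integral_M_energy) auto
  also have "\<dots> \<le> energy f {-K..K}" using K by (rule energy_mono)
  also have "\<dots> < \<infinity>" by (rule fin)
  finally have "N1p_norm p M G (\<lambda>x. ereal (v x)) < \<infinity>"
    unfolding N1p_norm_def using 1 p_pos by (subst epow_less_top_iff) auto
  then show ?thesis using primitive_measurable_M[OF v] by (simp add: N1p_def)
qed

text \<open>
  Newtonian functions on the line are real-valued and locally absolutely continuous. Changing the
  value at a single point leaves the space, as points are met by segments, none of which is exceptional.
\<close>

lemma N1p_UNIV_iff:
  "\<phi> \<in> N1p p M UNIV \<longleftrightarrow>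
     (\<exists>v f. \<phi> = (\<lambda>x. ereal (v x)) \<and> primitive v f \<and> energy v UNIV < \<infinity> \<and> energy f UNIV < \<infinity>)"
proof
  assume \<phi>: "\<phi> \<in> N1p p M UNIV"
  then obtain g where g: "weak_upper_gradient p M UNIV \<phi> g" "(\<integral>\<^sup>+x\<in>UNIV. epow (g x) p \<partial>M) < \<infinity>"
    using N1p_weak_upper_gradient by blast
  have "\<exists>v f. \<phi> = (\<lambda>x. ereal (v x)) \<and> primitive v f \<and> (\<forall>a b. energy f {a..b} < \<infinity>)"
    by (intro primitive_of_local_primitives primitive_of_weak_upper_gradient_Icc[OF g(1)] g(2)) auto
  then obtain v f where v: "\<phi> = (\<lambda>x. ereal (v x))" "primitive v f" by blast
  have "epow (energy v UNIV + energy f UNIV) (1 / p) < \<infinity>"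
    using \<phi> N1p_norm_primitive[OF v(2)] by (simp add: N1p_def v(1))
  then have "energy v UNIV + energy f UNIV < \<infinity>"
    using p_pos by (subst (asm) epow_less_top_iff) auto
  then show "\<exists>v f. \<phi> = (\<lambda>x. ereal (v x)) \<and> primitive v f \<and> energy v UNIV < \<infinity> \<and> energy f UNIV < \<infinity>"
    using v by (intro exI[of _ v] exI[of _ f]) auto
next
  assume "\<exists>v f. \<phi> = (\<lambda>x. ereal (v x)) \<and> primitive v f \<and> energy v UNIV < \<infinity> \<and> energy f UNIV < \<infinity>"
  then obtain v f where v: "\<phi> = (\<lambda>x. ereal (v x))" "primitive v f" "energy v UNIV < \<infinity>" "energy f UNIV < \<infinity>"
    by blast
  have "N1p_norm p M UNIV \<phi> < \<infinity>"
    unfolding v(1) N1p_norm_primitive[OF v(2)] using v p_pos by (subst epow_less_top_iff) auto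
  then show "\<phi> \<in> N1p p M UNIV"
    using primitive_measurable_M[OF v(2)] by (simp add: N1p_def v(1))
qed

lemma primitive_of_locally_N1p:
  assumes "\<And>G. open G \<Longrightarrow> bounded G \<Longrightarrow> (\<lambda>x. ereal (u x)) \<in> N1p p M G"
  shows "\<exists>f. primitive u f \<and> (\<forall>a b. energy f {a..b} < \<infinity>)"
proof -
  have "\<exists>v f. (\<lambda>x. ereal (u x)) = (\<lambda>x. ereal (v x)) \<and> primitive v f \<and> (\<forall>a b. energy f {a..b} < \<infinity>)"
  proof (rule primitive_of_local_primitives)
    fix n :: nat
    let ?G = "ball (0::real) (real n + 2)"
    obtain g where g: "weak_upper_gradient p M ?G (\<lambda>x. ereal (u x)) g" "(\<integral>\<^sup>+x\<in>?G. epow (g x) p \<partial>M) < \<infinity>"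
      using N1p_weak_upper_gradient[OF assms[of ?G]] by auto
    show "(\<forall>x\<in>{-1 - real n..1 + real n}. \<bar>ereal (u x)\<bar> \<noteq> \<infinity>) \<and>
      (\<exists>f. primitive (\<lambda>x. real_of_ereal (ereal (u (max (-1 - real n) (min (1 + real n) x))))) f \<and> energy f UNIV < \<infinity>)"
      by (intro primitive_of_weak_upper_gradient_Icc[OF g(1) _ _ _ g(2)]) (auto simp: dist_real_def)
  qed
  then obtain v f where "(\<lambda>x. ereal (u x)) = (\<lambda>x. ereal (v x))" "primitive v f" "\<forall>a b. energy f {a..b} < \<infinity>"
    by blast
  moreover from fun_cong[OF this(1)] have "u = v" by (intro ext) simp
  ultimately show ?thesis by (intro exI[of _ f]) simp
qed

section \<open>Quasiminimizers and the primitive of the dual weight\<close>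

lemma energy_zero [simp]: "energy (\<lambda>_. 0) S = 0"
  using p_pos by (simp add: energy_def)

lemma energy_add_le:
  assumes [measurable]: "f \<in> borel_measurable borel" "g \<in> borel_measurable borel" "S \<in> sets borel"
  shows "energy (\<lambda>x. f x + g x) S \<le> ennreal (2 powr p) * (energy f S + energy g S)"
proof -
  have pw: "\<bar>x + y\<bar> powr p \<le> 2 powr p * (\<bar>x\<bar> powr p + \<bar>y\<bar> powr p)" for x y :: real
  proof -
    have "\<bar>x + y\<bar> powr p \<le> (2 * max \<bar>x\<bar> \<bar>y\<bar>) powr p"
      using p_pos by (intro powr_mono2) auto
    also have "\<dots> = 2 powr p * max \<bar>x\<bar> \<bar>y\<bar> powr p" by (simp add: powr_mult)
    also have "\<dots> \<le> 2 powr p * (\<bar>x\<bar> powr p + \<bar>y\<bar> powr p)"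
      by (intro mult_left_mono) (auto simp: max_def)
    finally show ?thesis .
  qed
  have "energy (\<lambda>x. f x + g x) S \<le> (\<integral>\<^sup>+x. ennreal (2 powr p) *
      (ennreal (\<bar>f x\<bar> powr p * w x) * indicator S x + ennreal (\<bar>g x\<bar> powr p * w x) * indicator S x) \<partial>lborel)"
    unfolding energy_def
  proof (intro nn_integral_mono)
    fix x
    have "\<bar>f x + g x\<bar> powr p * w x \<le> 2 powr p * (\<bar>f x\<bar> powr p + \<bar>g x\<bar> powr p) * w x"
      using pw w_pos[of x] by (intro mult_right_mono) auto
    then have "ennreal (\<bar>f x + g x\<bar> powr p * w x)
        \<le> ennreal (2 powr p * (\<bar>f x\<bar> powr p * w x + \<bar>g x\<bar> powr p * w x))"
      by (intro ennreal_leI) (simp add: algebra_simps)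
    also have "\<dots> = ennreal (2 powr p) * (ennreal (\<bar>f x\<bar> powr p * w x) + ennreal (\<bar>g x\<bar> powr p * w x))"
      using w_pos[of x] by (simp add: ennreal_mult ennreal_plus del: ennreal_plus[symmetric])
    finally show "ennreal (\<bar>f x + g x\<bar> powr p * w x) * indicator S x \<le> ennreal (2 powr p) *
      (ennreal (\<bar>f x\<bar> powr p * w x) * indicator S x + ennreal (\<bar>g x\<bar> powr p * w x) * indicator S x)"
      by (auto simp: indicator_def)
  qed
  also have "\<dots> = ennreal (2 powr p) * (energy f S + energy g S)"
    unfolding energy_def by (simp add: nn_integral_cmult nn_integral_add)
  finally show ?thesis .
qed

lemma energy_dual: "energy (\<lambda>x. c * dual x) S = ennreal (\<bar>c\<bar> powr p) * (\<integral>\<^sup>+x\<in>S. ennreal (dual x) \<partial>lborel)"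
  if [measurable]: "S \<in> sets borel"
proof -
  have "energy (\<lambda>x. c * dual x) S = (\<integral>\<^sup>+x. ennreal (\<bar>c\<bar> powr p) * (ennreal (dual x) * indicator S x) \<partial>lborel)"
    unfolding energy_def
  proof (intro nn_integral_cong)
    fix x
    have "\<bar>c * dual x\<bar> powr p * w x = \<bar>c\<bar> powr p * (dual x powr p * w x)"
      using dual_pos[of x] by (simp add: abs_mult powr_mult)
    then have "ennreal (\<bar>c * dual x\<bar> powr p * w x) = ennreal (\<bar>c\<bar> powr p) * ennreal (dual x)"
      using dual_pos[of x] by (simp add: dual_powr_p ennreal_mult less_imp_le)
    then show "ennreal (\<bar>c * dual x\<bar> powr p * w x) * indicator S x
        = ennreal (\<bar>c\<bar> powr p) * (ennreal (dual x) * indicator S x)" by (simp add: mult.assoc)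
  qed
  then show ?thesis by (simp add: nn_integral_cmult)
qed

text \<open>
  Such a function approximates itself, because the zero function has norm 0.
\<close>

lemma bounded_support_test_function:
  assumes "\<psi> \<in> N1p_bounded_support p M"
  shows "\<psi> \<in> test_functions p M"
proof -
  have N: "\<psi> \<in> N1p p M UNIV" using assms by (simp add: N1p_bounded_support_def)
  then obtain v f where v: "\<psi> = (\<lambda>x. ereal (v x))" "primitive v f" unfolding N1p_UNIV_iff by blast
  have "primitive (\<lambda>_. 0) (\<lambda>_. 0)"
    using primitive_cmult[OF v(2), of 0] by simp
  then have "N1p_norm p M UNIV (\<lambda>x. ereal 0) = epow (energy (\<lambda>_. 0) UNIV + energy (\<lambda>_. 0) UNIV) (1 / p)"
    by (rule N1p_norm_primitive)
  also have "\<dots> = 0" using p_pos by (simp add: epow_def)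
  finally have "N1p_norm p M UNIV (\<lambda>x. \<psi> x - \<psi> x) = 0" by (simp add: v(1) zero_ereal_def)
  then show ?thesis
    using N assms unfolding test_functions_def by (auto intro!: bexI[of _ \<psi>])
qed

text \<open>
  With the minimal upper gradients identified, quasiminimality becomes an inequality between
  integrals of derivatives.
\<close>

lemma quasiminimizer_iff:
  assumes u: "primitive u f" and fin: "\<And>a b. energy f {a..b} < \<infinity>"
  shows "quasiminimizer p M Q (\<lambda>x. ereal (u x)) \<longleftrightarrow>
    (\<forall>v g. (\<lambda>x. ereal (v x)) \<in> test_functions p M \<and> primitive v g \<and> energy g UNIV < \<infinity> \<longrightarrow>
      energy f {x. v x \<noteq> 0} \<le> ennreal Q * energy (\<lambda>x. f x + g x) {x. v x \<noteq> 0})" (is "_ \<longleftrightarrow> ?R")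
proof -
  note [measurable] = primitive_measurable[OF u]
  have eq: "(\<integral>\<^sup>+x\<in>{x. ereal (v x) \<noteq> 0}. epow (min_wug p M (\<lambda>x. ereal (u x)) x) p \<partial>M) = energy f {x. v x \<noteq> 0}"
    "(\<integral>\<^sup>+x\<in>{x. ereal (v x) \<noteq> 0}. epow (min_wug p M (\<lambda>y. ereal (u y) + ereal (v y)) x) p \<partial>M)
      = energy (\<lambda>x. f x + g x) {x. v x \<noteq> 0}"
    if v: "primitive v g" "energy g UNIV < \<infinity>" for v g
  proof -
    note [measurable] = primitive_measurable[OF v(1)]
    have S: "{x. v x \<noteq> 0} \<in> sets borel" by measurable
    have S': "{x. ereal (v x) \<noteq> 0} = {x. v x \<noteq> 0}" by (simp add: zero_ereal_def)
    show "(\<integral>\<^sup>+x\<in>{x. ereal (v x) \<noteq> 0}. epow (min_wug p M (\<lambda>x. ereal (u x)) x) p \<partial>M) = energy f {x. v x \<noteq> 0}"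
      unfolding S' by (rule nn_integral_min_wug[OF u fin S])
    have "energy (\<lambda>x. f x + g x) {a..b} < \<infinity>" for a b
    proof -
      have "energy g {a..b} \<le> energy g UNIV" by (rule energy_mono) simp
      then have "energy g {a..b} < \<infinity>" using v(2) by simp
      then have "ennreal (2 powr p) * (energy f {a..b} + energy g {a..b}) < \<infinity>"
        using fin[of a b] by (simp add: ennreal_mult_less_top)
      then show ?thesis by (rule le_less_trans[OF energy_add_le, rotated -1]) auto
    qed
    then show "(\<integral>\<^sup>+x\<in>{x. ereal (v x) \<noteq> 0}. epow (min_wug p M (\<lambda>y. ereal (u y) + ereal (v y)) x) p \<partial>M)
      = energy (\<lambda>x. f x + g x) {x. v x \<noteq> 0}"
      unfolding S' using nn_integral_min_wug[OF primitive_add[OF u v(1)] _ S] by simp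
  qed
  have N1p: "(\<lambda>x. ereal (u x)) \<in> N1p p M G" if "open G" "bounded G" for G
    using primitive_in_N1p_bounded[OF u fin that] .
  show ?thesis
  proof
    assume L: "quasiminimizer p M Q (\<lambda>x. ereal (u x))"
    show ?R
    proof (intro allI impI)
      fix v g assume v: "(\<lambda>x. ereal (v x)) \<in> test_functions p M \<and> primitive v g \<and> energy g UNIV < \<infinity>"
      then have "(\<integral>\<^sup>+x\<in>{x. ereal (v x) \<noteq> 0}. epow (min_wug p M (\<lambda>x. ereal (u x)) x) p \<partial>M)
        \<le> ennreal Q * (\<integral>\<^sup>+x\<in>{x. ereal (v x) \<noteq> 0}. epow (min_wug p M (\<lambda>y. ereal (u y) + ereal (v y)) x) p \<partial>M)"
        by (intro L[unfolded quasiminimizer_def, THEN conjunct2, THEN bspec]) simp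
      then show "energy f {x. v x \<noteq> 0} \<le> ennreal Q * energy (\<lambda>x. f x + g x) {x. v x \<noteq> 0}"
        by (simp only: eq[OF conjunct1[OF conjunct2[OF v]] conjunct2[OF conjunct2[OF v]]])
    qed
  next
    assume R: ?R
    show "quasiminimizer p M Q (\<lambda>x. ereal (u x))"
      unfolding quasiminimizer_def
    proof (intro conjI allI impI ballI)
      fix G :: "real set" assume "open G \<and> bounded G"
      then show "(\<lambda>x. ereal (u x)) \<in> N1p p M G" using N1p by simp
    next
      fix \<phi> assume \<phi>: "\<phi> \<in> test_functions p M"
      then have "\<phi> \<in> N1p p M UNIV" by (simp add: test_functions_def)
      then obtain v g where v: "\<phi> = (\<lambda>x. ereal (v x))" "primitive v g" "energy g UNIV < \<infinity>"
        unfolding N1p_UNIV_iff by blast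
      have "energy f {x. v x \<noteq> 0} \<le> ennreal Q * energy (\<lambda>x. f x + g x) {x. v x \<noteq> 0}"
        using R \<phi> v by blast
      then show "(\<integral>\<^sup>+x\<in>{x. \<phi> x \<noteq> 0}. epow (min_wug p M (\<lambda>x. ereal (u x)) x) p \<partial>M)
        \<le> ennreal Q * (\<integral>\<^sup>+x\<in>{x. \<phi> x \<noteq> 0}. epow (min_wug p M (\<lambda>y. ereal (u y) + \<phi> y) x) p \<partial>M)"
        unfolding v(1) by (simp only: eq[OF v(2,3)])
    qed
  qed
qed

text \<open>
  The derivative of a function of bounded support integrates to 0. If \<open>dual\<close> has finite mass, then
  Young's inequality shows that the integral of the derivative depends continuously on the Newtonian
  norm, so the property passes to the closure.
\<close>

lemma test_function_integral_eq_0: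
  assumes D: "(\<integral>\<^sup>+x. ennreal (dual x) \<partial>lborel) < \<infinity>"
    and v: "(\<lambda>x. ereal (v x)) \<in> test_functions p M" "primitive v g" "energy g UNIV < \<infinity>"
  shows "integrable lborel g" "(LINT x|lborel. g x) = 0"
proof -
  have L1: "(\<integral>\<^sup>+x. ennreal \<bar>h x\<bar> \<partial>lborel) \<le> ennreal t * (\<integral>\<^sup>+x. ennreal (dual x) \<partial>lborel)
      + ennreal (t powr (1 - p)) * energy h UNIV"
    if "h \<in> borel_measurable borel" "0 < t" for h t
    using nn_integral_le_dual_energy[of h UNIV t] that by simp
  have int: "integrable lborel h" if h: "h \<in> borel_measurable borel" "energy h UNIV < \<infinity>" for h
  proof -
    have "(\<integral>\<^sup>+x. ennreal \<bar>h x\<bar> \<partial>lborel) < \<infinity>"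
      by (rule le_less_trans[OF L1[OF h(1), of 1]]) (use D h in simp_all)
    then show ?thesis using h(1) by (simp add: integrable_iff_bounded)
  qed
  show g_int: "integrable lborel g" by (rule int[OF primitive_measurable(1)[OF v(2)] v(3)])
  define d where "d = enn2real (\<integral>\<^sup>+x. ennreal (dual x) \<partial>lborel)"
  have d: "(\<integral>\<^sup>+x. ennreal (dual x) \<partial>lborel) = ennreal d" "0 \<le> d" using D by (auto simp: d_def)
  have "\<bar>LINT x|lborel. g x\<bar> \<le> \<delta>" if \<delta>: "0 < \<delta>" for \<delta>
  proof -
    \<comment> \<open>Both summands of Young's inequality become at most \<open>\<delta> / 2\<close>: first \<open>t\<close> makes the multiple
        of the mass \<open>d\<close> small, then \<open>\<epsilon>\<close> is adapted to \<open>t\<close>. In \<open>t\<close>, \<open>d + 1\<close> avoids a division by 0.\<close>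
    define t where "t = \<delta> / (2 * (d + 1))"
    have t: "0 < t" "t * d \<le> \<delta> / 2" using \<delta> d by (auto simp: t_def field_simps)
    define \<epsilon> where "\<epsilon> = (\<delta> / 2 * t powr (p - 1)) powr (1 / p)"
    have \<epsilon>: "0 < \<epsilon>" using \<delta> t by (simp add: \<epsilon>_def)
    have \<epsilon>p: "t powr (1 - p) * \<epsilon> powr p = \<delta> / 2"
      using \<delta> t p_pos by (simp add: \<epsilon>_def powr_powr powr_add[symmetric] mult_ac)
    obtain \<psi> where \<psi>: "\<psi> \<in> N1p_bounded_support p M"
      "N1p_norm p M UNIV (\<lambda>x. ereal (v x) - \<psi> x) < ennreal \<epsilon>"
      using v(1) \<epsilon> unfolding test_functions_def by blast
    then have "\<psi> \<in> N1p p M UNIV" by (simp add: N1p_bounded_support_def)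
    then obtain z h where z: "\<psi> = (\<lambda>x. ereal (z x))" "primitive z h" "energy h UNIV < \<infinity>"
      unfolding N1p_UNIV_iff by blast
    obtain G where G: "bounded G" "\<And>x. x \<notin> G \<Longrightarrow> z x = 0"
      using \<psi>(1) by (auto simp: N1p_bounded_support_def z(1) zero_ereal_def)
    obtain K0 where K0: "\<And>x. x \<in> G \<Longrightarrow> \<bar>x\<bar> \<le> K0" using G(1) by (auto simp: bounded_iff)
    define K where "K = \<bar>K0\<bar> + 1"
    have z0: "z x = 0" if "K \<le> \<bar>x\<bar>" for x
      using K0[of x] G(2)[of x] that by (cases "x \<in> G") (auto simp: K_def)
    have h_int: "integrable lborel h" by (rule int[OF primitive_measurable(1)[OF z(2)] z(3)])
    have "AE x in lborel. h x = indicator {-K..K} x *\<^sub>R h x"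
      using primitive_zero_set[OF z(2)]
    proof eventually_elim
      case (elim x)
      then show ?case using z0[of x] by (cases "K \<le> \<bar>x\<bar>") (auto simp: indicator_def)
    qed
    then have "(LINT x|lborel. h x) = (LINT x:{-K..K}|lborel. h x)"
      unfolding set_lebesgue_integral_def using primitive_measurable(1)[OF z(2)] by (intro integral_cong_AE) auto
    also have "\<dots> = z K - z (-K)" using z(2) by (simp add: primitive_def K_def)
    also have "\<dots> = 0" using z0 by (simp add: K_def)
    finally have h0: "(LINT x|lborel. h x) = 0" .
    define k where "k x = g x + - 1 * h x" for x
    have pk: "primitive (\<lambda>x. v x + - 1 * z x) k"
      unfolding k_def[abs_def] by (intro primitive_add primitive_cmult v z)
    have "energy k UNIV \<le> epow (epow (energy (\<lambda>x. v x + - 1 * z x) UNIV + energy k UNIV) (1 / p)) p"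
      using p_pos by (simp add: epow_inverse)
    also have "epow (energy (\<lambda>x. v x + - 1 * z x) UNIV + energy k UNIV) (1 / p)
        = N1p_norm p M UNIV (\<lambda>x. ereal (v x) - \<psi> x)"
      using N1p_norm_primitive[OF pk] by (simp add: z(1))
    also have "epow \<dots> p \<le> epow (ennreal \<epsilon>) p"
      using \<psi>(2) by (intro epow_mono p_pos) simp
    also have "\<dots> = ennreal (\<epsilon> powr p)" using \<epsilon> by (simp add: epow_ennreal)
    finally have ek: "energy k UNIV \<le> ennreal (\<epsilon> powr p)" .
    have k_int: "integrable lborel k" unfolding k_def using g_int h_int by auto
    have "ennreal \<bar>LINT x|lborel. g x\<bar> = ennreal \<bar>LINT x|lborel. k x\<bar>"
      using g_int h_int h0 by (simp add: k_def)
    also have "\<dots> \<le> ennreal (LINT x|lborel. \<bar>k x\<bar>)"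
      using integral_abs_bound[of lborel k] by (rule ennreal_leI)
    also have "\<dots> = (\<integral>\<^sup>+x. ennreal \<bar>k x\<bar> \<partial>lborel)"
      using k_int by (intro nn_integral_eq_integral[symmetric]) auto
    also have "\<dots> \<le> ennreal t * ennreal d + ennreal (t powr (1 - p)) * energy k UNIV"
      using L1[OF primitive_measurable(1)[OF pk] t(1)] by (simp add: d)
    also have "\<dots> \<le> ennreal t * ennreal d + ennreal (t powr (1 - p)) * ennreal (\<epsilon> powr p)"
      using ek by (intro add_left_mono mult_left_mono) auto
    also have "\<dots> = ennreal (t * d + t powr (1 - p) * \<epsilon> powr p)"
      using t d by (simp add: ennreal_mult)
    also have "\<dots> \<le> ennreal \<delta>" unfolding \<epsilon>p using t by (intro ennreal_leI) simp
    finally show ?thesis using \<delta> by (subst (asm) ennreal_le_iff) simp_all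
  qed
  then have "\<bar>LINT x|lborel. g x\<bar> \<le> 0" by (rule field_le_epsilon) simp
  then show "(LINT x|lborel. g x) = 0" by (simp only: abs_le_zero_iff)
qed

text \<open>
  The primitive of \<open>dual\<close> is the candidate suggested by the Euler-Lagrange equation. Its oscillation
  and its energy are both the mass of \<open>dual\<close>. It minimizes energy because the tangent inequality bounds
  the energy of a competitor with derivative \<open>dual + g\<close> from below by the integral of \<open>dual + p * g\<close>,
  where \<open>g\<close> contributes 0: it has integral 0 over the line and vanishes where the test function does.
\<close>

lemma p_harmonic_dual_primitive:
  assumes D: "(\<integral>\<^sup>+x. ennreal (dual x) \<partial>lborel) < \<infinity>" and u: "primitive u dual"
  shows "p_harmonic p M u" "bounded (range u)" "finite_energy p M u" "\<not> u constant_on UNIV"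
proof -
  have e1: "energy dual S = (\<integral>\<^sup>+x\<in>S. ennreal (dual x) \<partial>lborel)" if "S \<in> sets borel" for S
    using energy_dual[OF that, of 1] by simp
  have le_D: "(\<integral>\<^sup>+x\<in>S. ennreal (dual x) \<partial>lborel) \<le> (\<integral>\<^sup>+x. ennreal (dual x) \<partial>lborel)" for S
    by (intro nn_integral_mono) (auto simp: indicator_def)
  have fin: "energy dual S < \<infinity>" if "S \<in> sets borel" for S
    using le_less_trans[OF le_D D] that by (simp add: e1)
  have finI: "energy dual {a..b} < \<infinity>" for a b by (rule fin) simp
  have dual_int: "integrable lborel dual"
    using D dual_pos by (simp add: integrable_iff_bounded abs_of_nonneg less_imp_le)
  show "finite_energy p M u"
    unfolding finite_energy_def
    using nn_integral_min_wug[OF u finI, of UNIV] fin[of UNIV] by simp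
  have diff: "ennreal \<bar>u x - u 0\<bar> \<le> (\<integral>\<^sup>+x. ennreal (dual x) \<partial>lborel)" for x
    using order_trans[OF primitive_diff_le[OF u, of x 0]] le_D dual_pos by (simp add: abs_of_nonneg less_imp_le)
  have "\<bar>u x - u 0\<bar> \<le> enn2real (\<integral>\<^sup>+x. ennreal (dual x) \<partial>lborel)" for x
    using enn2real_mono[OF diff[of x]] D by simp
  then have "\<bar>u x\<bar> \<le> \<bar>u 0\<bar> + enn2real (\<integral>\<^sup>+x. ennreal (dual x) \<partial>lborel)" for x
    using abs_triangle_ineq2[of "u x" "u 0"] by (smt (verit))
  then show "bounded (range u)" unfolding bounded_iff by (intro exI ballI) auto
  show "\<not> u constant_on UNIV"
  proof
    assume "u constant_on UNIV"
    then have c: "u x = u 0" for x by (auto simp: constant_on_def)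
    have "u b - u a = 0" for a b using c[of a] c[of b] by simp
    then have "AE x in lborel. ennreal \<bar>dual x\<bar> \<le> 0"
      by (intro primitive_AE_le[OF u]) simp_all
    then have "AE x::real in lborel. False"
    proof (rule eventually_mono)
      show "ennreal \<bar>dual x\<bar> \<le> 0 \<Longrightarrow> False" for x using dual_pos[of x] by simp
    qed
    then show False by (simp add: eventually_False ae_filter_eq_bot_iff)
  qed
  have "quasiminimizer p M 1 (\<lambda>x. ereal (u x))"
    unfolding quasiminimizer_iff[OF u finI]
  proof (intro allI impI)
    fix v g assume "(\<lambda>x. ereal (v x)) \<in> test_functions p M \<and> primitive v g \<and> energy g UNIV < \<infinity>"
    then have v: "(\<lambda>x. ereal (v x)) \<in> test_functions p M" "primitive v g" "energy g UNIV < \<infinity>" by auto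
    note [measurable] = primitive_measurable[OF v(2)]
    let ?S = "{x. v x \<noteq> 0}"
    have S[measurable]: "?S \<in> sets borel" by measurable
    have g: "integrable lborel g" "(LINT x|lborel. g x) = 0"
      using test_function_integral_eq_0[OF D v] by auto
    have "AE x in lborel. g x = indicator ?S x * g x"
      using primitive_zero_set[OF v(2)] by eventually_elim (auto simp: indicator_def)
    then have gS: "(LINT x|lborel. indicator ?S x * g x) = 0"
      using integral_cong_AE[of g lborel "\<lambda>x. indicator ?S x * g x"] g(2) by simp
    have iS: "integrable lborel (\<lambda>x. indicator ?S x * dual x)" "integrable lborel (\<lambda>x. indicator ?S x * g x)"
      using integrable_mult_indicator[OF _ dual_int, of ?S] integrable_mult_indicator[OF _ g(1), of ?S] by auto
    \<comment> \<open>\<open>?h\<close> is the tangent of the energy density at \<open>dual\<close>, restricted to \<open>?S\<close>.\<close>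
    let ?h = "\<lambda>x. indicator ?S x * dual x + p * (indicator ?S x * g x)"
    have hi: "integrable lborel ?h" using iS by simp
    have "energy dual ?S = (\<integral>\<^sup>+x. ennreal (indicator ?S x * dual x) \<partial>lborel)"
      unfolding e1[OF S] by (intro nn_integral_cong) (auto simp: indicator_def)
    also have "\<dots> = ennreal (LINT x|lborel. indicator ?S x * dual x)"
      using iS dual_pos by (intro nn_integral_eq_integral) (auto simp: less_imp_le)
    also have "(LINT x|lborel. indicator ?S x * dual x) = (LINT x|lborel. ?h x)"
      using iS gS by simp
    also have "ennreal (LINT x|lborel. ?h x) \<le> (\<integral>\<^sup>+x. ennreal (?h x) \<partial>lborel)"
    proof -
      have "(LINT x|lborel. ?h x) \<le> enn2real (\<integral>\<^sup>+x. ennreal (?h x) \<partial>lborel)"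
        unfolding real_lebesgue_integral_def[OF hi] by simp
      then have "ennreal (LINT x|lborel. ?h x) \<le> ennreal (enn2real (\<integral>\<^sup>+x. ennreal (?h x) \<partial>lborel))"
        by (rule ennreal_leI)
      also have "\<dots> \<le> (\<integral>\<^sup>+x. ennreal (?h x) \<partial>lborel)" by (rule ennreal_enn2real_le)
      finally show ?thesis .
    qed
    also have "\<dots> \<le> energy (\<lambda>x. dual x + g x) ?S"
      unfolding energy_def
    proof (intro nn_integral_mono)
      fix x
      have "(dual x powr p + p * dual x powr (p - 1) * g x) * w x \<le> \<bar>dual x + g x\<bar> powr p * w x"
        using w_pos[of x] by (intro mult_right_mono powr_tangent_le p dual_pos) auto
      moreover have "(dual x powr p + p * dual x powr (p - 1) * g x) * w x = dual x + p * g x"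
        using dual_powr_p[of x] dual_powr[of x] by (simp add: algebra_simps)
      ultimately show "ennreal (?h x) \<le> ennreal (\<bar>dual x + g x\<bar> powr p * w x) * indicator ?S x"
        by (auto simp: indicator_def intro!: ennreal_leI)
    qed
    finally show "energy dual ?S \<le> ennreal 1 * energy (\<lambda>x. dual x + g x) ?S" by (simp add: ennreal_leI)
  qed
  then show "p_harmonic p M u"
    by (simp add: p_harmonic_def primitive_continuous[OF u])
qed

section \<open>A Liouville theorem for quasiharmonic functions\<close>

text \<open>
  For \<open>a < b\<close>, the power \<open>1 - p\<close> of this number is the \<open>p\<close>-capacity between \<open>a\<close> and \<open>b\<close>.
\<close>

definition dual_mass :: "real \<Rightarrow> real \<Rightarrow> real" where
  "dual_mass a b = (LINT x:{a..b}|lborel. dual x)"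

lemma ennreal_dual_mass: "ennreal (dual_mass a b) = (\<integral>\<^sup>+x\<in>{a..b}. ennreal (dual x) \<partial>lborel)"
  unfolding dual_mass_def
  by (rule set_integral_eq_nn_integral_nonneg[OF dual_locally_integrable less_imp_le[OF dual_pos]])

lemma dual_mass_nonneg: "0 \<le> dual_mass a b"
  unfolding dual_mass_def set_lebesgue_integral_def
  by (intro Bochner_Integration.integral_nonneg) (simp add: less_imp_le[OF dual_pos])

lemma dual_mass_pos:
  assumes "a < b" shows "0 < dual_mass a b"
proof (rule ccontr)
  assume "\<not> 0 < dual_mass a b"
  then have "dual_mass a b = 0" using dual_mass_nonneg[of a b] by simp
  then have "(\<integral>\<^sup>+x\<in>{a..b}. ennreal (dual x) \<partial>lborel) = 0"
    using ennreal_dual_mass[of a b] by simp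
  then have "AE x in lborel. ennreal (dual x) * indicator {a..b} x = 0"
    by (subst (asm) nn_integral_0_iff_AE) auto
  then have "AE x in lborel. x \<notin> {a..b}"
  proof eventually_elim
    case (elim x)
    then show ?case using dual_pos[of x] by (auto simp: indicator_def)
  qed
  then have "{a..b} \<in> null_sets lborel" using AE_iff_null_sets[of "{a..b}" lborel] by simp
  then show False using assms by (auto simp: null_sets_def)
qed

lemma energy_Un:
  assumes [measurable]: "h \<in> borel_measurable borel" "A \<in> sets borel" "B \<in> sets borel" and "A \<inter> B = {}"
  shows "energy h (A \<union> B) = energy h A + energy h B"
proof -
  have "energy h (A \<union> B) = (\<integral>\<^sup>+x. ennreal (\<bar>h x\<bar> powr p * w x) * indicator A x
      + ennreal (\<bar>h x\<bar> powr p * w x) * indicator B x \<partial>lborel)"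
    unfolding energy_def using assms(4) by (intro nn_integral_cong) (auto simp: indicator_def)
  also have "\<dots> = energy h A + energy h B"
    unfolding energy_def by (intro nn_integral_add) auto
  finally show ?thesis .
qed

text \<open>
  The competitor is the \<open>p\<close>-harmonic function on \<open>{a..b}\<close> with the same boundary values as \<open>u\<close>. Its
  derivative is the multiple \<open>c * dual\<close>, whose energy is explicit.
\<close>

lemma quasiminimizer_energy_le:
  assumes u: "primitive u f" and fin: "\<And>a b. energy f {a..b} < \<infinity>"
    and qm: "quasiminimizer p M Q (\<lambda>x. ereal (u x))" and Q: "1 \<le> Q" and ab: "a < b"
  shows "energy f {a..b} \<le> ennreal (Q * (\<bar>(u b - u a) / dual_mass a b\<bar> powr p * dual_mass a b))"
proof -
  note [measurable] = primitive_measurable[OF u]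
  \<comment> \<open>\<open>c\<close> is chosen so that \<open>c * dual\<close> and \<open>f\<close> have the same integral over \<open>{a..b}\<close>, which makes
      the primitive of the bump \<open>g\<close> vanish to the right of \<open>b\<close>.\<close>
  define c where "c = (u b - u a) / dual_mass a b"
  define k where "k x = c * dual x + - 1 * f x" for x
  define g where "g x = k x * indicator {a<..<b} x" for x
  have lk: "locally_integrable k"
    unfolding k_def[abs_def] using u dual_locally_integrable
    by (intro locally_integrable_add locally_integrable_cmult) (auto simp: primitive_def)
  note [measurable] = locally_integrable_measurable[OF lk]
  have lg: "locally_integrable g"
    unfolding g_def[abs_def] by (intro locally_integrable_restrict lk) simp
  note [measurable] = locally_integrable_measurable[OF lg]
  have g0: "g x = 0" if "x \<notin> {a<..<b}" for x using that by (simp add: g_def)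
  obtain v where v: "primitive v g" and v_left: "\<forall>x\<le>a. v x = 0"
    and v_b: "\<forall>x\<ge>b. v x = (LINT t:{a..b}|lborel. g t)"
    using primitive_of_bump[OF lg less_imp_le[OF ab] g0] by blast
  note [measurable] = primitive_measurable[OF v]
  have cont: "continuous_on UNIV v" using v by (rule primitive_continuous)
  have "(LINT t:{a..b}|lborel. g t) = (LINT t:{a..b}|lborel. k t)"
    unfolding set_lebesgue_integral_def
  proof (rule integral_cong_AE)
    have "AE t in lborel. t \<noteq> a" "AE t in lborel. t \<noteq> b" by (auto intro: AE_lborel_singleton)
    then show "AE t in lborel. indicator {a..b} t *\<^sub>R g t = indicator {a..b} t *\<^sub>R k t"
      by eventually_elim (auto simp: g_def indicator_def)
  qed measurable
  also have "\<dots> = (LINT t:{a..b}|lborel. c * dual t) + (LINT t:{a..b}|lborel. - 1 * f t)"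
  proof -
    have "locally_integrable (\<lambda>t. c * dual t)" "locally_integrable (\<lambda>t. - 1 * f t)"
      by (rule locally_integrable_cmult, rule dual_locally_integrable)
        (rule locally_integrable_cmult, rule primitive_locally_integrable[OF u])
    then show ?thesis
      unfolding k_def locally_integrable_def by (intro set_integral_add) blast+
  qed
  also have "\<dots> = c * dual_mass a b - (u b - u a)"
    unfolding set_integral_mult_right using u ab by (simp add: dual_mass_def primitive_def)
  also have "\<dots> = 0" using dual_mass_pos[OF ab] by (simp add: c_def)
  finally have v_right: "\<forall>x\<ge>b. v x = 0" using v_b by simp
  let ?S = "{x. v x \<noteq> 0}"
  have Sab: "?S \<subseteq> {a<..<b}" using v_left v_right by (auto simp: not_le[symmetric])
  have S[measurable]: "?S \<in> sets borel" by measurable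
  have ed: "energy (\<lambda>x. c * dual x) {a..b} = ennreal (\<bar>c\<bar> powr p * dual_mass a b)"
    by (simp add: energy_dual ennreal_dual_mass[symmetric] ennreal_mult dual_mass_nonneg)
  have ef: "energy (\<lambda>x. - 1 * f x) {a..b} = energy f {a..b}" by (simp add: energy_def)
  have "energy g UNIV \<le> energy k {a..b}"
    unfolding energy_def using p_pos by (intro nn_integral_mono) (auto simp: g_def indicator_def)
  also have "\<dots> \<le> ennreal (2 powr p) * (energy (\<lambda>x. c * dual x) {a..b} + energy (\<lambda>x. - 1 * f x) {a..b})"
    unfolding k_def by (rule energy_add_le) auto
  also have "\<dots> < \<infinity>" unfolding ed ef using fin[of a b] by (simp add: ennreal_mult_less_top)
  finally have eg: "energy g UNIV < \<infinity>" .
  have "energy v UNIV \<le> energy v {a..b}"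
    unfolding energy_def
  proof (intro nn_integral_mono)
    fix x
    show "ennreal (\<bar>v x\<bar> powr p * w x) * indicator UNIV x \<le> ennreal (\<bar>v x\<bar> powr p * w x) * indicator {a..b} x"
    proof (cases "x \<in> {a..b}")
      case False
      then have "v x = 0" using v_left v_right by auto
      then show ?thesis using p_pos by simp
    qed simp
  qed
  then have ev: "energy v UNIV < \<infinity>"
    using energy_continuous_finite[OF cont] by (rule le_less_trans)
  have "(\<lambda>x. ereal (v x)) \<in> N1p p M UNIV"
    unfolding N1p_UNIV_iff using v eg ev by blast
  then have "(\<lambda>x. ereal (v x)) \<in> N1p_bounded_support p M"
    unfolding N1p_bounded_support_def using v_left v_right
    by (auto intro!: exI[of _ "{a<..<b}"] simp: not_less zero_ereal_def)
  then have test: "(\<lambda>x. ereal (v x)) \<in> test_functions p M" by (rule bounded_support_test_function)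
  have 1: "energy f ?S \<le> ennreal Q * energy (\<lambda>x. c * dual x) ?S"
  proof -
    have "energy f ?S \<le> ennreal Q * energy (\<lambda>x. f x + g x) ?S"
      using qm test v eg unfolding quasiminimizer_iff[OF u fin] by blast
    also have "energy (\<lambda>x. f x + g x) ?S = energy (\<lambda>x. c * dual x) ?S"
      unfolding energy_def
    proof (intro nn_integral_cong)
      fix x
      show "ennreal (\<bar>f x + g x\<bar> powr p * w x) * indicator ?S x = ennreal (\<bar>c * dual x\<bar> powr p * w x) * indicator ?S x"
        using Sab by (cases "x \<in> ?S") (auto simp: g_def k_def subset_iff)
    qed
    finally show ?thesis .
  qed
  \<comment> \<open>Quasiminimality only speaks about \<open>?S\<close>. On the rest of \<open>{a..b}\<close>, \<open>v\<close> vanishes, hence so does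
      its derivative, and the two integrands agree.\<close>
  let ?Z = "{a..b} - ?S"
  have 2: "energy f ?Z = energy (\<lambda>x. c * dual x) ?Z"
    unfolding energy_def
  proof (rule nn_integral_cong_AE)
    have "AE x in lborel. x \<noteq> a" "AE x in lborel. x \<noteq> b" by (auto intro: AE_lborel_singleton)
    then show "AE x in lborel. ennreal (\<bar>f x\<bar> powr p * w x) * indicator ?Z x
        = ennreal (\<bar>c * dual x\<bar> powr p * w x) * indicator ?Z x"
      using primitive_zero_set[OF v]
    proof eventually_elim
      case (elim x)
      show ?case
      proof (cases "x \<in> ?Z")
        case True
        then have "v x = 0" "x \<in> {a<..<b}" using elim by auto
        then have "k x = 0" using elim by (simp add: g_def)
        then show ?thesis by (simp add: k_def)
      qed simp
    qed
  qed
  have Z[measurable]: "?Z \<in> sets borel" by simp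
  have un: "{a..b} = ?S \<union> ?Z" "?S \<inter> ?Z = {}" using Sab by auto
  have "energy f {a..b} = energy f ?S + energy f ?Z"
    by (subst un(1), rule energy_Un) (use un in auto)
  also have "\<dots> \<le> ennreal Q * energy (\<lambda>x. c * dual x) ?S + ennreal Q * energy (\<lambda>x. c * dual x) ?Z"
  proof (intro add_mono 1)
    have "1 * energy f ?Z \<le> ennreal Q * energy f ?Z" using Q by (intro mult_right_mono) auto
    then show "energy f ?Z \<le> ennreal Q * energy (\<lambda>x. c * dual x) ?Z" using 2 by simp
  qed
  also have "\<dots> = ennreal Q * (energy (\<lambda>x. c * dual x) ?S + energy (\<lambda>x. c * dual x) ?Z)"
    by (simp add: distrib_left)
  also have "energy (\<lambda>x. c * dual x) ?S + energy (\<lambda>x. c * dual x) ?Z = energy (\<lambda>x. c * dual x) {a..b}"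
    using energy_Un[OF _ S Z un(2), of "\<lambda>x. c * dual x"] un(1) by simp
  also have "ennreal Q * \<dots> = ennreal (Q * (\<bar>c\<bar> powr p * dual_mass a b))"
    unfolding ed using Q by (simp add: ennreal_mult dual_mass_nonneg)
  finally show ?thesis by (simp add: c_def)
qed

lemma dual_mass_at_top:
  assumes "(\<integral>\<^sup>+x. ennreal (dual x) \<partial>lborel) = \<infinity>"
  shows "filterlim (\<lambda>n::nat. dual_mass (- real n) (real n)) at_top sequentially"
proof -
  let ?D = "density lborel (\<lambda>x. ennreal (dual x))"
  have "(\<lambda>n. emeasure ?D {-real n..real n}) \<longlonglongrightarrow> emeasure ?D (\<Union>n. {-real n..real n})"
    by (rule Lim_emeasure_incseq) (auto simp: incseq_def)
  moreover have "(\<Union>n. {-real n..real n}) = UNIV"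
  proof (intro equalityI subsetI)
    fix x :: real
    obtain n where "\<bar>x\<bar> < real n" using reals_Archimedean2 by blast
    then show "x \<in> (\<Union>n. {-real n..real n})" by (auto simp: abs_less_iff intro!: exI[of _ n])
  qed simp
  moreover have "emeasure ?D UNIV = \<infinity>" using assms by (simp add: emeasure_density)
  moreover have "emeasure ?D {-real n..real n} = ennreal (dual_mass (- real n) (real n))" for n
    by (simp add: emeasure_density ennreal_dual_mass)
  ultimately have "(\<lambda>n. ennreal (dual_mass (- real n) (real n))) \<longlonglongrightarrow> \<infinity>" by simp
  then show ?thesis by (simp add: ennreal_tendsto_top_eq_at_top)
qed

text \<open>
  The energy of \<open>u\<close> on the interval from \<open>- n\<close> to \<open>n\<close> is at most a multiple of the \<open>p\<close>-th power of
  the given sequence, and it increases with \<open>n\<close>. Hence it vanishes for every \<open>n\<close>.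
\<close>

lemma quasiminimizer_constant_of_slow_growth:
  assumes u: "primitive u f" and fin: "\<And>a b. energy f {a..b} < \<infinity>"
    and qm: "quasiminimizer p M Q (\<lambda>x. ereal (u x))" and Q: "1 \<le> Q"
    and slow: "(\<lambda>n::nat. \<bar>u (real n) - u (- real n)\<bar> * dual_mass (- real n) (real n) powr (1 / p - 1)) \<longlonglongrightarrow> 0"
  shows "u constant_on UNIV"
proof -
  note [measurable] = primitive_measurable[OF u]
  define D where "D n = \<bar>u (real n) - u (- real n)\<bar> * dual_mass (- real n) (real n) powr (1 / p - 1)" for n :: nat
  \<comment> \<open>\<open>D n powr p\<close> is the bound of \<open>quasiminimizer_energy_le\<close> on the interval from \<open>- n\<close> to \<open>n\<close>.\<close>
  have le: "energy f {- real n..real n} \<le> ennreal (Q * D n powr p)" if n: "0 < n" for n :: nat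
  proof -
    let ?S = "dual_mass (- real n) (real n)" and ?d = "u (real n) - u (- real n)"
    have S: "0 < ?S" using n by (intro dual_mass_pos) simp
    have "\<bar>?d / ?S\<bar> powr p * ?S = \<bar>?d\<bar> powr p * (?S powr (- p) * ?S)"
      using S by (simp add: abs_divide powr_divide powr_minus field_simps)
    also have "?S powr (- p) * ?S = ?S powr (1 - p)"
      using S by (simp add: powr_diff powr_minus field_simps)
    also have "1 - p = (1 / p - 1) * p" using p by (simp add: field_simps)
    also have "?S powr \<dots> = (?S powr (1 / p - 1)) powr p" by (simp add: powr_powr)
    also have "\<bar>?d\<bar> powr p * \<dots> = D n powr p" by (simp add: D_def powr_mult)
    finally have "\<bar>?d / ?S\<bar> powr p * ?S = D n powr p" .
    then show ?thesis using quasiminimizer_energy_le[OF u fin qm Q, of "- real n" "real n"] n by simp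
  qed
  have "(\<lambda>n. ennreal (Q * D n powr p)) \<longlonglongrightarrow> ennreal (Q * 0 powr p)"
    using slow p_pos unfolding D_def[symmetric]
    by (intro tendsto_ennrealI tendsto_mult tendsto_const tendsto_powr') (auto simp: D_def)
  then have lim: "(\<lambda>n. ennreal (Q * D n powr p)) \<longlonglongrightarrow> 0" using p_pos by simp
  have energy0: "energy f {- real m..real m} = 0" for m
  proof -
    have "\<exists>N. \<forall>n\<ge>N. energy f {- real m..real m} \<le> ennreal (Q * D n powr p)"
    proof (intro exI allI impI)
      fix n assume n: "Suc m \<le> n"
      have "energy f {- real m..real m} \<le> energy f {- real n..real n}"
        using n by (intro energy_mono) auto
      also have "\<dots> \<le> ennreal (Q * D n powr p)" using n by (intro le) simp
      finally show "energy f {- real m..real m} \<le> ennreal (Q * D n powr p)" .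
    qed
    then have "energy f {- real m..real m} \<le> 0" by (rule LIMSEQ_le_const[OF lim])
    then show ?thesis by simp
  qed
  have "u b - u a = 0" if ab: "a \<le> b" for a b
  proof -
    obtain m :: nat where m: "max \<bar>a\<bar> \<bar>b\<bar> < real m" using reals_Archimedean2 by blast
    have "AE x in lborel. ennreal (\<bar>f x\<bar> powr p * w x) * indicator {- real m..real m} x = 0"
      using energy0[of m] unfolding energy_def by (subst (asm) nn_integral_0_iff_AE) auto
    then have "AE x in lborel. indicator {a..b} x *\<^sub>R f x = 0"
    proof eventually_elim
      case (elim x)
      show ?case
      proof (cases "x \<in> {a..b}")
        case True
        then have "x \<in> {- real m..real m}" using m by auto
        then have "\<bar>f x\<bar> powr p * w x \<le> 0" using elim by (simp add: ennreal_eq_0_iff)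
        then have "\<bar>f x\<bar> powr p \<le> 0" using w_pos[of x] by (simp add: mult_le_0_iff not_less)
        then show ?thesis by (auto simp: powr_def split: if_splits)
      qed simp
    qed
    then have "(LINT x|lborel. indicator {a..b} x *\<^sub>R f x) = (LINT x::real|lborel. 0)"
      by (intro integral_cong_AE) auto
    then show ?thesis using u ab by (simp add: primitive_def set_lebesgue_integral_def)
  qed
  then have "u x = u 0" for x
    by (cases "0 \<le> x") (metis eq_iff_diff_eq_0, metis eq_iff_diff_eq_0 linear)
  then show ?thesis by (auto simp: constant_on_def)
qed

lemma dual_mass_powr_tendsto_0:
  assumes "(\<integral>\<^sup>+x. ennreal (dual x) \<partial>lborel) = \<infinity>"
  shows "(\<lambda>n::nat. C * dual_mass (- real n) (real n) powr (1 / p - 1)) \<longlonglongrightarrow> 0"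
proof -
  have "(\<lambda>n::nat. dual_mass (- real n) (real n) powr (1 / p - 1)) \<longlonglongrightarrow> 0"
    using p dual_mass_at_top[OF assms] by (intro tendsto_neg_powr) (simp_all add: field_simps)
  then show ?thesis by (rule tendsto_mult_right_zero)
qed

text \<open>
  The increments stay bounded while the mass of \<open>dual\<close> tends to infinity.
\<close>

lemma bounded_slow_growth:
  assumes D: "(\<integral>\<^sup>+x. ennreal (dual x) \<partial>lborel) = \<infinity>" and b: "bounded (range u)"
  shows "(\<lambda>n::nat. \<bar>u (real n) - u (- real n)\<bar> * dual_mass (- real n) (real n) powr (1 / p - 1)) \<longlonglongrightarrow> 0"
proof -
  obtain K where K: "\<bar>u x\<bar> \<le> K" for x using b by (auto simp: bounded_iff)
  show ?thesis
  proof (rule Lim_null_comparison)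
    show "\<forall>\<^sub>F n in sequentially. norm (\<bar>u (real n) - u (- real n)\<bar> * dual_mass (- real n) (real n) powr (1 / p - 1))
        \<le> (2 * K) * dual_mass (- real n) (real n) powr (1 / p - 1)"
    proof (intro always_eventually allI)
      fix n :: nat
      have "\<bar>u (real n) - u (- real n)\<bar> \<le> 2 * K" using K[of "real n"] K[of "- real n"] by linarith
      then show "norm (\<bar>u (real n) - u (- real n)\<bar> * dual_mass (- real n) (real n) powr (1 / p - 1))
        \<le> (2 * K) * dual_mass (- real n) (real n) powr (1 / p - 1)"
        by (simp add: abs_mult mult_right_mono)
    qed
  qed (rule dual_mass_powr_tendsto_0[OF D])
qed

text \<open>
  By Young's inequality the increment of \<open>u\<close> over an interval is at most twice the \<open>p\<close>-th root of its
  energy there, times \<open>dual_mass powr (1 - 1 / p)\<close>. Outside a large interval the energy is small, and the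
  fixed increment over that interval is negligible compared with the growing mass.
\<close>

lemma finite_energy_slow_growth:
  assumes D: "(\<integral>\<^sup>+x. ennreal (dual x) \<partial>lborel) = \<infinity>"
    and u: "primitive u f" and fin: "energy f UNIV < \<infinity>"
  shows "(\<lambda>n::nat. \<bar>u (real n) - u (- real n)\<bar> * dual_mass (- real n) (real n) powr (1 / p - 1)) \<longlonglongrightarrow> 0"
proof (rule LIMSEQ_I)
  note [measurable] = primitive_measurable[OF u]
  fix \<delta> :: real assume \<delta>: "0 < \<delta>"
  \<comment> \<open>Each of the two tails will contribute \<open>2 * \<epsilon> powr (1 / p) = \<delta> / 4\<close>.\<close>
  define \<epsilon> where "\<epsilon> = (\<delta> / 8) powr p"
  have \<epsilon>: "0 < \<epsilon>" "\<epsilon> powr (1 / p) = \<delta> / 8" using \<delta> p_pos by (auto simp: \<epsilon>_def powr_powr)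
  let ?E = "density lborel (\<lambda>x. ennreal (\<bar>f x\<bar> powr p * w x))"
  let ?T = "\<lambda>n::nat. - {- real n<..<real n}"
  have eE: "emeasure ?E T = energy f T" if "T \<in> sets borel" for T
    using that by (simp add: emeasure_density energy_def)
  have "(\<lambda>n. emeasure ?E (?T n)) \<longlonglongrightarrow> emeasure ?E (\<Inter>n. ?T n)"
  proof (rule Lim_emeasure_decseq)
    show "emeasure ?E (?T n) \<noteq> \<infinity>" for n
      using energy_mono[of "?T n" UNIV f] fin by (auto simp: eE)
  qed (auto simp: decseq_def)
  moreover have "(\<Inter>n. ?T n) = {}"
  proof -
    have "x \<notin> (\<Inter>n. ?T n)" for x
    proof -
      obtain n where "\<bar>x\<bar> < real n" using reals_Archimedean2 by blast
      then show ?thesis by (auto simp: abs_less_iff intro!: exI[of _ n])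
    qed
    then show ?thesis by blast
  qed
  ultimately have "(\<lambda>n. energy f (?T n)) \<longlonglongrightarrow> 0" by (simp add: eE)
  then have "\<forall>\<^sub>F n in sequentially. energy f (?T n) < ennreal \<epsilon>"
    using \<epsilon> by (intro order_tendstoD) auto
  then obtain c where c: "energy f (?T c) \<le> ennreal \<epsilon>"
    by (meson eventually_sequentially less_imp_le order_refl)
  define A where "A = \<bar>u (real c) - u (- real c)\<bar>"
  let ?S = "\<lambda>n::nat. dual_mass (- real n) (real n)"
  have part: "\<bar>u b - u a\<bar> \<le> 2 * (\<epsilon> powr (1 / p) * ?S n powr (1 - 1 / p))"
    if ab: "a \<le> b" "{a..b} \<subseteq> ?T c" "{a..b} \<subseteq> {- real n..real n}" "0 < n" for a b and n :: nat
  proof -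
    have S: "0 < ?S n" using that(4) by (intro dual_mass_pos) simp
    \<comment> \<open>This \<open>t\<close> makes the two summands of Young's inequality equal.\<close>
    define t where "t = (\<epsilon> / ?S n) powr (1 / p)"
    have t: "0 < t" using S \<epsilon> by (simp add: t_def)
    have t': "t = \<epsilon> powr (1 / p) * ?S n powr (- (1 / p))"
      using S \<epsilon> by (simp add: t_def powr_divide powr_minus field_simps)
    have t1: "t * ?S n = \<epsilon> powr (1 / p) * ?S n powr (1 - 1 / p)"
      using S unfolding t' by (simp add: powr_diff powr_minus field_simps)
    have t2: "t powr (1 - p) * \<epsilon> = \<epsilon> powr (1 / p) * ?S n powr (1 - 1 / p)"
    proof -
      have "t powr (1 - p) = (\<epsilon> powr (1 / p)) powr (1 - p) * (?S n powr (- (1 / p))) powr (1 - p)"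
        unfolding t' by (simp add: powr_mult)
      also have "\<dots> = \<epsilon> powr (1 / p - 1) * ?S n powr (1 - 1 / p)"
      proof -
        have "1 / p * (1 - p) = 1 / p - 1" "- (1 / p) * (1 - p) = 1 - 1 / p"
          using p by (simp_all add: field_simps)
        then show ?thesis by (simp only: powr_powr)
      qed
      also have "\<epsilon> powr (1 / p - 1) = \<epsilon> powr (1 / p) / \<epsilon>"
        using \<epsilon> by (simp add: powr_diff)
      finally show ?thesis using \<epsilon> by simp
    qed
    have "ennreal \<bar>u b - u a\<bar> \<le> (\<integral>\<^sup>+x\<in>{a..b}. ennreal \<bar>f x\<bar> \<partial>lborel)"
      using primitive_diff_le[OF u, of b a] ab(1) by (simp add: min_def max_def split: if_splits)
    also have "\<dots> \<le> ennreal t * (\<integral>\<^sup>+x\<in>{a..b}. ennreal (dual x) \<partial>lborel) + ennreal (t powr (1 - p)) * energy f {a..b}"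
      by (intro nn_integral_le_dual_energy t) auto
    also have "\<dots> \<le> ennreal t * ennreal (?S n) + ennreal (t powr (1 - p)) * ennreal \<epsilon>"
    proof (intro add_mono mult_left_mono)
      show "(\<integral>\<^sup>+x\<in>{a..b}. ennreal (dual x) \<partial>lborel) \<le> ennreal (?S n)"
        unfolding ennreal_dual_mass
      proof (rule nn_integral_mono)
        fix x
        show "ennreal (dual x) * indicator {a..b} x \<le> ennreal (dual x) * indicator {- real n..real n} x"
          using ab(3) by (cases "x \<in> {a..b}") auto
      qed
      show "energy f {a..b} \<le> ennreal \<epsilon>" using energy_mono[OF ab(2), of f] c by (rule order_trans)
    qed auto
    also have "\<dots> = ennreal (t * ?S n + t powr (1 - p) * \<epsilon>)"
      using t S \<epsilon> by (simp add: ennreal_mult)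
    also have "t * ?S n + t powr (1 - p) * \<epsilon> = 2 * (\<epsilon> powr (1 / p) * ?S n powr (1 - 1 / p))"
      unfolding t1 t2 by simp
    finally show ?thesis by (subst (asm) ennreal_le_iff) simp_all
  qed
  have "\<forall>\<^sub>F n in sequentially. A * ?S n powr (1 / p - 1) < \<delta> / 2"
    using dual_mass_powr_tendsto_0[OF D, of A] \<delta> by (intro order_tendstoD) auto
  then obtain N where N: "\<And>n. N \<le> n \<Longrightarrow> A * ?S n powr (1 / p - 1) < \<delta> / 2"
    by (auto simp: eventually_sequentially)
  show "\<exists>N. \<forall>n\<ge>N. norm (\<bar>u (real n) - u (- real n)\<bar> * ?S n powr (1 / p - 1) - 0) < \<delta>"
  proof (intro exI allI impI)
    fix n assume n: "max N (Suc c) \<le> n"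
    have S: "0 < ?S n" using n by (intro dual_mass_pos) simp
    have 1: "\<bar>u (real n) - u (real c)\<bar> \<le> 2 * (\<epsilon> powr (1 / p) * ?S n powr (1 - 1 / p))"
      using n by (intro part) auto
    have 2: "\<bar>u (- real c) - u (- real n)\<bar> \<le> 2 * (\<epsilon> powr (1 / p) * ?S n powr (1 - 1 / p))"
      using n by (intro part) auto
    have "\<bar>u (real n) - u (- real n)\<bar> \<le> A + 4 * (\<epsilon> powr (1 / p) * ?S n powr (1 - 1 / p))"
      using 1 2 unfolding A_def by linarith
    then have "\<bar>u (real n) - u (- real n)\<bar> * ?S n powr (1 / p - 1)
        \<le> (A + 4 * (\<epsilon> powr (1 / p) * ?S n powr (1 - 1 / p))) * ?S n powr (1 / p - 1)"
      by (intro mult_right_mono) auto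
    also have "\<dots> = A * ?S n powr (1 / p - 1) + 4 * \<epsilon> powr (1 / p) * (?S n powr (1 - 1 / p) * ?S n powr (1 / p - 1))"
      by (simp add: algebra_simps)
    also have "?S n powr (1 - 1 / p) * ?S n powr (1 / p - 1) = 1"
      using S by (simp add: powr_add[symmetric])
    also have "A * ?S n powr (1 / p - 1) + 4 * \<epsilon> powr (1 / p) * 1 < \<delta>"
      using N[of n] n unfolding \<epsilon>(2) by simp
    finally show "norm (\<bar>u (real n) - u (- real n)\<bar> * ?S n powr (1 / p - 1) - 0) < \<delta>"
      by (simp add: abs_mult)
  qed
qed

lemma quasiharmonic_constant:
  assumes D: "(\<integral>\<^sup>+x. ennreal (dual x) \<partial>lborel) = \<infinity>"
    and u: "quasiharmonic p M u" and "bounded (range u) \<or> finite_energy p M u"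
  shows "u constant_on UNIV"
proof -
  obtain Q where Q: "1 \<le> Q" and qm: "quasiminimizer p M Q (\<lambda>x. ereal (u x))"
    using u unfolding quasiharmonic_def by blast
  obtain f where f: "primitive u f" and fin: "\<forall>a b. energy f {a..b} < \<infinity>"
    using primitive_of_locally_N1p[of u] qm unfolding quasiminimizer_def by blast
  have "(\<lambda>n::nat. \<bar>u (real n) - u (- real n)\<bar> * dual_mass (- real n) (real n) powr (1 / p - 1)) \<longlonglongrightarrow> 0"
    using assms(3)
  proof
    assume "bounded (range u)"
    then show ?thesis by (rule bounded_slow_growth[OF D])
  next
    assume "finite_energy p M u"
    then have "energy f UNIV < \<infinity>"
      using nn_integral_min_wug[OF f, of UNIV] fin by (simp add: finite_energy_def)
    then show ?thesis by (rule finite_energy_slow_growth[OF D f])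
  qed
  then show ?thesis using fin by (intro quasiminimizer_constant_of_slow_growth[OF f _ qm Q]) auto
qed

lemma weight_integral:
  assumes "(\<integral>\<^sup>+x. ennreal (dual x) \<partial>lborel) < \<infinity>"
  shows "weight w \<and> has_weight M w \<and> (\<integral>\<^sup>+x. epow (ennreal (w x)) (1 / (1 - p)) \<partial>lebesgue) < \<infinity>"
proof (intro conjI)
  have "set_integrable lebesgue {a..b} w" for a b
  proof -
    have i: "integrable lborel (\<lambda>x. indicator {a..b} x *\<^sub>R w x)"
      using w_loc by (simp add: locally_integrable_def set_integrable_def)
    then show ?thesis
      unfolding set_integrable_def by (subst integrable_completion) auto
  qed
  then show "weight w" using w_pos by (simp add: weight_def less_imp_le)
  show "has_weight M w"
    unfolding has_weight_def
  proof
    fix A :: "real set" assume A: "A \<in> sets borel"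
    then have "emeasure M A = emeasure (density lborel (\<lambda>x. ennreal (w x))) A" by (simp add: M)
    then show "emeasure M A = (\<integral>\<^sup>+x\<in>A. ennreal (w x) \<partial>lebesgue)"
      using A by (simp add: emeasure_density nn_integral_completion)
  qed
  have "epow (ennreal (w x)) (1 / (1 - p)) = ennreal (dual x)" for x
    using w_pos[of x] by (simp add: epow_ennreal dual_def)
  then show "(\<integral>\<^sup>+x. epow (ennreal (w x)) (1 / (1 - p)) \<partial>lebesgue) < \<infinity>"
    using assms by (simp add: nn_integral_completion)
qed

end

section \<open>The weight of a measure that supports a Poincare inequality\<close>

lemma weighted_lineI:
  assumes p: "1 < p" and cb: "complete_borel_measure \<mu>"
    and w[measurable]: "w \<in> borel_measurable borel" and pos: "\<And>x. 0 < w x"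
    and dens: "\<And>A. A \<in> sets borel \<Longrightarrow> emeasure \<mu> A = (\<integral>\<^sup>+x\<in>A. ennreal (w x) \<partial>lborel)"
    and fin: "\<And>a b. (\<integral>\<^sup>+x\<in>{a..b}. ennreal (w x) \<partial>lborel) < \<infinity>"
    and dual: "\<And>a b. (\<integral>\<^sup>+x\<in>{a..b}. ennreal (w x powr (1 / (1 - p))) \<partial>lborel) < \<infinity>"
  shows "weighted_line p \<mu> w"
proof
  obtain N where N: "sets N = sets borel" "\<mu> = completion N"
    using cb by (auto simp: complete_borel_measure_def)
  have "N = density lborel (\<lambda>x. ennreal (w x))"
  proof (rule measure_eqI)
    fix A assume A: "A \<in> sets N"
    then have "emeasure N A = emeasure \<mu> A" by (simp add: N(2))
    also have "\<dots> = (\<integral>\<^sup>+x\<in>A. ennreal (w x) \<partial>lborel)" using A by (intro dens) (simp add: N(1))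
    also have "\<dots> = emeasure (density lborel (\<lambda>x. ennreal (w x))) A"
      using A by (subst emeasure_density) (simp_all add: N(1))
    finally show "emeasure N A = emeasure (density lborel (\<lambda>x. ennreal (w x))) A" .
  qed (simp add: N)
  then show "\<mu> = completion (density lborel (\<lambda>x. ennreal (w x)))" by (simp add: N)
  show "locally_integrable w"
    unfolding locally_integrable_iff using fin pos by (simp add: abs_of_nonneg less_imp_le)
  show "locally_integrable (\<lambda>x. w x powr (1 / (1 - p)))"
    unfolding locally_integrable_iff using dual by simp
qed (use p pos in auto)

text \<open>
  If \<open>w powr (1 / (1 - p))\<close> is integrable, then \<open>w\<close> vanishes only on a null set, since
  \<open>epow 0 a = \<infinity>\<close> for \<open>a < 0\<close>.
\<close>

lemma weighted_line_of_weight: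
  assumes p: "1 < p" and cb: "complete_borel_measure \<mu>" and wt: "weight w" "has_weight \<mu> w"
    and fin: "(\<integral>\<^sup>+x. epow (ennreal (w x)) (1 / (1 - p)) \<partial>lebesgue) < \<infinity>"
  shows "\<exists>w'. weighted_line p \<mu> w' \<and> (\<integral>\<^sup>+x. ennreal (w' x powr (1 / (1 - p))) \<partial>lborel) < \<infinity>"
proof -
  have w0: "0 \<le> w x" for x using wt by (simp add: weight_def)
  have q: "1 / (1 - p) < 0" using p by simp
  have int: "integrable lebesgue (\<lambda>x. indicator {a..b} x *\<^sub>R w x)" for a b
    using wt by (simp add: weight_def set_integrable_def)
  have w_meas: "w \<in> borel_measurable lebesgue"
  proof (rule borel_measurable_LIMSEQ_real)
    show "(\<lambda>x. indicator {- real n..real n} x *\<^sub>R w x) \<in> borel_measurable lebesgue" for n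
      by (rule borel_measurable_integrable[OF int])
    fix x :: real
    obtain N :: nat where N: "\<bar>x\<bar> < real N" using reals_Archimedean2 by blast
    have "\<forall>\<^sub>F n in sequentially. indicator {- real n..real n} x *\<^sub>R w x = w x"
      using eventually_ge_at_top[of N]
      by eventually_elim (use N in \<open>auto simp: indicator_def abs_less_iff\<close>)
    then show "(\<lambda>n. indicator {- real n..real n} x *\<^sub>R w x) \<longlonglongrightarrow> w x" by (rule tendsto_eventually)
  qed
  then obtain w1 where w1[measurable]: "w1 \<in> borel_measurable lborel" and w1_ae: "AE x in lborel. w x = w1 x"
    using completion_ex_borel_measurable_real by blast
  have "AE x in lebesgue. epow (ennreal (w x)) (1 / (1 - p)) \<noteq> \<infinity>"
    using fin w_meas by (intro nn_integral_PInf_AE) auto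
  then have "AE x in lborel. epow (ennreal (w x)) (1 / (1 - p)) \<noteq> \<infinity>" by (simp only: AE_completion_iff)
  then have w_pos: "AE x in lborel. 0 < w x"
  proof eventually_elim
    case (elim x)
    then have "w x \<noteq> 0" using q by (auto simp: epow_def)
    then show ?case using w0[of x] by simp
  qed
  \<comment> \<open>A Borel version of \<open>w\<close> that is positive everywhere; the value 1 is only taken on a null set.\<close>
  define w' where "w' x = (if 0 < w1 x then w1 x else 1)" for x
  have w'_pos: "0 < w' x" for x by (simp add: w'_def)
  have w'[measurable]: "w' \<in> borel_measurable borel" unfolding w'_def using w1 by measurable
  have ae: "AE x in lborel. w x = w' x \<and> 0 < w x"
    using w_pos w1_ae by eventually_elim (simp add: w'_def)
  have wint: "(\<integral>\<^sup>+x\<in>A. ennreal (w x) \<partial>lebesgue) = (\<integral>\<^sup>+x\<in>A. ennreal (w' x) \<partial>lborel)" for A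
    unfolding nn_integral_completion
    by (intro nn_integral_cong_AE) (use ae in \<open>eventually_elim, simp\<close>)
  have dint: "(\<integral>\<^sup>+x. epow (ennreal (w x)) (1 / (1 - p)) \<partial>lebesgue) = (\<integral>\<^sup>+x. ennreal (w' x powr (1 / (1 - p))) \<partial>lborel)"
    unfolding nn_integral_completion
  proof (intro nn_integral_cong_AE)
    show "AE x in lborel. epow (ennreal (w x)) (1 / (1 - p)) = ennreal (w' x powr (1 / (1 - p)))"
      using ae by eventually_elim (simp add: epow_ennreal)
  qed
  have "weighted_line p \<mu> w'"
  proof (rule weighted_lineI[OF p cb w' w'_pos])
    show "emeasure \<mu> A = (\<integral>\<^sup>+x\<in>A. ennreal (w' x) \<partial>lborel)" if "A \<in> sets borel" for A
      using wt(2) that by (simp add: has_weight_def wint)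
    show "(\<integral>\<^sup>+x\<in>{a..b}. ennreal (w' x) \<partial>lborel) < \<infinity>" for a b
    proof -
      have "(\<integral>\<^sup>+x\<in>{a..b}. ennreal (w x) \<partial>lebesgue) = (\<integral>\<^sup>+x. ennreal (norm (indicator {a..b} x *\<^sub>R w x)) \<partial>lebesgue)"
        using w0 by (intro nn_integral_cong) (auto simp: indicator_def)
      also have "\<dots> < \<infinity>" using int[of a b] by (simp add: integrable_iff_bounded)
      finally show ?thesis by (simp add: wint)
    qed
    show "(\<integral>\<^sup>+x\<in>{a..b}. ennreal (w' x powr (1 / (1 - p))) \<partial>lborel) < \<infinity>" for a b
    proof -
      have "(\<integral>\<^sup>+x\<in>{a..b}. ennreal (w' x powr (1 / (1 - p))) \<partial>lborel) \<le> (\<integral>\<^sup>+x. ennreal (w' x powr (1 / (1 - p))) \<partial>lborel)"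
        by (intro nn_integral_mono) (auto simp: indicator_def)
      then show ?thesis using fin dint by simp
    qed
  qed
  then show ?thesis using fin dint by auto
qed

text \<open>
  Here \<open>N\<close> is the Borel measure whose completion is \<open>\<mu>\<close>.
\<close>

locale doubling_poincare_line =
  fixes p :: real and \<mu> N :: "real measure"
  assumes p: "1 < p" and sets_N: "sets N = sets borel" and \<mu>: "\<mu> = completion N"
    and pos_fin: "positive_finite_on_balls \<mu>"
    and doubling: "locally_doubling \<mu>"
    and poincare: "local_poincare p \<mu>"
begin

lemma p_pos: "0 < p" using p by simp

lemma ball_sets_N [measurable, simp]: "ball x r \<in> sets N"
  by (simp add: sets_N)

lemma emeasure_\<mu>: "A \<in> sets borel \<Longrightarrow> emeasure \<mu> A = emeasure N A"
  by (simp add: \<mu> sets_N)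

lemma space_N: "space N = UNIV"
  using sets_eq_imp_space_eq[OF sets_N] by simp

lemma space_\<mu>: "space \<mu> = UNIV" by (simp add: \<mu> space_N)

lemma borel_sets_\<mu>: "sets borel \<subseteq> sets \<mu>"
  by (auto simp: \<mu> sets_N)

lemma ball_pos: "0 < r \<Longrightarrow> 0 < emeasure N (ball x r)"
  using pos_fin[unfolded positive_finite_on_balls_def, THEN spec, THEN spec, of r x]
  by (simp add: emeasure_\<mu>)

lemma ball_finite: "emeasure N (ball x r) < \<infinity>"
  using pos_fin[unfolded positive_finite_on_balls_def, THEN spec, THEN spec, of r x]
  by (cases "0 < r") (auto simp: emeasure_\<mu> ball_empty not_less)

lemma ball_measure:
  assumes "0 < r"
  shows "emeasure N (ball x r) = ennreal (measure N (ball x r))" "0 < measure N (ball x r)"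
proof -
  show 1: "emeasure N (ball x r) = ennreal (measure N (ball x r))"
    using ball_finite[of x r] by (intro emeasure_eq_ennreal_measure) (simp add: less_top)
  show "0 < measure N (ball x r)" using ball_pos[OF assms, of x] unfolding 1 by simp
qed

lemma bounded_finite:
  assumes "A \<subseteq> ball x r" shows "emeasure N A < \<infinity>"
  using emeasure_mono[OF assms, of N] ball_finite[of x r] by (auto simp: sets_N intro: le_less_trans)

text \<open>
  Let \<open>u\<close> be 0 on the left third of a ball and \<open>T\<close> on the right third. By doubling both thirds have a
  fixed share of the measure, and no constant \<open>b\<close> is close to both 0 and \<open>T\<close>.
\<close>

lemma oscillation_of_step:
  assumes doub: "\<forall>x r. 0 < r \<and> ball x r \<subseteq> ball x0 R \<longrightarrow>
      emeasure \<mu> (ball x (2 * r)) \<le> ennreal CD * emeasure \<mu> (ball x r)"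
    and CD: "0 < CD" and h: "0 < h" and sub: "ball c (6 * h) \<subseteq> ball x0 R"
    and left: "\<And>x. x \<le> c - h \<Longrightarrow> u x = 0" and right: "\<And>x. c + h \<le> x \<Longrightarrow> u x = T"
  shows "ennreal (T * measure N (ball c (3 * h)))
    \<le> ennreal (CD ^ 3) * (\<integral>\<^sup>+y\<in>ball c (3 * h). ennreal \<bar>u y - b\<bar> \<partial>N)"
proof -
  let ?B = "ball c (3 * h)"
  define m where "m = measure N ?B"
  have m: "emeasure N ?B = ennreal m" "0 < m"
    using ball_measure[of "3 * h" c] h by (simp_all add: m_def)
  \<comment> \<open>Three doublings take a ball of radius \<open>h\<close> at distance \<open>2 * h\<close> from \<open>c\<close> to one that contains \<open>?B\<close>.\<close>
  have side: "ennreal m \<le> ennreal (CD ^ 3) * emeasure N (ball y h)" if y: "\<bar>y - c\<bar> = 2 * h" for y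
  proof -
    have s: "ball y r \<subseteq> ball x0 R" if "r \<le> 4 * h" for r
    proof -
      have "ball y r \<subseteq> ball c (6 * h)" using that y by (auto simp: dist_real_def)
      then show ?thesis using sub by blast
    qed
    have d: "emeasure N (ball y (2 * r)) \<le> ennreal CD * emeasure N (ball y r)" if "0 < r" "r \<le> 4 * h" for r
      using doub[THEN spec, THEN spec, THEN mp, OF conjI[OF that(1) s[OF that(2)]]] by (simp add: emeasure_\<mu>)
    have "ennreal m \<le> emeasure N (ball y (2 * (4 * h)))"
      unfolding m(1)[symmetric] using y h by (intro emeasure_mono) (auto simp: sets_N dist_real_def)
    also have "\<dots> \<le> ennreal CD * emeasure N (ball y (2 * (2 * h)))" using d[of "4 * h"] h by simp
    also have "\<dots> \<le> ennreal CD * (ennreal CD * emeasure N (ball y (2 * h)))"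
      using d[of "2 * h"] h by (intro mult_left_mono) auto
    also have "\<dots> \<le> ennreal CD * (ennreal CD * (ennreal CD * emeasure N (ball y h)))"
      using d[of h] h by (intro mult_left_mono) auto
    also have "\<dots> = ennreal (CD ^ 3) * emeasure N (ball y h)"
      using CD by (simp add: power3_eq_cube ennreal_mult mult.assoc)
    finally show ?thesis .
  qed
  let ?B1 = "ball (c - 2 * h) h" and ?B2 = "ball (c + 2 * h) h"
  have "ennreal (T * m) \<le> ennreal (\<bar>b\<bar> + \<bar>T - b\<bar>) * ennreal m"
    using m by (subst ennreal_mult[symmetric]) (auto intro!: ennreal_leI mult_right_mono)
  also have "\<dots> = ennreal \<bar>b\<bar> * ennreal m + ennreal \<bar>T - b\<bar> * ennreal m"
    by (simp add: distrib_right)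
  also have "\<dots> \<le> ennreal \<bar>b\<bar> * (ennreal (CD ^ 3) * emeasure N ?B1) + ennreal \<bar>T - b\<bar> * (ennreal (CD ^ 3) * emeasure N ?B2)"
    using h by (intro add_mono mult_left_mono side) auto
  also have "\<dots> = ennreal (CD ^ 3) * (ennreal \<bar>b\<bar> * emeasure N ?B1 + ennreal \<bar>T - b\<bar> * emeasure N ?B2)"
    by (simp add: distrib_left mult_ac)
  also have "ennreal \<bar>b\<bar> * emeasure N ?B1 + ennreal \<bar>T - b\<bar> * emeasure N ?B2
      = (\<integral>\<^sup>+y. ennreal \<bar>b\<bar> * indicator ?B1 y + ennreal \<bar>T - b\<bar> * indicator ?B2 y \<partial>N)"
    by (subst nn_integral_add) (simp_all add: nn_integral_cmult_indicator)
  also have "\<dots> \<le> (\<integral>\<^sup>+y\<in>?B. ennreal \<bar>u y - b\<bar> \<partial>N)"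
  proof (rule nn_integral_mono)
    fix y
    show "ennreal \<bar>b\<bar> * indicator ?B1 y + ennreal \<bar>T - b\<bar> * indicator ?B2 y \<le> ennreal \<bar>u y - b\<bar> * indicator ?B y"
    proof (cases "y \<in> ?B1")
      case True
      then have "u y = 0" "y \<notin> ?B2" "y \<in> ?B" using h by (auto simp: dist_real_def intro!: left)
      then show ?thesis using True by simp
    next
      case False
      show ?thesis
      proof (cases "y \<in> ?B2")
        case True
        then have "u y = T" "y \<in> ?B" using h by (auto simp: dist_real_def intro!: right)
        then show ?thesis using True False by simp
      qed (use False in simp)
    qed
  qed
  finally show ?thesis by (simp add: m_def mult_left_mono)
qed

text \<open>
  The number \<open>j\<close> stands for the integral of \<open>\<rho> powr p\<close>, so that the estimate is one between real numbers.
\<close>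

definition bumps_controlled :: "real \<Rightarrow> real \<Rightarrow> real \<Rightarrow> bool" where
  "bumps_controlled x0 R K \<longleftrightarrow> (\<forall>c h \<rho> j. 0 < h \<and> ball c (6 * h) \<subseteq> ball x0 R \<and> locally_integrable \<rho> \<and>
     (\<forall>x. 0 \<le> \<rho> x) \<and> (\<forall>x. x \<notin> ball c h \<longrightarrow> \<rho> x = 0) \<and> 0 \<le> j \<and>
     (\<integral>\<^sup>+x. ennreal (\<rho> x powr p) \<partial>N) \<le> ennreal j \<longrightarrow>
     (LINT x:{c - h..c + h}|lborel. \<rho> x) powr p * measure N (ball c h) \<le> K * h powr p * j)"

text \<open>
  All regularity of the measure rests on this consequence of doubling and the Poincare inequality.
  It is obtained by testing the inequality on \<open>ball c (3 * h)\<close> with a primitive \<open>u\<close> of \<open>\<rho>\<close>. By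
  \<open>oscillation_of_step\<close> the mean oscillation of \<open>u\<close> is at least a multiple of the integral of \<open>\<rho>\<close>.
  With the dual weight as \<open>\<rho>\<close> the estimate becomes the local Muckenhoupt condition.
\<close>

lemma bump_estimate:
  "\<exists>R>0. \<exists>K>0. bumps_controlled x0 R K"
proof -
  obtain r0 CP L where r0: "0 < r0" and CP: "0 < CP" and L: "1 \<le> L"
    and poin: "\<forall>x r. 0 < r \<and> ball x r \<subseteq> ball x0 r0 \<longrightarrow>
        (\<forall>u g. u \<in> borel_measurable (restrict_space \<mu> (ball x (L * r))) \<and>
               (\<integral>\<^sup>+y\<in>ball x (L * r). e2ennreal \<bar>u y\<bar> \<partial>\<mu>) < \<infinity> \<and>
               weak_upper_gradient p \<mu> (ball x (L * r)) u g \<longrightarrow>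
           (let uB = (LINT y:ball x r|\<mu>. real_of_ereal (u y)) / measure \<mu> (ball x r) in
            (\<integral>\<^sup>+y\<in>ball x r. e2ennreal \<bar>u y - ereal uB\<bar> \<partial>\<mu>) / emeasure \<mu> (ball x r)
              \<le> ennreal (CP * r) *
                epow ((\<integral>\<^sup>+y\<in>ball x (L * r). epow (g y) p \<partial>\<mu>) / emeasure \<mu> (ball x (L * r)))
                     (1 / p)))"
    using poincare[unfolded local_poincare_def, THEN spec, of x0] by (elim exE conjE)
  obtain r1 CD where r1: "0 < r1" and CD: "0 < CD"
    and doub: "\<forall>x r. 0 < r \<and> ball x r \<subseteq> ball x0 r1 \<longrightarrow>
      emeasure \<mu> (ball x (2 * r)) \<le> ennreal CD * emeasure \<mu> (ball x r)"
    using doubling[unfolded locally_doubling_def, THEN spec, of x0] by (elim exE conjE)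
  define R where "R = min r0 r1"
  define K where "K = (CD ^ 3 * (CP * 3)) powr p"
  have "T powr p * measure N (ball c h) \<le> K * h powr p * j"
    if h: "0 < h" and sub: "ball c (6 * h) \<subseteq> ball x0 R" and \<rho>: "locally_integrable \<rho>"
      and \<rho>0: "\<And>x. 0 \<le> \<rho> x" and supp: "\<And>x. x \<notin> ball c h \<Longrightarrow> \<rho> x = 0" and j: "0 \<le> j"
      and \<rho>j: "(\<integral>\<^sup>+x. ennreal (\<rho> x powr p) \<partial>N) \<le> ennreal j"
      and T: "T = (LINT x:{c - h..c + h}|lborel. \<rho> x)" for c h \<rho> j T
  proof -
    note [measurable] = locally_integrable_measurable[OF \<rho>]
    have supp': "\<rho> x = 0" if "x \<notin> {c - h<..<c + h}" for x
      using supp[of x] that by (simp add: ball_eq_greaterThanLessThan)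
    have "c - h \<le> c + h" using h by simp
    from primitive_of_bump[OF \<rho> this supp'] obtain u where u: "primitive u \<rho>"
      and u_left: "\<And>x. x \<le> c - h \<Longrightarrow> u x = 0" and u_right: "\<And>x. c + h \<le> x \<Longrightarrow> u x = T"
      unfolding T by blast
    have T_nn: "ennreal T = (\<integral>\<^sup>+x\<in>{c - h..c + h}. ennreal (\<rho> x) \<partial>lborel)"
      unfolding T by (rule set_integral_eq_nn_integral_nonneg[OF \<rho> \<rho>0])
    have T0: "0 \<le> T"
      unfolding T by (rule lborel_set_integral_nonneg) (simp add: \<rho>0)
    have u_le: "\<bar>u x\<bar> \<le> T" for x
    proof -
      have "ennreal \<bar>u x - u (c - h)\<bar> \<le> (\<integral>\<^sup>+t\<in>{min (c - h) x..max (c - h) x}. ennreal \<bar>\<rho> t\<bar> \<partial>lborel)"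
        by (rule primitive_diff_le[OF u])
      also have "\<dots> \<le> (\<integral>\<^sup>+x\<in>{c - h..c + h}. ennreal (\<rho> x) \<partial>lborel)"
      proof (rule nn_integral_mono)
        fix t
        show "ennreal \<bar>\<rho> t\<bar> * indicator {min (c - h) x..max (c - h) x} t \<le> ennreal (\<rho> t) * indicator {c - h..c + h} t"
          using supp[of t] \<rho>0[of t] by (cases "t \<in> ball c h") (auto simp: dist_real_def indicator_def)
      qed
      also have "\<dots> = ennreal T" by (rule T_nn[symmetric])
      finally have "\<bar>u x - u (c - h)\<bar> \<le> T" using T0 by (subst (asm) ennreal_le_iff) simp_all
      then show ?thesis using u_left[of "c - h"] by simp
    qed
    let ?B = "ball c (3 * h)" and ?E = "ball c (L * (3 * h))"
    have h3: "0 < 3 * h" using h by simp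
    have subB: "?B \<subseteq> ball x0 r0"
      using sub h by (force simp: R_def subset_iff)
    have meas: "(\<lambda>x. ereal (u x)) \<in> borel_measurable (restrict_space \<mu> ?E)"
    proof -
      have "(\<lambda>x. ereal (u x)) \<in> borel_measurable borel"
        by (intro borel_measurable_ereal primitive_measurable(2)[OF u])
      then show ?thesis
        using borel_sets_\<mu> by (intro measurable_restrict_space1) (auto simp: measurable_def space_\<mu>)
    qed
    have int: "(\<integral>\<^sup>+y\<in>?E. e2ennreal \<bar>ereal (u y)\<bar> \<partial>\<mu>) < \<infinity>"
    proof -
      have "(\<integral>\<^sup>+y\<in>?E. e2ennreal \<bar>ereal (u y)\<bar> \<partial>\<mu>) \<le> (\<integral>\<^sup>+y. ennreal T * indicator ?E y \<partial>\<mu>)"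
        using u_le by (intro nn_integral_mono) (auto simp: indicator_def ennreal_leI)
      also have "\<dots> = ennreal T * emeasure N ?E"
        using borel_sets_\<mu> by (subst nn_integral_cmult_indicator) (auto simp: emeasure_\<mu>)
      also have "\<dots> < \<infinity>" using ball_finite[of c "L * (3 * h)"] by (simp add: ennreal_mult_less_top)
      finally show ?thesis .
    qed
    have wug: "weak_upper_gradient p \<mu> ?E (\<lambda>x. ereal (u x)) (\<lambda>x. ennreal \<bar>\<rho> x\<bar>)"
      by (rule weak_upper_gradient_primitive[OF u p_pos borel_sets_\<mu> space_\<mu>])
    define uB where "uB = (LINT y:?B|\<mu>. real_of_ereal (ereal (u y))) / measure \<mu> ?B"
    define I where "I = (\<integral>\<^sup>+y\<in>?B. ennreal \<bar>u y - uB\<bar> \<partial>N)"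
    define m where "m = measure N ?B"
    define m0 where "m0 = measure N (ball c h)"
    have m: "emeasure N ?B = ennreal m" "0 < m"
      using ball_measure[OF h3] by (simp_all only: m_def)
    have m0: "emeasure N (ball c h) = ennreal m0" "0 < m0"
      using ball_measure[OF h] by (simp_all only: m0_def)
    define mE where "mE = measure N ?E"
    have mE: "emeasure \<mu> ?E = ennreal mE" "m0 \<le> mE"
    proof -
      have "h \<le> L * (3 * h)" using L h mult_right_mono[of 1 L "3 * h"] by simp
      moreover from this have E: "emeasure N ?E = ennreal mE" using ball_measure(1)[of "L * (3 * h)" c] h by (simp add: mE_def)
      ultimately have "emeasure N (ball c h) \<le> ennreal mE"
        by (subst E[symmetric], intro emeasure_mono) (auto simp: sets_N)
      then show "m0 \<le> mE" unfolding m0(1) by (subst (asm) ennreal_le_iff) (simp_all add: mE_def)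
      show "emeasure \<mu> ?E = ennreal mE" using E by (simp add: emeasure_\<mu>)
    qed
    have grad: "(\<integral>\<^sup>+y\<in>?E. epow (ennreal \<bar>\<rho> y\<bar>) p \<partial>\<mu>) \<le> ennreal j"
    proof -
      have "(\<integral>\<^sup>+y\<in>?E. epow (ennreal \<bar>\<rho> y\<bar>) p \<partial>\<mu>) \<le> (\<integral>\<^sup>+y. ennreal (\<rho> y powr p) \<partial>N)"
        unfolding \<mu> nn_integral_completion using p_pos \<rho>0
        by (intro nn_integral_mono) (auto simp: indicator_def epow_ennreal)
      then show ?thesis using \<rho>j by (rule order_trans)
    qed
    have "epow ((\<integral>\<^sup>+y\<in>?E. epow (ennreal \<bar>\<rho> y\<bar>) p \<partial>\<mu>) / emeasure \<mu> ?E) (1 / p)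
        \<le> epow (ennreal (j / m0)) (1 / p)"
    proof (rule epow_mono)
      have "(\<integral>\<^sup>+y\<in>?E. epow (ennreal \<bar>\<rho> y\<bar>) p \<partial>\<mu>) / emeasure \<mu> ?E \<le> ennreal j / ennreal mE"
        unfolding mE(1) using grad by (rule divide_right_mono_ennreal)
      also have "\<dots> = ennreal (j / mE)" using j m0(2) mE(2) by (intro divide_ennreal) auto
      also have "\<dots> \<le> ennreal (j / m0)"
        using j m0(2) mE(2) by (intro ennreal_leI divide_left_mono mult_pos_pos) auto
      finally show "(\<integral>\<^sup>+y\<in>?E. epow (ennreal \<bar>\<rho> y\<bar>) p \<partial>\<mu>) / emeasure \<mu> ?E \<le> ennreal (j / m0)" .
    qed (use p_pos in simp)
    also have "\<dots> = ennreal ((j / m0) powr (1 / p))"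
      using j m0 p_pos by (intro epow_ennreal) auto
    finally have avg: "epow ((\<integral>\<^sup>+y\<in>?E. epow (ennreal \<bar>\<rho> y\<bar>) p \<partial>\<mu>) / emeasure \<mu> ?E) (1 / p)
        \<le> ennreal ((j / m0) powr (1 / p))" .
    have "(\<integral>\<^sup>+y\<in>?B. e2ennreal \<bar>ereal (u y) - ereal uB\<bar> \<partial>\<mu>) / emeasure \<mu> ?B
        \<le> ennreal (CP * (3 * h)) * epow ((\<integral>\<^sup>+y\<in>?E. epow (ennreal \<bar>\<rho> y\<bar>) p \<partial>\<mu>) / emeasure \<mu> ?E) (1 / p)"
      using poin[THEN spec, THEN spec, THEN mp, OF conjI[OF h3 subB], THEN spec, THEN spec, THEN mp,
          OF conjI[OF meas conjI[OF int wug]]]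
      unfolding Let_def uB_def .
    also have "(\<integral>\<^sup>+y\<in>?B. e2ennreal \<bar>ereal (u y) - ereal uB\<bar> \<partial>\<mu>) = I"
      unfolding I_def by (simp add: \<mu> nn_integral_completion)
    also have "emeasure \<mu> ?B = ennreal m" by (simp add: emeasure_\<mu> m)
    also have "ennreal (CP * (3 * h)) * epow ((\<integral>\<^sup>+y\<in>?E. epow (ennreal \<bar>\<rho> y\<bar>) p \<partial>\<mu>) / emeasure \<mu> ?E) (1 / p)
        \<le> ennreal (CP * (3 * h)) * ennreal ((j / m0) powr (1 / p))"
      using avg by (rule mult_left_mono) simp
    finally have osc: "I / ennreal m \<le> ennreal (CP * (3 * h)) * ennreal ((j / m0) powr (1 / p))" .
    define b where "b = CP * (3 * h) * (j / m0) powr (1 / p)"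
    have b: "0 \<le> b" using CP h by (simp add: b_def)
    have "I = I / ennreal m * ennreal m"
      using m(2) mult_divide_eq_ennreal[of "ennreal m" I]
      by (simp add: mult.commute[of _ "ennreal m"] ennreal_times_divide)
    also have "\<dots> \<le> ennreal b * ennreal m"
      using osc CP h by (intro mult_right_mono) (auto simp: b_def ennreal_mult)
    finally have I_le: "I \<le> ennreal (b * m)" using b m by (simp add: ennreal_mult)
    have "ennreal (T * m) \<le> ennreal (CD ^ 3) * I"
      unfolding m_def I_def
    proof (rule oscillation_of_step[OF doub CD h _ u_left u_right])
      show "ball c (6 * h) \<subseteq> ball x0 r1" using sub by (force simp: R_def subset_iff)
    qed
    also have "\<dots> \<le> ennreal (CD ^ 3) * ennreal (b * m)" using I_le by (rule mult_left_mono) simp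
    finally have "T * m \<le> CD ^ 3 * (b * m)"
      using CD b m by (subst (asm) ennreal_mult[symmetric]) (auto simp: ennreal_le_iff)
    then have "T \<le> CD ^ 3 * b" using m by simp
    then have "T powr p \<le> (CD ^ 3 * b) powr p" using T0 p_pos by (intro powr_mono2) auto
    also have "CD ^ 3 * b = (CD ^ 3 * (CP * 3)) * (h * (j / m0) powr (1 / p))" by (simp add: b_def)
    also have "\<dots> powr p = K * (h powr p * (j / m0))"
      using CD CP h j m0 p_pos by (simp add: powr_mult K_def powr_powr)
    finally have "T powr p \<le> K * (h powr p * (j / m0))" .
    then show ?thesis unfolding m0_def[symmetric] using m0(2) by (simp add: field_simps)
  qed
  moreover have "0 < R" "0 < K" using r0 r1 CD CP by (auto simp: R_def K_def)
  ultimately show ?thesis unfolding bumps_controlled_def by (intro exI[of _ R] exI[of _ K]) auto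
qed

text \<open>
  The bump estimate for indicator functions.
\<close>

lemma measure_estimate:
  "\<exists>s>0. \<exists>K>0. \<forall>c h A. 0 < h \<and> h \<le> s \<and> \<bar>c - x0\<bar> \<le> s \<and> A \<in> sets borel \<and> A \<subseteq> ball c h \<longrightarrow>
     measure lborel A powr p * measure N (ball c h) \<le> K * h powr p * measure N A"
proof -
  obtain R K where R: "0 < R" and K: "0 < K"
    and est: "bumps_controlled x0 R K"
    using bump_estimate[of x0] by (elim exE conjE)
  have "measure lborel A powr p * measure N (ball c h) \<le> K * h powr p * measure N A"
    if h: "0 < h" "h \<le> R / 7" and c: "\<bar>c - x0\<bar> \<le> R / 7" and A: "A \<in> sets borel" "A \<subseteq> ball c h" for c h A
  proof -
    note [measurable] = A(1)
    have "A \<subseteq> {c - h<..<c + h}" using A(2) by (simp only: ball_eq_greaterThanLessThan)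
    then have A_Icc: "A \<subseteq> {c - h..c + h}" by (rule order_trans) auto
    \<comment> \<open>The radius \<open>R / 7\<close> leaves room for \<open>\<bar>c - x0\<bar> + 6 * h\<close>.\<close>
    have sub: "ball c (6 * h) \<subseteq> ball x0 R"
    proof
      fix x assume "x \<in> ball c (6 * h)"
      then have "\<bar>c - x\<bar> < 6 * h" by (simp add: dist_real_def)
      then have "\<bar>x0 - x\<bar> < R" using h c by linarith
      then show "x \<in> ball x0 R" by (simp add: dist_real_def)
    qed
    have "locally_integrable (indicator A)"
      unfolding locally_integrable_iff
    proof (intro conjI allI)
      fix a b :: real
      have "(\<integral>\<^sup>+x\<in>{a..b}. ennreal \<bar>indicator A x\<bar> \<partial>lborel) \<le> (\<integral>\<^sup>+x. indicator {a..b} x \<partial>lborel)"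
        by (intro nn_integral_mono) (auto simp: indicator_def)
      also have "\<dots> < \<infinity>" by (simp add: emeasure_lborel_Icc_eq)
      finally show "(\<integral>\<^sup>+x\<in>{a..b}. ennreal \<bar>indicator A x\<bar> \<partial>lborel) < \<infinity>" .
    qed measurable
    moreover have "(\<integral>\<^sup>+x. ennreal ((indicator A x) powr p) \<partial>N) \<le> ennreal (measure N A)"
    proof -
      have "(\<integral>\<^sup>+x. ennreal ((indicator A x) powr p) \<partial>N) = (\<integral>\<^sup>+x. indicator A x \<partial>N)"
        using p_pos by (intro nn_integral_cong) (auto simp: indicator_def)
      also have "\<dots> = emeasure N A" using A by (intro nn_integral_indicator) (simp add: sets_N)
      also have "\<dots> = ennreal (measure N A)"
        using bounded_finite[OF A(2)] by (intro emeasure_eq_ennreal_measure) (simp add: less_top)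
      finally show ?thesis by simp
    qed
    ultimately have "(LINT x:{c - h..c + h}|lborel. indicator A x) powr p * measure N (ball c h) \<le> K * h powr p * measure N A"
      using h sub A(2) by (intro est[unfolded bumps_controlled_def, THEN spec, THEN spec, THEN spec, THEN spec, THEN mp] conjI allI impI)
        (auto simp: indicator_eq_0_iff)
    moreover have "(LINT x:{c - h..c + h}|lborel. indicator A x) = measure lborel A"
    proof -
      have "(LINT x:{c - h..c + h}|lborel. indicator A x) = (LINT x|lborel. (indicator A x :: real))"
        unfolding set_lebesgue_integral_def
        by (intro Bochner_Integration.integral_cong) (use A_Icc in \<open>auto simp: indicator_def\<close>)
      then show ?thesis by simp
    qed
    ultimately show ?thesis by simp
  qed
  then show ?thesis using R K by (intro exI[of _ "R / 7"] exI[of _ K]) auto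
qed

text \<open>
  For a Lebesgue null set \<open>Z\<close>, the set \<open>J - Z\<close> has the same length as the interval \<open>J\<close>. Hence the
  bump estimate for its indicator bounds \<open>N J\<close> by a multiple of \<open>N (J - Z)\<close>. Such an inequality for all
  small intervals extends to all Borel sets, and applied to \<open>Z\<close> itself it gives \<open>N Z = 0\<close>. This
  excludes a singular part of the measure.
\<close>

lemma lborel_null_imp_null:
  assumes Z: "Z \<in> null_sets lborel"
  shows "emeasure N Z = 0"
proof (rule emeasure_eq_0_of_local)
  have Zb[measurable]: "Z \<in> sets borel" using Z by (auto simp: null_sets_def)
  then show "Z \<in> sets N" by (simp add: sets_N)
  show "sets N = sets borel" by (rule sets_N)
  note [measurable_cong] = sets_N
  fix x0 :: real
  obtain s K where s: "0 < s" and K: "0 < K"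
    and est: "\<forall>c h A. 0 < h \<and> h \<le> s \<and> \<bar>c - x0\<bar> \<le> s \<and> A \<in> sets borel \<and> A \<subseteq> ball c h \<longrightarrow>
     measure lborel A powr p * measure N (ball c h) \<le> K * h powr p * measure N A"
    using measure_estimate[of x0] by (elim exE conjE)
  let ?B = "ball x0 s"
  let ?\<nu>1 = "density N (\<lambda>x. indicator ?B x)" and ?\<nu>2 = "density N (\<lambda>x. ennreal K * indicator (?B - Z) x)"
  have e1: "emeasure ?\<nu>1 A = emeasure N (?B \<inter> A)" if "A \<in> sets borel" for A
    using that by (subst emeasure_density) (auto simp: sets_N indicator_inter_arith[symmetric])
  have e2: "emeasure ?\<nu>2 A = ennreal K * emeasure N ((?B - Z) \<inter> A)" if "A \<in> sets borel" for A
  proof -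
    have "emeasure ?\<nu>2 A = (\<integral>\<^sup>+x. ennreal K * indicator ((?B - Z) \<inter> A) x \<partial>N)"
      using that by (subst emeasure_density) (auto simp: sets_N indicator_inter_arith mult.assoc)
    also have "\<dots> = ennreal K * emeasure N ((?B - Z) \<inter> A)"
      using that by (intro nn_integral_cmult_indicator) (simp add: sets_N)
    finally show ?thesis .
  qed
  have "emeasure ?\<nu>1 Z \<le> emeasure ?\<nu>2 Z"
  proof (rule emeasure_le_of_intervals)
    show "emeasure ?\<nu>2 {a<..<b} < \<infinity>" for a b
      using bounded_finite[of "(?B - Z) \<inter> {a<..<b}" x0 s] by (simp add: e2 ennreal_mult_less_top subset_iff)
    show "emeasure ?\<nu>1 {a<..<b} \<le> emeasure ?\<nu>2 {a<..<b}" if "a < b" for a b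
    proof -
      define a' b' where "a' = max a (x0 - s)" and "b' = min b (x0 + s)"
      have I: "?B \<inter> {a<..<b} = {a'<..<b'}" by (auto simp: a'_def b'_def dist_real_def)
      show ?thesis
      proof (cases "a' < b'")
        case True
        define c h where "c = (a' + b') / 2" and "h = (b' - a') / 2"
        have ball: "ball c h = {a'<..<b'}"
          by (auto simp: c_def h_def dist_real_def abs_less_iff field_simps)
        have "x0 - s \<le> a'" "b' \<le> x0 + s" by (auto simp: a'_def b'_def)
        then have h: "0 < h" "h \<le> s" "\<bar>c - x0\<bar> \<le> s"
          using True unfolding c_def h_def by (simp_all add: abs_le_iff field_simps)
        \<comment> \<open>Removing \<open>Z\<close> does not change the Lebesgue measure, which forces \<open>N\<close> to charge \<open>ball c h - Z\<close>.\<close>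
        let ?A = "ball c h - Z"
        have "emeasure lborel ?A = emeasure lborel (ball c h)"
          using Z by (intro emeasure_Diff_null_set) auto
        also have "\<dots> = ennreal (2 * h)" unfolding ball using True by (simp add: h_def)
        finally have mA: "measure lborel ?A = 2 * h" using h by (simp add: measure_def)
        have "(2 * h) powr p * measure N (ball c h) \<le> K * h powr p * measure N ?A"
          using est[THEN spec, THEN spec, THEN spec, THEN mp, of h c ?A] h unfolding mA by simp
        then have "h powr p * (2 powr p * measure N (ball c h)) \<le> h powr p * (K * measure N ?A)"
          using h by (simp add: powr_mult mult_ac)
        then have "2 powr p * measure N (ball c h) \<le> K * measure N ?A" using h by simp
        moreover have "1 * measure N (ball c h) \<le> 2 powr p * measure N (ball c h)"
          using p_pos by (intro mult_right_mono) (auto intro: ge_one_powr_ge_zero)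
        ultimately have le: "measure N (ball c h) \<le> K * measure N ?A" by simp
        have "emeasure N (ball c h) = ennreal (measure N (ball c h))" by (rule ball_measure(1)[OF h(1)])
        also have "\<dots> \<le> ennreal (K * measure N ?A)" using le by (rule ennreal_leI)
        also have "\<dots> = ennreal K * ennreal (measure N ?A)" using K by (intro ennreal_mult) auto
        also have "ennreal (measure N ?A) = emeasure N ?A"
          using bounded_finite[of ?A c h] by (intro emeasure_eq_ennreal_measure[symmetric]) (auto simp: less_top)
        also have "?A = (?B - Z) \<inter> {a<..<b}" using I ball by auto
        finally have "emeasure N (?B \<inter> {a<..<b}) \<le> ennreal K * emeasure N ((?B - Z) \<inter> {a<..<b})"
          unfolding I ball .
        then show ?thesis by (simp add: e1 e2)
      next
        case False
        then have "?B \<inter> {a<..<b} = {}" unfolding I by auto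
        then show ?thesis by (simp add: e1)
      qed
    qed
  qed (auto simp: sets_N)
  also have "emeasure ?\<nu>2 Z = 0"
  proof -
    have "(?B - Z) \<inter> Z = {}" by auto
    then show ?thesis by (simp add: e2)
  qed
  finally show "\<exists>s>0. emeasure N (Z \<inter> ball x0 s) = 0" using s by (auto simp: e1 Int_commute)
qed

text \<open>
  The bump estimate for the indicator of \<open>A\<close> bounds the length of \<open>A\<close> by its measure.
\<close>

lemma null_imp_lborel_null:
  assumes A: "A \<in> sets borel" "emeasure N A = 0"
  shows "emeasure lborel A = 0"
proof (rule emeasure_eq_0_of_local)
  fix x0 :: real
  obtain s K where s: "0 < s" and K: "0 < K"
    and est: "\<forall>c h A. 0 < h \<and> h \<le> s \<and> \<bar>c - x0\<bar> \<le> s \<and> A \<in> sets borel \<and> A \<subseteq> ball c h \<longrightarrow>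
     measure lborel A powr p * measure N (ball c h) \<le> K * h powr p * measure N A"
    using measure_estimate[of x0] by (elim exE conjE)
  let ?A = "A \<inter> ball x0 s"
  have "emeasure N ?A \<le> emeasure N A" using A by (intro emeasure_mono) (auto simp: sets_N)
  then have N0: "measure N ?A = 0" using A by (simp add: measure_def)
  have "measure lborel ?A powr p * measure N (ball x0 s) \<le> K * s powr p * measure N ?A"
    using est[THEN spec, THEN spec, THEN spec, THEN mp, of s x0 ?A] s A(1) by simp
  then have "measure lborel ?A powr p * measure N (ball x0 s) \<le> 0" by (simp add: N0)
  then have "measure lborel ?A powr p \<le> 0"
    using ball_measure(2)[OF s, of x0] by (simp add: mult_le_0_iff)
  then have m0: "measure lborel ?A = 0" by (auto simp: powr_def split: if_splits)
  have "emeasure lborel ?A \<le> emeasure lborel (ball x0 s)" by (intro emeasure_mono) auto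
  also have "\<dots> < \<infinity>" using emeasure_bounded_finite[of "ball x0 s"] by simp
  finally have "emeasure lborel ?A = ennreal (measure lborel ?A)"
    by (intro emeasure_eq_ennreal_measure) (simp add: less_top)
  then have "emeasure lborel ?A = 0" by (simp add: m0)
  then show "\<exists>s>0. emeasure lborel (A \<inter> ball x0 s) = 0" using s by auto
qed (use A in auto)

lemma positive_density:
  "\<exists>w\<in>borel_measurable borel. (\<forall>x. 0 < w x) \<and> N = density lborel (\<lambda>x. ennreal (w x))"
proof -
  have "absolutely_continuous lborel N"
    unfolding absolutely_continuous_def
  proof (rule subsetI)
    fix Z :: "real set" assume Z: "Z \<in> null_sets lborel"
    then show "Z \<in> null_sets N"
      using lborel_null_imp_null[OF Z] by (auto simp: null_sets_def sets_N)
  qed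
  then obtain W where W: "W \<in> borel_measurable lborel" and dW: "density lborel W = N"
    using sigma_finite_measure.Radon_Nikodym[OF sigma_finite_lborel, of N] sets_N by auto
  then have W_meas[measurable]: "W \<in> borel_measurable borel" by simp
  have "(\<integral>\<^sup>+x\<in>{a..b}. W x \<partial>lborel) < \<infinity>" for a b
  proof -
    have "{a..b} \<subseteq> ball 0 (max \<bar>a\<bar> \<bar>b\<bar> + 1)" by (auto simp: dist_real_def)
    then have "emeasure (density lborel W) {a..b} < \<infinity>" unfolding dW by (rule bounded_finite)
    then show ?thesis by (simp add: emeasure_density)
  qed
  then have W_fin: "AE x in lborel. W x = ennreal (enn2real (W x))"
    by (intro locally_integrable_enn2real) auto
  have "emeasure N {x. W x = 0} = (\<integral>\<^sup>+x. W x * indicator {x. W x = 0} x \<partial>lborel)"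
    unfolding dW[symmetric] by (subst emeasure_density) auto
  also have "\<dots> = nn_integral lborel (\<lambda>x::real. 0)" by (intro nn_integral_cong) (auto simp: indicator_def)
  finally have "emeasure lborel {x. W x = 0} = 0" by (intro null_imp_lborel_null) auto
  then have "{x. W x = 0} \<in> null_sets lborel" by (simp add: null_sets_def)
  then have W_pos: "AE x in lborel. W x \<noteq> 0" using AE_not_in by fastforce
  \<comment> \<open>The default 1 replaces the values 0 and \<open>\<infinity>\<close> of \<open>W\<close>, which occur only on a null set.\<close>
  define w where "w x = (if 0 < enn2real (W x) then enn2real (W x) else 1)" for x
  have w[measurable]: "w \<in> borel_measurable borel" unfolding w_def by measurable
  have "AE x in lborel. W x = ennreal (w x)"
    using W_fin W_pos
  proof eventually_elim
    case (elim x)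
    then have "enn2real (W x) \<noteq> 0" by (metis ennreal_0)
    then show ?case using elim(1) by (simp add: w_def less_le)
  qed
  then have "density lborel W = density lborel (\<lambda>x. ennreal (w x))"
    by (intro density_cong) auto
  then show ?thesis using w dW by (intro bexI[of _ w]) (auto simp: w_def)
qed

text \<open>
  The extremal bump is the dual weight itself. Since it is not known to be integrable beforehand, it
  is truncated first.
\<close>

lemma dual_weight_locally_finite:
  assumes w[measurable]: "w \<in> borel_measurable borel" and pos: "\<And>x. 0 < w x"
    and N: "N = density lborel (\<lambda>x. ennreal (w x))"
  shows "\<exists>r>0. (\<integral>\<^sup>+x\<in>ball x0 r. ennreal (w x powr (1 / (1 - p))) \<partial>lborel) < \<infinity>"
proof -
  obtain R K where R: "0 < R" and K: "0 < K"
    and est: "bumps_controlled x0 R K"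
    using bump_estimate[of x0] by (elim exE conjE)
  define \<sigma> where "\<sigma> x = w x powr (1 / (1 - p))" for x
  have [measurable]: "\<sigma> \<in> borel_measurable borel" unfolding \<sigma>_def by measurable
  have \<sigma>0: "0 < \<sigma> x" for x using pos[of x] by (simp add: \<sigma>_def)
  have \<sigma>p: "\<sigma> x powr p * w x = \<sigma> x" for x
    unfolding \<sigma>_def by (rule powr_dual_exponent[OF p pos])
  define h where "h = R / 6"
  have h: "0 < h" using R by (simp add: h_def)
  define m0 where "m0 = measure N (ball x0 h)"
  have m0: "0 < m0" unfolding m0_def by (rule ball_measure(2)[OF h])
  define \<kappa> where "\<kappa> = (K * h powr p / m0) powr (1 / (p - 1))"
  define S where "S n = ball x0 h \<inter> {x. \<sigma> x \<le> real n}" for n :: nat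
  have [measurable]: "S n \<in> sets borel" for n unfolding S_def by measurable
  have bound: "(\<integral>\<^sup>+x\<in>S n. ennreal (\<sigma> x) \<partial>lborel) \<le> ennreal \<kappa>" for n
  proof -
    \<comment> \<open>The bump is the truncated dual weight. Its energy is its integral \<open>T\<close>, so the estimate
        reads \<open>T powr p \<le> const * T\<close> and bounds \<open>T\<close> independently of \<open>n\<close>.\<close>
    define \<rho> where "\<rho> x = \<sigma> x * indicator (S n) x" for x
    have [measurable]: "\<rho> \<in> borel_measurable borel" unfolding \<rho>_def by measurable
    have \<rho>0: "0 \<le> \<rho> x" for x using \<sigma>0[of x] by (simp add: \<rho>_def)
    have \<rho>_le: "\<rho> x \<le> real n" for x by (auto simp: \<rho>_def S_def indicator_def)
    have \<rho>: "locally_integrable \<rho>"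
      unfolding locally_integrable_iff
    proof (intro conjI allI)
      fix a b :: real
      have "(\<integral>\<^sup>+x\<in>{a..b}. ennreal \<bar>\<rho> x\<bar> \<partial>lborel) \<le> (\<integral>\<^sup>+x. ennreal (real n) * indicator {a..b} x \<partial>lborel)"
        using \<rho>_le \<rho>0 by (intro nn_integral_mono mult_right_mono ennreal_leI) auto
      also have "\<dots> = ennreal (real n) * emeasure lborel {a..b}" by (intro nn_integral_cmult_indicator) simp
      also have "\<dots> < \<infinity>" by (simp add: emeasure_lborel_Icc_eq ennreal_mult_less_top)
      finally show "(\<integral>\<^sup>+x\<in>{a..b}. ennreal \<bar>\<rho> x\<bar> \<partial>lborel) < \<infinity>" .
    qed measurable
    define T where "T = (LINT x:{x0 - h..x0 + h}|lborel. \<rho> x)"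
    have T0: "0 \<le> T"
      unfolding T_def by (rule lborel_set_integral_nonneg) (simp add: \<rho>0)
    have supp: "\<rho> x = 0" if "x \<notin> ball x0 h" for x using that by (simp add: \<rho>_def S_def)
    have "ennreal T = (\<integral>\<^sup>+x\<in>{x0 - h..x0 + h}. ennreal (\<rho> x) \<partial>lborel)"
      unfolding T_def by (rule set_integral_eq_nn_integral_nonneg[OF \<rho> \<rho>0])
    also have "\<dots> = (\<integral>\<^sup>+x\<in>S n. ennreal (\<sigma> x) \<partial>lborel)"
      by (intro nn_integral_cong) (auto simp: \<rho>_def S_def indicator_def dist_real_def)
    finally have T: "ennreal T = (\<integral>\<^sup>+x\<in>S n. ennreal (\<sigma> x) \<partial>lborel)" .
    have "(\<integral>\<^sup>+x. ennreal (\<rho> x powr p) \<partial>N) = (\<integral>\<^sup>+x. ennreal (w x) * ennreal (\<rho> x powr p) \<partial>lborel)"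
      unfolding N by (intro nn_integral_density) auto
    also have "\<dots> = (\<integral>\<^sup>+x\<in>S n. ennreal (\<sigma> x) \<partial>lborel)"
    proof (intro nn_integral_cong)
      fix x
      have "ennreal (w x) * ennreal (\<sigma> x powr p) = ennreal (\<sigma> x)"
        using pos[of x] \<sigma>p[of x] by (subst ennreal_mult[symmetric]) (simp_all add: mult.commute)
      then show "ennreal (w x) * ennreal (\<rho> x powr p) = ennreal (\<sigma> x) * indicator (S n) x"
        using p_pos by (auto simp: \<rho>_def indicator_def)
    qed
    also have "\<dots> = ennreal T" by (rule T[symmetric])
    finally have \<rho>p: "(\<integral>\<^sup>+x. ennreal (\<rho> x powr p) \<partial>N) \<le> ennreal T" by simp
    have sub: "ball x0 (6 * h) \<subseteq> ball x0 R" by (simp add: h_def)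
    have "T powr p * m0 \<le> K * h powr p * T"
      unfolding T_def m0_def
      by (intro est[unfolded bumps_controlled_def, THEN spec, THEN spec, THEN spec, THEN spec, THEN mp] conjI allI impI)
        (use h sub \<rho> \<rho>0 supp T0 \<rho>p in \<open>auto simp: T_def\<close>)
    have "T \<le> \<kappa>"
    proof (cases "T = 0")
      case False
      then have Tpos: "0 < T" using T0 by simp
      have "T * (T powr (p - 1) * m0) \<le> T * (K * h powr p)"
        using \<open>T powr p * m0 \<le> K * h powr p * T\<close> Tpos by (simp add: powr_diff mult_ac)
      then have "T powr (p - 1) * m0 \<le> K * h powr p" using Tpos by simp
      then have "T powr (p - 1) \<le> K * h powr p / m0" using m0 by (simp add: pos_le_divide_eq)
      then have "(T powr (p - 1)) powr (1 / (p - 1)) \<le> \<kappa>"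
        unfolding \<kappa>_def using p by (intro powr_mono2) auto
      then show ?thesis using p Tpos by (simp add: powr_powr)
    qed (simp add: \<kappa>_def)
    then show ?thesis unfolding T[symmetric] by (rule ennreal_leI)
  qed
  let ?D = "density lborel (\<lambda>x. ennreal (\<sigma> x))"
  have "(\<lambda>n. emeasure ?D (S n)) \<longlonglongrightarrow> emeasure ?D (\<Union>n. S n)"
    by (rule Lim_emeasure_incseq) (auto simp: incseq_def S_def)
  moreover have "(\<Union>n. S n) = ball x0 h"
    using real_arch_simple by (auto simp: S_def)
  moreover have eD: "emeasure ?D A = (\<integral>\<^sup>+x\<in>A. ennreal (\<sigma> x) \<partial>lborel)" if "A \<in> sets borel" for A
    using that by (simp add: emeasure_density)
  ultimately have "(\<lambda>n. \<integral>\<^sup>+x\<in>S n. ennreal (\<sigma> x) \<partial>lborel) \<longlonglongrightarrow> (\<integral>\<^sup>+x\<in>ball x0 h. ennreal (\<sigma> x) \<partial>lborel)"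
    by simp
  then have "(\<integral>\<^sup>+x\<in>ball x0 h. ennreal (\<sigma> x) \<partial>lborel) \<le> ennreal \<kappa>"
    using bound by (intro LIMSEQ_le_const2) auto
  then have "(\<integral>\<^sup>+x\<in>ball x0 h. ennreal (\<sigma> x) \<partial>lborel) < \<infinity>" by (rule le_less_trans) simp
  then show ?thesis using h unfolding \<sigma>_def by blast
qed

lemma exists_weighted_line: "\<exists>w. weighted_line p \<mu> w"
proof -
  obtain w where w[measurable]: "w \<in> borel_measurable borel" and pos: "\<And>x. 0 < w x"
    and N: "N = density lborel (\<lambda>x. ennreal (w x))"
    using positive_density by blast
  have dens: "emeasure \<mu> A = (\<integral>\<^sup>+x\<in>A. ennreal (w x) \<partial>lborel)" if "A \<in> sets borel" for A
  proof -
    have "emeasure \<mu> A = emeasure (density lborel (\<lambda>x. ennreal (w x))) A"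
      using that by (simp only: emeasure_\<mu> N[symmetric])
    then show ?thesis using that by (simp add: emeasure_density)
  qed
  have "weighted_line p \<mu> w"
  proof (rule weighted_lineI[OF p _ w pos dens])
    show "complete_borel_measure \<mu>" using sets_N \<mu> by (auto simp: complete_borel_measure_def)
    show "(\<integral>\<^sup>+x\<in>{a..b}. ennreal (w x) \<partial>lborel) < \<infinity>" for a b
    proof -
      have "{a..b} \<subseteq> ball 0 (max \<bar>a\<bar> \<bar>b\<bar> + 1)" by (auto simp: dist_real_def)
      then have "emeasure N {a..b} < \<infinity>" by (rule bounded_finite)
      then show ?thesis using dens[of "{a..b}"] by (simp add: emeasure_\<mu>)
    qed
    show "(\<integral>\<^sup>+x\<in>{a..b}. ennreal (w x powr (1 / (1 - p))) \<partial>lborel) < \<infinity>" for a b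
      by (intro locally_finite_imp_finite_Icc dual_weight_locally_finite[OF w pos N]) measurable
  qed auto
  then show ?thesis by blast
qed

end

section \<open>Existence of nonconstant quasiharmonic functions\<close>

theorem theorem1p2:
  fixes p :: real and \<mu> :: "real measure"
  assumes "1 < p"
    and "complete_borel_measure \<mu>"
    and "positive_finite_on_balls \<mu>"
    and "locally_doubling \<mu>"
    and "local_poincare p \<mu>"
  shows
    "let a = (\<exists>u. p_harmonic p \<mu> u \<and> bounded (range u) \<and> \<not> u constant_on UNIV);
         b = (\<exists>u. p_harmonic p \<mu> u \<and> finite_energy p \<mu> u \<and> \<not> u constant_on UNIV);
         c = (\<exists>u. quasiharmonic p \<mu> u \<and> bounded (range u) \<and> \<not> u constant_on UNIV);
         d = (\<exists>u. quasiharmonic p \<mu> u \<and> finite_energy p \<mu> u \<and> \<not> u constant_on UNIV);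
         e = (\<exists>w. weight w \<and> has_weight \<mu> w \<and>
                  (\<integral>\<^sup>+x. epow (ennreal (w x)) (1 / (1 - p)) \<partial>lebesgue) < \<infinity>)
     in (a \<longleftrightarrow> b) \<and> (b \<longleftrightarrow> c) \<and> (c \<longleftrightarrow> d) \<and> (d \<longleftrightarrow> e)"
proof -
  let ?e = "\<exists>w. weight w \<and> has_weight \<mu> w \<and> (\<integral>\<^sup>+x. epow (ennreal (w x)) (1 / (1 - p)) \<partial>lebesgue) < \<infinity>"
  have harmonic: "quasiharmonic p \<mu> u" if "p_harmonic p \<mu> u" for u
    using that unfolding p_harmonic_def quasiharmonic_def by (auto intro!: exI[of _ 1])
  have e_ab: "\<exists>u. p_harmonic p \<mu> u \<and> bounded (range u) \<and> finite_energy p \<mu> u \<and> \<not> u constant_on UNIV" if e: ?e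
  proof -
    obtain w where "weighted_line p \<mu> w" and D: "(\<integral>\<^sup>+x. ennreal (w x powr (1 / (1 - p))) \<partial>lborel) < \<infinity>"
      using e weighted_line_of_weight[OF assms(1,2)] by blast
    then interpret weighted_line p \<mu> w by simp
    have "primitive (\<lambda>x. LBINT t=0..x. dual t) dual"
      by (rule primitive_exists[OF dual_locally_integrable])
    then show ?thesis using p_harmonic_dual_primitive D unfolding dual_def by blast
  qed
  have cd_e: ?e if u: "quasiharmonic p \<mu> u" "bounded (range u) \<or> finite_energy p \<mu> u" "\<not> u constant_on UNIV" for u
  proof -
    obtain N where "sets N = sets borel" "\<mu> = completion N"
      using assms(2) by (auto simp: complete_borel_measure_def)
    then interpret doubling_poincare_line p \<mu> N
      using assms by unfold_locales auto
    obtain w where "weighted_line p \<mu> w" using exists_weighted_line by blast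
    then interpret weighted_line p \<mu> w .
    have "(\<integral>\<^sup>+x. ennreal (dual x) \<partial>lborel) \<noteq> \<infinity>"
      using quasiharmonic_constant[OF _ u(1,2)] u(3) by blast
    then show ?thesis using weight_integral by (auto simp: less_top)
  qed
  show ?thesis
    unfolding Let_def using harmonic e_ab cd_e by blast
qed

end
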